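(* If $t\ge 3$, $n\ge 20t^2+23t+5$ and $\pi=(d_1,\ldots,d_n)$ is a graphic sequence with $\sigma(\pi)>4tn-2n-4t^2+2t+2$, then $\pi$ has a realization containing every 2-tree on $3t+1$ vertices as a subgraph.
   Context: A simple graph $G$ is a 2-tree if $G=K_3$, or $G$ has a vertex $v$ of degree 2 whose two neighbors are adjacent and $G-v$ is a 2-tree. A non-increasing sequence $\pi=(d_1,\ldots,d_n)$ of nonnegative integers is graphic if it is the degree sequence of some simple graph on $n$ vertices, called a realization of $\pi$. We write $\sigma(\pi)=d_1+\cdots+d_n$. *)

theory Defs
  imports
    "Graph_Theory.Digraph_Isomorphism"
    "Graph_Theory.Pair_Digraph"
    "Graph_Theory.Kuratowski"
    "HOL-Library.Multiset"
begin

(* Simple graphs are the finite symmetric loop-free digraphs without parallel arcs of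
   Graph_Theory (locales graph and pair_graph): an edge uv is the pair of arcs (u,v), (v,u).
   Hence the degree of a vertex is its out_degree. *)

inductive two_tree :: "('a, 'b) pre_digraph \<Rightarrow> bool" where
  triangle: "K\<^bsub>3\<^esub> G \<Longrightarrow> two_tree G"
| extend: "graph G \<Longrightarrow> v \<in> verts G \<Longrightarrow> out_degree G v = 2 \<Longrightarrow>
    x \<noteq> y \<Longrightarrow> v \<rightarrow>\<^bsub>G\<^esub> x \<Longrightarrow> v \<rightarrow>\<^bsub>G\<^esub> y \<Longrightarrow> x \<rightarrow>\<^bsub>G\<^esub> y \<Longrightarrow>
    two_tree (pre_digraph.del_vert G v) \<Longrightarrow> two_tree G"

definition degree_sequence :: "('a, 'b) pre_digraph \<Rightarrow> nat list" where
  "degree_sequence G =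
    rev (sorted_list_of_multiset (image_mset (out_degree G) (mset_set (verts G))))"

definition realization :: "'a pair_pre_digraph \<Rightarrow> nat list \<Rightarrow> bool" where
  "realization G \<pi> \<longleftrightarrow> pair_graph G \<and> degree_sequence G = \<pi>"

(* Every finite graph has an isomorphic copy with vertices in nat. *)
definition graphic :: "nat list \<Rightarrow> bool" where
  "graphic \<pi> \<longleftrightarrow> sorted_wrt (\<ge>) \<pi> \<and> (\<exists>G :: nat pair_pre_digraph. realization G \<pi>)"

(* Containment as a not necessarily induced subgraph, up to isomorphism. *)
definition contains_copy :: "'a pair_pre_digraph \<Rightarrow> 'b pair_pre_digraph \<Rightarrow> bool" where
  "contains_copy G T \<longleftrightarrow>
    (\<exists>H :: 'a pair_pre_digraph. subgraph (with_proj H) (with_proj G) \<and>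
      digraph_iso (with_proj T) (with_proj H))"

lemma del_vert_with_proj:
  "pre_digraph.del_vert (with_proj G) v =
    with_proj \<lparr> pverts = pverts G - {v}, parcs = {e \<in> parcs G. fst e \<noteq> v \<and> snd e \<noteq> v} \<rparr>"
  by (simp add: pre_digraph.del_vert_def with_proj_def)

lemma length_degree_sequence: "length (degree_sequence G) = card (verts G)"
  by (simp add: degree_sequence_def flip: size_mset)

lemma contains_copy_iff:
  assumes G: "pair_graph G" and T: "pair_graph T"
  shows "contains_copy G T \<longleftrightarrow>
    (\<exists>f. inj_on f (pverts T) \<and> f ` pverts T \<subseteq> pverts G \<and>
      (\<forall>(u, v) \<in> parcs T. (f u, f v) \<in> parcs G))"
proof
  assume "contains_copy G T"
  then obtain H h where H: "subgraph (with_proj H) (with_proj G)"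
    and h: "pre_digraph.digraph_isomorphism (with_proj T) h"
    and eq: "with_proj H = app_iso h (with_proj T)"
    unfolding contains_copy_def digraph_iso_def by blast
  from eq have hd: "iso_tail h = fst" "iso_head h = snd"
    and vs: "pverts H = iso_verts h ` pverts T" and es: "parcs H = iso_arcs h ` parcs T"
    by (simp_all add: with_proj_def app_iso_def)
  have "(iso_verts h u, iso_verts h v) \<in> parcs G" if "(u, v) \<in> parcs T" for u v
  proof -
    have "iso_arcs h (u, v) = (iso_verts h u, iso_verts h v)"
      using h that hd by (auto simp: pre_digraph.digraph_isomorphism_def prod_eq_iff)
    then show ?thesis using that es H by (force simp: subgraph_def)
  qed
  moreover have "inj_on (iso_verts h) (pverts T)" "iso_verts h ` pverts T \<subseteq> pverts G"
    using h H vs by (auto simp: pre_digraph.digraph_isomorphism_def subgraph_def)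
  ultimately show "\<exists>f. inj_on f (pverts T) \<and> f ` pverts T \<subseteq> pverts G \<and>
      (\<forall>(u, v) \<in> parcs T. (f u, f v) \<in> parcs G)" by blast
next
  assume "\<exists>f. inj_on f (pverts T) \<and> f ` pverts T \<subseteq> pverts G \<and>
      (\<forall>(u, v) \<in> parcs T. (f u, f v) \<in> parcs G)"
  then obtain f where f: "inj_on f (pverts T)" "f ` pverts T \<subseteq> pverts G"
    and f0: "\<forall>(u, v) \<in> parcs T. (f u, f v) \<in> parcs G" by (elim exE conjE)
  have f3: "(f u, f v) \<in> parcs G" if "(u, v) \<in> parcs T" for u v
    using f0 that by auto
  interpret G: pair_graph G by (rule G)
  interpret T: pair_graph T by (rule T)
  define h where "h = \<lparr> iso_verts = f, iso_arcs = map_prod f f,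
    iso_head = (snd :: 'a \<times> 'a \<Rightarrow> 'a), iso_tail = fst \<rparr>"
  define H where "H = \<lparr> pverts = f ` pverts T, parcs = map_prod f f ` parcs T \<rparr>"
  have sub: "parcs T \<subseteq> pverts T \<times> pverts T" by (auto dest: T.wellformed')
  have "inj_on (map_prod f f) (parcs T)"
    using map_prod_inj_on[OF f(1) f(1)] sub by (rule inj_on_subset)
  then have "pre_digraph.digraph_isomorphism (with_proj T) h"
    using f(1) by (auto simp: pre_digraph.digraph_isomorphism_def h_def wf_digraph_wp_iff
        intro: T.pair_wf_digraph)
  moreover have "with_proj H = app_iso h (with_proj T)"
    by (simp add: with_proj_def app_iso_def h_def H_def)
  moreover have "subgraph (with_proj H) (with_proj G)"
  proof -
    have "pair_wf_digraph H" by unfold_locales (auto simp: H_def dest: T.wellformed')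
    then show ?thesis using f(2) f3 G.pair_wf_digraph
      by (auto simp: subgraph_def compatible_def wf_digraph_wp_iff H_def)
  qed
  ultimately show "contains_copy G T"
    unfolding contains_copy_def digraph_iso_def by blast
qed

end

theory Submission
  imports Defs
begin

text \<open>Write \<open>r = 2 t - 1\<close>; the hypothesis says that \<open>\<pi>\<close> has at least \<open>r (n - t) + 2\<close> edges. A 2-tree on
  \<open>3 t + 1\<close> vertices has a 3-colouring in which any two classes span a forest; hence it
  embeds into each of a few explicit hosts, all of which contain a clique completely joined to a
  sparse rest. Realizations containing a host are found by extremality: take a realization that
  shares as many edges as possible with the wanted host. If a host edge is still missing, exchanging
  two or three edges would add it, unless nearly all edges avoiding the clique meet the neighbourhoods
  of two vertices; this contradicts the number of edges.

  If at least \<open>r\<close> vertices have degree at least \<open>4 t + 2\<close>, the clique consists of \<open>r\<close> vertices of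
  largest degree, joined to the next \<open>t + 4\<close> vertices, and the sparse rest contains a path with two
  edges or two disjoint edges. If only \<open>r - s\<close> vertices have such degrees, with \<open>s > 0\<close>, then many of
  the others have degree at least \<open>r + s\<close>, which leaves room for a sparse rest of maximum degree \<open>2 s\<close>.\<close>

section \<open>Realizations of a degree function and exchanges of edges\<close>

text \<open>The number \<open>r (n - t)\<close> counts the edges of a clique on \<open>r\<close>
  vertices joined to \<open>n - r\<close> independent vertices. A 2-tree on \<open>3 t + 1\<close>
  vertices without \<open>t + 2\<close> independent vertices does not fit into that graph, and the
  square of a path still does not fit after one edge is added to the independent part. Hence two
  surplus edges, and hence hosts with a cherry or two disjoint edges: a largest colour class has at
  least \<open>t + 1\<close> vertices, so the other two classes exceed the clique by at most one
  vertex, which has to live in the sparse rest next to its neighbours of the largest class.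

  The obstacle is that an exchange of two edges is blocked whenever the far ends are equal or
  adjacent. An exchange of three edges brings in an arbitrary further edge, so in a blocked
  realization every such edge is tied to two fixed neighbourhoods. This bounds the number of edges
  only if degrees outside the clique are bounded in terms of \<open>t\<close>. The degree
  \<open>6 t = 2 (3 t + 1) - 2\<close> is where this comes from: \<open>3 t + 1\<close> vertices of
  that degree already give a realization with a clique on \<open>3 t + 1\<close> vertices.\<close>

definition sgraph :: "'a set \<Rightarrow> 'a set set \<Rightarrow> bool" where
  "sgraph V E \<longleftrightarrow> finite V \<and> (\<forall>e\<in>E. e \<subseteq> V \<and> card e = 2)"

definition nbrs :: "'a set set \<Rightarrow> 'a \<Rightarrow> 'a set" where
  "nbrs E x = {y. {x, y} \<in> E}"

text \<open>Degrees are prescribed vertex by vertex rather than as a sorted list, because exchanges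
  keep every single degree. Sorted sequences return only in the final translation.\<close>

definition realizes :: "'a set \<Rightarrow> ('a \<Rightarrow> nat) \<Rightarrow> 'a set set \<Rightarrow> bool" where
  "realizes V d E \<longleftrightarrow> sgraph V E \<and> (\<forall>x\<in>V. card (nbrs E x) = d x)"

lemma in_nbrs: "y \<in> nbrs E x \<longleftrightarrow> {x, y} \<in> E"
  by (simp add: nbrs_def)

lemma in_nbrs_commute: "y \<in> nbrs E x \<longleftrightarrow> x \<in> nbrs E y"
  by (simp add: in_nbrs insert_commute)

lemma realizes_sgraph: "realizes V d E \<Longrightarrow> sgraph V E"
  by (simp add: realizes_def)

lemma realizes_card_nbrs: "realizes V d E \<Longrightarrow> x \<in> V \<Longrightarrow> card (nbrs E x) = d x"
  by (simp add: realizes_def)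

lemma sgraph_finite: "sgraph V E \<Longrightarrow> finite V"
  by (simp add: sgraph_def)

lemma sgraph_finite_edges: "sgraph V E \<Longrightarrow> finite E"
  by (rule finite_subset[of _ "Pow V"]) (auto simp: sgraph_def)

lemma sgraph_no_loop: "sgraph V E \<Longrightarrow> {x, y} \<in> E \<Longrightarrow> x \<noteq> y"
  by (metis One_nat_def card_1_singleton_iff insert_absorb2 n_not_Suc_n numeral_2_eq_2 sgraph_def)

lemma sgraph_ends: "sgraph V E \<Longrightarrow> {x, y} \<in> E \<Longrightarrow> x \<in> V \<and> y \<in> V"
  by (auto simp: sgraph_def)

lemma sgraph_edge: assumes "sgraph V E" "e \<in> E" obtains x y where "e = {x, y}" "x \<noteq> y" "x \<in> V" "y \<in> V"
proof -
  have "card e = 2" "e \<subseteq> V" using assms by (auto simp: sgraph_def)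
  then show thesis using that by (auto simp: card_2_iff)
qed

lemma sgraph_nbrs_subset: "sgraph V E \<Longrightarrow> nbrs E x \<subseteq> V"
  by (auto simp: in_nbrs dest: sgraph_ends)

lemma sgraph_finite_nbrs: "sgraph V E \<Longrightarrow> finite (nbrs E x)"
  by (meson finite_subset sgraph_finite sgraph_nbrs_subset)

lemma sgraph_not_self: "sgraph V E \<Longrightarrow> x \<notin> nbrs E x"
  using sgraph_no_loop[of V E x x] by (auto simp: in_nbrs)

lemma card_incident:
  assumes "sgraph V E" shows "card {e \<in> E. x \<in> e} = card (nbrs E x)"
proof -
  have "inj_on (\<lambda>y. {x, y}) (nbrs E x)"
    by (auto simp: inj_on_def doubleton_eq_iff)
  moreover have "(\<lambda>y. {x, y}) ` nbrs E x = {e \<in> E. x \<in> e}"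
  proof (intro equalityI subsetI)
    fix e assume "e \<in> {e \<in> E. x \<in> e}"
    then have e: "e \<in> E" "x \<in> e" by auto
    then obtain a b where "e = {a, b}" using sgraph_edge[OF assms] by metis
    with e show "e \<in> (\<lambda>y. {x, y}) ` nbrs E x" by (auto simp: in_nbrs insert_commute)
  qed (auto simp: in_nbrs)
  ultimately show ?thesis by (metis card_image)
qed

lemma sum_card_incident:
  assumes "finite P" "finite F"
  shows "(\<Sum>c\<in>P. card {e \<in> F. c \<in> e}) = (\<Sum>e\<in>F. card (e \<inter> P))"
proof -
  have "(\<Sum>c\<in>P. card {e \<in> F. c \<in> e}) = (\<Sum>c\<in>P. \<Sum>e\<in>F. if c \<in> e then 1 else 0)"
    using assms by (simp add: sum.If_cases Int_def)
  also have "\<dots> = (\<Sum>e\<in>F. \<Sum>c\<in>P. if c \<in> e then 1 else 0)" by (rule sum.swap)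
  also have "\<dots> = (\<Sum>e\<in>F. card (e \<inter> P))"
    using assms by (intro sum.cong refl) (simp add: sum.If_cases Int_def conj_commute)
  finally show ?thesis .
qed

lemma handshake:
  assumes "sgraph V E" shows "(\<Sum>x\<in>V. card (nbrs E x)) = 2 * card E"
proof -
  have "(\<Sum>x\<in>V. card (nbrs E x)) = (\<Sum>x\<in>V. card {e \<in> E. x \<in> e})"
    by (simp add: card_incident[OF assms])
  also have "\<dots> = (\<Sum>e\<in>E. card (e \<inter> V))"
    using assms by (intro sum_card_incident) (auto simp: sgraph_finite sgraph_finite_edges)
  also have "\<dots> = (\<Sum>e\<in>E. 2)"
    using assms by (intro sum.cong refl) (auto simp: sgraph_def Int_absorb2)
  finally show ?thesis by simp
qed

text \<open>An exchange is a set \<open>D\<close> of removed and a set \<open>A\<close> of added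
  edges; \<open>balance\<close> says that both have the same degree at every vertex. Coincidences
  among end points are left to the individual exchanges.\<close>

lemma realizes_exchange:
  assumes R: "realizes V d E" and D: "D \<subseteq> E" and A: "A \<inter> E = {}" "finite A"
    and new: "\<And>e. e \<in> A \<Longrightarrow> e \<subseteq> V \<and> card e = 2"
    and balance: "\<And>z. card {e \<in> D. z \<in> e} = card {e \<in> A. z \<in> e}"
  shows "realizes V d (E - D \<union> A)"
proof -
  have G: "sgraph V E" using R by (rule realizes_sgraph)
  have G': "sgraph V (E - D \<union> A)" using G new by (auto simp: sgraph_def)
  have fE: "finite E" using G by (rule sgraph_finite_edges)
  have "card (nbrs (E - D \<union> A) z) = card (nbrs E z)" for z
  proof -
    have "{e \<in> E - D \<union> A. z \<in> e} = ({e \<in> E. z \<in> e} - {e \<in> D. z \<in> e}) \<union> {e \<in> A. z \<in> e}"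
      by auto
    then have "card {e \<in> E - D \<union> A. z \<in> e} =
        card ({e \<in> E. z \<in> e} - {e \<in> D. z \<in> e}) + card {e \<in> A. z \<in> e}"
      using A fE by (simp only:) (intro card_Un_disjoint, auto)
    also have "card ({e \<in> E. z \<in> e} - {e \<in> D. z \<in> e}) = card {e \<in> E. z \<in> e} - card {e \<in> D. z \<in> e}"
      using D fE by (intro card_Diff_subset) (auto intro: finite_subset)
    also have "\<dots> + card {e \<in> A. z \<in> e} = card {e \<in> E. z \<in> e}"
    proof -
      have "card {e \<in> D. z \<in> e} \<le> card {e \<in> E. z \<in> e}" using D fE by (intro card_mono) auto
      then show ?thesis using balance[of z] by simp
    qed
    finally show ?thesis using card_incident[OF G] card_incident[OF G'] by simp
  qed
  with G' R show ?thesis by (simp add: realizes_def)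
qed

lemma card_filter_mem:
  "finite F \<Longrightarrow> card {e \<in> F. z \<in> e} = (\<Sum>e\<in>F. if z \<in> e then 1 else 0)"
  by (simp add: sum.If_cases Int_def)

text \<open>The closed walk \<open>x', x, y, y', q, p, x'\<close> alternates between edges and
  non-edges, so each visit to a vertex loses one edge and gains one. Vertices may coincide, for
  instance \<open>x' = y'\<close>; counting visits with the indicator \<open>?g\<close> covers these
  cases too.\<close>

lemma switch3:
  assumes R: "realizes V d E"
    and E: "{x, x'} \<in> E" "{y, y'} \<in> E" "{p, q} \<in> E"
    and N: "{x, y} \<notin> E" "{x', p} \<notin> E" "{y', q} \<notin> E"
    and ne: "x \<noteq> y" "x' \<noteq> p" "y' \<noteq> q"
  shows "realizes V d (E - {{x, x'}, {y, y'}, {p, q}} \<union> {{x, y}, {x', p}, {y', q}})"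
proof (rule realizes_exchange[OF R])
  have G: "sgraph V E" using R by (rule realizes_sgraph)
  have loops: "x \<noteq> x'" "y \<noteq> y'" "p \<noteq> q" using E sgraph_no_loop[OF G] by auto
  have V: "{x, x', y, y', p, q} \<subseteq> V" using E sgraph_ends[OF G] by auto
  show "e \<subseteq> V \<and> card e = 2" if "e \<in> {{x, y}, {x', p}, {y', q}}" for e
    using that V ne by auto
  have D: "{x, x'} \<noteq> {y, y'}" "{x, x'} \<noteq> {p, q}" "{y, y'} \<noteq> {p, q}"
    using E N ne loops by (auto simp: doubleton_eq_iff insert_commute)
  have A: "{x, y} \<noteq> {x', p}" "{x, y} \<noteq> {y', q}" "{x', p} \<noteq> {y', q}"
    using E N ne loops by (auto simp: doubleton_eq_iff insert_commute)
  fix z :: 'a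
  let ?g = "\<lambda>w. if z = w then 1 else (0::nat)"
  have "card {e \<in> {{x, x'}, {y, y'}, {p, q}}. z \<in> e} = ?g x + ?g x' + ?g y + ?g y' + ?g p + ?g q"
    using D loops by (subst card_filter_mem) auto
  moreover have "card {e \<in> {{x, y}, {x', p}, {y', q}}. z \<in> e} = ?g x + ?g x' + ?g y + ?g y' + ?g p + ?g q"
    using A ne by (subst card_filter_mem) auto
  ultimately show "card {e \<in> {{x, x'}, {y, y'}, {p, q}}. z \<in> e} = card {e \<in> {{x, y}, {x', p}, {y', q}}. z \<in> e}"
    by simp
qed (use E N in auto)

lemma switch2:
  assumes R: "realizes V d E"
    and E: "{x, x'} \<in> E" "{y, y'} \<in> E"
    and N: "{x, y} \<notin> E" "{x', y'} \<notin> E"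
    and ne: "x \<noteq> y" "x' \<noteq> y'"
  shows "realizes V d (E - {{x, x'}, {y, y'}} \<union> {{x, y}, {x', y'}})"
proof (rule realizes_exchange[OF R])
  have G: "sgraph V E" using R by (rule realizes_sgraph)
  have loops: "x \<noteq> x'" "y \<noteq> y'" using E sgraph_no_loop[OF G] by auto
  have V: "{x, x', y, y'} \<subseteq> V" using E sgraph_ends[OF G] by auto
  show "e \<subseteq> V \<and> card e = 2" if "e \<in> {{x, y}, {x', y'}}" for e
    using that V ne by auto
  have D: "{x, x'} \<noteq> {y, y'}" and A: "{x, y} \<noteq> {x', y'}"
    using E N ne loops by (auto simp: doubleton_eq_iff insert_commute)
  fix z :: 'a
  let ?g = "\<lambda>w. if z = w then 1 else (0::nat)"
  have "card {e \<in> {{x, x'}, {y, y'}}. z \<in> e} = ?g x + ?g x' + ?g y + ?g y'"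
    using D loops by (subst card_filter_mem) auto
  moreover have "card {e \<in> {{x, y}, {x', y'}}. z \<in> e} = ?g x + ?g x' + ?g y + ?g y'"
    using A ne by (subst card_filter_mem) auto
  ultimately show "card {e \<in> {{x, x'}, {y, y'}}. z \<in> e} = card {e \<in> {{x, y}, {x', y'}}. z \<in> e}"
    by simp
qed (use E N in auto)

section \<open>Realizations with maximal overlap with a wanted edge set\<close>

lemma exists_maximal_overlap:
  assumes "realizes V d E"
  obtains E' where "realizes V d E'"
    "\<And>E''. realizes V d E'' \<Longrightarrow> card (E'' \<inter> U) \<le> card (E' \<inter> U)"
proof -
  have fin: "finite V" using assms realizes_sgraph sgraph_finite by blast
  have "\<forall>F. realizes V d F \<longrightarrow> card (F \<inter> U) < Suc (card (Pow V))"
  proof (intro allI impI)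
    fix F assume "realizes V d F"
    then have "F \<inter> U \<subseteq> Pow V" by (auto simp: realizes_def sgraph_def)
    then show "card (F \<inter> U) < Suc (card (Pow V))" using fin by (intro le_imp_less_Suc card_mono) auto
  qed
  from ex_has_greatest_nat[of "realizes V d", OF assms this] show thesis
    using that by auto
qed

text \<open>Inner edges are counted as pairs and the others by their end in \<open>H\<close>, so
  nothing is counted twice. For \<open>card H = 2 t - 1\<close> and full adjacency to the outside
  the right-hand side is exactly \<open>r (n - t)\<close>.\<close>

lemma card_edges_meeting:
  assumes G: "sgraph V E" and "finite H"
  shows "card {e \<in> E. e \<inter> H \<noteq> {}} \<le> (card H choose 2) + (\<Sum>b\<in>H. card (nbrs E b - H))"
proof -
  let ?I = "{e. e \<subseteq> H \<and> card e = 2}" and ?O = "\<Union>b\<in>H. (\<lambda>y. {b, y}) ` (nbrs E b - H)"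
  have "{e \<in> E. e \<inter> H \<noteq> {}} \<subseteq> ?I \<union> ?O"
  proof
    fix e assume e: "e \<in> {e \<in> E. e \<inter> H \<noteq> {}}"
    then obtain x y where xy: "e = {x, y}" "x \<noteq> y" using sgraph_edge[OF G] by blast
    show "e \<in> ?I \<union> ?O"
    proof (cases "x \<in> H \<and> y \<in> H")
      case True then show ?thesis using xy by auto
    next
      case False
      then have "(x \<in> H \<and> y \<in> nbrs E x - H) \<or> (y \<in> H \<and> x \<in> nbrs E y - H)"
        using e xy by (auto simp: in_nbrs insert_commute)
      then show ?thesis using xy by (auto simp: insert_commute)
    qed
  qed
  moreover have fin: "finite ?I" "finite ?O"
    using assms sgraph_finite_nbrs[OF G] by (auto intro: finite_subset[of _ "Pow H"])
  ultimately have "card {e \<in> E. e \<inter> H \<noteq> {}} \<le> card (?I \<union> ?O)" by (intro card_mono) auto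
  also have "\<dots> \<le> card ?I + card ?O" by (rule card_Un_le)
  also have "card ?I = card H choose 2" using assms by (simp add: n_subsets)
  also have "card ?O \<le> (\<Sum>b\<in>H. card ((\<lambda>y. {b, y}) ` (nbrs E b - H)))"
    using assms by (intro card_UN_le)
  also have "\<dots> \<le> (\<Sum>b\<in>H. card (nbrs E b - H))"
    using sgraph_finite_nbrs[OF G] by (intro sum_mono card_image_le) auto
  finally show ?thesis by simp
qed

lemma card_edges_split:
  assumes "finite E"
  shows "card E = card {e \<in> E. e \<inter> H \<noteq> {}} + card {e \<in> E. e \<inter> H = {}}"
proof -
  have "E = {e \<in> E. e \<inter> H \<noteq> {}} \<union> {e \<in> E. e \<inter> H = {}}" by auto
  then show ?thesis using assms
    by (metis (no_types, lifting) card_Un_disjoint disjoint_iff finite_Un mem_Collect_eq)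
qed

lemma realizes_card_edges:
  assumes "realizes V d E" shows "2 * card E = (\<Sum>x\<in>V. d x)"
  using handshake[of V E] assms by (simp add: realizes_def)

definition max_overlap :: "'a set \<Rightarrow> ('a \<Rightarrow> nat) \<Rightarrow> 'a set set \<Rightarrow> 'a set set \<Rightarrow> bool" where
  "max_overlap V d U E \<longleftrightarrow> realizes V d E \<and>
    (\<forall>E'. realizes V d E' \<longrightarrow> card (E' \<inter> U) \<le> card (E \<inter> U))"

lemma max_overlap_no_gain:
  assumes M: "max_overlap V d U E" and R': "realizes V d E'"
    and "E \<inter> U \<subseteq> E'" "e \<in> U" "e \<in> E'"
  shows "e \<in> E"
proof (rule ccontr)
  assume e: "e \<notin> E"
  have "realizes V d E" using M by (simp add: max_overlap_def)
  then have fE: "finite (E \<inter> U)" using realizes_sgraph sgraph_finite_edges by blast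
  have "finite (E' \<inter> U)" using R' realizes_sgraph sgraph_finite_edges by blast
  then have "card (insert e (E \<inter> U)) \<le> card (E' \<inter> U)" using assms by (intro card_mono) auto
  then have "card (E \<inter> U) < card (E' \<inter> U)" using fE e by simp
  moreover have "card (E' \<inter> U) \<le> card (E \<inter> U)" using M R' unfolding max_overlap_def by blast
  ultimately show False by simp
qed

text \<open>The exchange would gain \<open>xy\<close> and destroy no edge of \<open>U\<close>, so it
  must be blocked at \<open>x'p\<close> or at \<open>y'q\<close>. As \<open>p\<close> and
  \<open>q\<close> can be interchanged, every edge \<open>pq\<close> outside \<open>U\<close> is
  tied in both orders to the closed neighbourhoods of \<open>x'\<close> and \<open>y'\<close>; the
  upper bounds on the edges avoiding the clique all start here.\<close>

lemma max_overlap_switch3: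
  assumes M: "max_overlap V d U E" and xy: "{x, y} \<in> U" "{x, y} \<notin> E" "x \<noteq> y"
    and E: "{x, x'} \<in> E - U" "{y, y'} \<in> E - U" "{p, q} \<in> E - U"
  shows "p = x' \<or> {x', p} \<in> E \<or> q = y' \<or> {y', q} \<in> E"
proof (rule ccontr)
  assume neg: "\<not> ?thesis"
  have "realizes V d E" using M by (simp add: max_overlap_def)
  then have "realizes V d (E - {{x, x'}, {y, y'}, {p, q}} \<union> {{x, y}, {x', p}, {y', q}})"
    using E xy neg by (intro switch3) auto
  from max_overlap_no_gain[OF M this, of "{x, y}"] show False using E xy by auto
qed

lemma max_overlap_switch2:
  assumes M: "max_overlap V d U E" and xy: "{x, y} \<in> U" "{x, y} \<notin> E" "x \<noteq> y"
    and E: "{x, x'} \<in> E - U" "{y, y'} \<in> E - U"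
  shows "x' = y' \<or> {x', y'} \<in> E"
proof (rule ccontr)
  assume neg: "\<not> ?thesis"
  have "realizes V d E" using M by (simp add: max_overlap_def)
  then have "realizes V d (E - {{x, x'}, {y, y'}} \<union> {{x, y}, {x', y'}})"
    using E xy neg by (intro switch2) auto
  from max_overlap_no_gain[OF M this, of "{x, y}"] show False using E xy by auto
qed

lemma exists_max_overlap:
  assumes "realizes V d E" obtains E' where "max_overlap V d U E'"
  using exists_maximal_overlap[OF assms, of U] that unfolding max_overlap_def by blast

text \<open>The condition applies to both orders of the ends, so an edge has both ends in
  \<open>P\<close>, or both in \<open>Q\<close>, or one end in \<open>P \<inter> Q\<close>; in each
  case it is counted twice on the right. This halves the bound that comes from merely meeting
  \<open>P \<union> Q\<close>.\<close>

lemma card_constrained_edges: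
  assumes G: "sgraph V E" and F: "F \<subseteq> E" and fin: "finite P" "finite Q"
    and c: "\<And>p q. {p, q} \<in> F \<Longrightarrow> p \<in> P \<or> q \<in> Q"
  shows "2 * card F \<le> (\<Sum>c\<in>P. card {e \<in> F. c \<in> e}) + (\<Sum>c\<in>Q. card {e \<in> F. c \<in> e})"
proof -
  have fF: "finite F" using sgraph_finite_edges[OF G] F by (rule finite_subset[rotated])
  have "2 * card F = (\<Sum>e\<in>F. 2)" by simp
  also have "\<dots> \<le> (\<Sum>e\<in>F. card (e \<inter> P) + card (e \<inter> Q))"
  proof (rule sum_mono)
    fix e assume e: "e \<in> F"
    then obtain p q where pq: "e = {p, q}" "p \<noteq> q" using sgraph_edge[OF G] F by blast
    have "p \<in> P \<or> q \<in> Q" "q \<in> P \<or> p \<in> Q" using e pq c by (auto simp: insert_commute)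
    then show "2 \<le> card (e \<inter> P) + card (e \<inter> Q)" using pq
      by (auto simp: Int_insert_left card_insert_if)
  qed
  also have "\<dots> = (\<Sum>c\<in>P. card {e \<in> F. c \<in> e}) + (\<Sum>c\<in>Q. card {e \<in> F. c \<in> e})"
    using fin fF by (simp add: sum.distrib sum_card_incident)
  finally show ?thesis .
qed

lemma realizes_card_edges_eq:
  assumes "realizes V d E" "realizes V d E'" shows "card E = card E'"
  using realizes_card_edges[OF assms(1)] realizes_card_edges[OF assms(2)] by simp

lemma card_nbrs_diff_le:
  assumes "sgraph V E" "H \<subseteq> V" shows "card (nbrs E b - H) \<le> card V - card H"
proof -
  have "nbrs E b - H \<subseteq> V - H" using sgraph_nbrs_subset[OF assms(1)] by auto
  then have "card (nbrs E b - H) \<le> card (V - H)"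
    using sgraph_finite[OF assms(1)] by (intro card_mono) auto
  also have "\<dots> = card V - card H"
    using assms sgraph_finite by (intro card_Diff_subset) (auto intro: finite_subset)
  finally show ?thesis .
qed

lemma card_edges_at_le:
  assumes "realizes V d E" "F \<subseteq> E" "c \<in> V" shows "card {e \<in> F. c \<in> e} \<le> d c"
proof -
  have G: "sgraph V E" using assms by (simp add: realizes_def)
  have "card {e \<in> F. c \<in> e} \<le> card {e \<in> E. c \<in> e}"
    using assms sgraph_finite_edges[OF G] by (intro card_mono) auto
  then show ?thesis using card_incident[OF G] assms by (simp add: realizes_def)
qed

text \<open>If a host edge \<open>xy\<close> is missing at maximal overlap, then \<open>x\<close>
  and \<open>y\<close> have edges \<open>xx'\<close> and \<open>yy'\<close> outside
  \<open>U\<close>, with \<open>x'\<close> and \<open>y'\<close> outside \<open>H\<close>. The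
  remaining edges that avoid \<open>H\<close> and \<open>U\<close> are tied to two closed
  neighbourhoods with at most \<open>\<mu> + 1\<close> vertices outside \<open>H\<close>, each of
  degree at most \<open>\<mu>\<close>, so there are at most \<open>\<mu> (\<mu> + 1)\<close> of
  them; \<open>big\<close> says that the realization has more.\<close>

lemma realizes_containing:
  assumes R: "realizes V d E" and HX: "H \<subseteq> X" "X \<subseteq> V" and U: "sgraph X U"
    and join: "\<And>h x. h \<in> H \<Longrightarrow> x \<in> X \<Longrightarrow> h \<noteq> x \<Longrightarrow> {h, x} \<in> U"
    and degU: "\<And>x. x \<in> X \<Longrightarrow> card (nbrs U x) \<le> d x"
    and low: "\<And>x. x \<in> V - H \<Longrightarrow> d x \<le> \<mu>"
    and big: "(card H choose 2) + card H * (card V - card H)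
      + card {e \<in> U. e \<inter> H = {}} + \<mu> * (\<mu> + 1) < card E"
  obtains E' where "realizes V d E'" "U \<subseteq> E'"
proof -
  obtain E' where M: "max_overlap V d U E'" using exists_max_overlap[OF R] .
  then have R': "realizes V d E'" by (simp add: max_overlap_def)
  then have G: "sgraph V E'" by (rule realizes_sgraph)
  have fin: "finite V" "finite E'" "finite H"
    using sgraph_finite[OF G] sgraph_finite_edges[OF G] HX finite_subset[of H V] by auto
  \<comment> \<open>The degree of \<open>x\<close> is at least its degree in \<open>U\<close>, so a
    missing edge of \<open>U\<close> at \<open>x\<close> is compensated by an edge outside
    \<open>U\<close>. The far end is not in \<open>H\<close>, because \<open>U\<close> contains all
    pairs between \<open>H\<close> and \<open>X\<close>.\<close>
  have other: "\<exists>x'. {x, x'} \<in> E' - U \<and> x' \<in> V - H"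
    if xy: "{x, y} \<in> U" "{x, y} \<notin> E'" for x y
  proof -
    have x: "x \<in> X" using xy U sgraph_ends by metis
    have "\<not> nbrs E' x \<subseteq> nbrs U x"
    proof
      assume "nbrs E' x \<subseteq> nbrs U x"
      moreover have "y \<in> nbrs U x - nbrs E' x" using xy by (auto simp: in_nbrs)
      ultimately have "nbrs E' x \<subset> nbrs U x" by blast
      then have "card (nbrs E' x) < card (nbrs U x)"
        using sgraph_finite_nbrs[OF U] by (rule psubset_card_mono[rotated])
      then show False using degU[OF x] realizes_card_nbrs[OF R', of x] x HX by auto
    qed
    then obtain x' where x': "{x, x'} \<in> E'" "{x, x'} \<notin> U" unfolding subset_iff in_nbrs by blast
    moreover have "x' \<in> V" "x' \<noteq> x" using x' sgraph_ends[OF G] sgraph_no_loop[OF G] by auto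
    moreover have "x' \<notin> H" using join[of x' x] x x' \<open>x' \<noteq> x\<close> by (auto simp: insert_commute)
    ultimately show ?thesis by blast
  qed
  have "U \<subseteq> E'"
  proof (rule ccontr)
    assume "\<not> U \<subseteq> E'"
    then obtain e where e: "e \<in> U" "e \<notin> E'" by blast
    then obtain x y where xy: "e = {x, y}" "x \<noteq> y" using sgraph_edge[OF U] by metis
    obtain x' where x': "{x, x'} \<in> E' - U" "x' \<in> V - H" using other[of x y] e xy by auto
    obtain y' where y': "{y, y'} \<in> E' - U" "y' \<in> V - H"
      using other[of y x] e xy by (auto simp: insert_commute)
    define F where "F = {e \<in> E'. e \<inter> H = {} \<and> e \<notin> U}"
    define N where "N z = insert z (nbrs E' z) - H" for z
    have fN: "finite (N z)" for z unfolding N_def using sgraph_finite_nbrs[OF G] by auto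
    have sum_le: "(\<Sum>c\<in>N z. card {e \<in> F. c \<in> e}) \<le> (\<mu> + 1) * \<mu>" if z: "z \<in> V - H" for z
    proof -
      have NV: "N z \<subseteq> V - H" unfolding N_def using z sgraph_nbrs_subset[OF G] by auto
      have "(\<Sum>c\<in>N z. card {e \<in> F. c \<in> e}) \<le> (\<Sum>c\<in>N z. \<mu>)"
      proof (rule sum_mono)
        fix c assume "c \<in> N z"
        then have c: "c \<in> V - H" using NV by blast
        then show "card {e \<in> F. c \<in> e} \<le> \<mu>"
          using card_edges_at_le[OF R', of F c] low[OF c] by (auto simp: F_def)
      qed
      also have "\<dots> = card (N z) * \<mu>" by simp
      also have "card (N z) \<le> card (insert z (nbrs E' z))"
        unfolding N_def using sgraph_finite_nbrs[OF G] by (intro card_mono) auto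
      then have "card (N z) \<le> \<mu> + 1"
        using z realizes_card_nbrs[OF R', of z] low[OF z] sgraph_finite_nbrs[OF G]
        by (auto simp: card_insert_if split: if_splits)
      then have "card (N z) * \<mu> \<le> (\<mu> + 1) * \<mu>" by (rule mult_le_mono1)
      finally show ?thesis .
    qed
    have "p \<in> N x' \<or> q \<in> N y'" if pq: "{p, q} \<in> F" for p q
      using max_overlap_switch3[OF M, of x y x' y' p q] e xy x' y' pq
      by (auto simp: F_def N_def in_nbrs)
    then have "2 * card F \<le> (\<Sum>c\<in>N x'. card {e \<in> F. c \<in> e}) + (\<Sum>c\<in>N y'. card {e \<in> F. c \<in> e})"
      using fN by (intro card_constrained_edges[OF G]) (auto simp: F_def)
    then have F1: "card F \<le> (\<mu> + 1) * \<mu>"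
      using sum_le[OF x'(2)] sum_le[OF y'(2)] by linarith
    have "card E = card E'" by (rule realizes_card_edges_eq[OF R R'])
    also have "card E' = card {e \<in> E'. e \<inter> H \<noteq> {}} + card {e \<in> E'. e \<inter> H = {}}"
      using fin by (intro card_edges_split)
    also have "card {e \<in> E'. e \<inter> H \<noteq> {}} \<le> (card H choose 2) + (\<Sum>b\<in>H. card (nbrs E' b - H))"
      by (rule card_edges_meeting[OF G fin(3)])
    also have "(\<Sum>b\<in>H. card (nbrs E' b - H)) \<le> (\<Sum>b\<in>H. card V - card H)"
      using card_nbrs_diff_le[OF G, of H] HX by (intro sum_mono) auto
    also have "\<dots> = card H * (card V - card H)" by simp
    also have "card {e \<in> E'. e \<inter> H = {}} \<le> card (F \<union> {e \<in> U. e \<inter> H = {}})"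
      using fin sgraph_finite_edges[OF U] by (intro card_mono) (auto simp: F_def)
    also have "\<dots> \<le> card F + card {e \<in> U. e \<inter> H = {}}" by (rule card_Un_le)
    finally show False using big F1 by (simp add: mult.commute)
  qed
  then show thesis using that R' by blast
qed

text \<open>If \<open>x\<close> and \<open>y\<close> in \<open>X\<close> stay non-adjacent at
  maximal overlap with the complete graph on \<open>X\<close>, each has at least \<open>k\<close>
  neighbours outside \<open>X\<close>. Exchanges of two edges make these neighbourhoods
  \<open>Z1\<close> and \<open>Z2\<close> completely adjacent to each other, and exchanges of three
  edges forbid a non-adjacent pair in both, so one of them is itself a clique. The degree
  \<open>2 k - 2\<close> is what leaves \<open>k\<close> neighbours outside after at most
  \<open>k - 2\<close> inside.\<close>

lemma realizes_clique:
  assumes R: "realizes V d E" and X: "X \<subseteq> V" "card X = k"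
    and deg: "\<And>x. x \<in> X \<Longrightarrow> 2 * k - 2 \<le> d x"
  obtains E' K where "realizes V d E'" "K \<subseteq> V" "card K \<ge> k"
    "\<And>x y. x \<in> K \<Longrightarrow> y \<in> K \<Longrightarrow> x \<noteq> y \<Longrightarrow> {x, y} \<in> E'"
proof -
  define U where "U = {e. e \<subseteq> X \<and> card e = 2}"
  obtain E' where M: "max_overlap V d U E'" using exists_max_overlap[OF R] .
  then have R': "realizes V d E'" by (simp add: max_overlap_def)
  then have G: "sgraph V E'" by (rule realizes_sgraph)
  have fX: "finite X" using X sgraph_finite[OF G] by (auto intro: finite_subset)
  show thesis
  proof (cases "\<forall>x\<in>X. \<forall>y\<in>X. x \<noteq> y \<longrightarrow> {x, y} \<in> E'")
    case True
    then show thesis using that[OF R' X(1)] X by simp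
  next
    case False
    then obtain x y where xy: "x \<in> X" "y \<in> X" "x \<noteq> y" "{x, y} \<notin> E'" by blast
    have large: "card (nbrs E' u - X) \<ge> k"
      if uw: "u \<in> X" "w \<in> X" "u \<noteq> w" "{u, w} \<notin> E'" for u w
    proof -
      have "nbrs E' u \<inter> X \<subseteq> X - {u, w}"
        using uw sgraph_not_self[OF G] by (auto simp: in_nbrs)
      then have "card (nbrs E' u \<inter> X) \<le> card (X - {u, w})"
        using fX by (intro card_mono) auto
      also have "\<dots> = k - 2" using uw X fX by (simp add: card_Diff_subset)
      finally have "card (nbrs E' u \<inter> X) \<le> k - 2" .
      moreover have "card (nbrs E' u) = card (nbrs E' u \<inter> X) + card (nbrs E' u - X)"
        using sgraph_finite_nbrs[OF G]
        by (metis Diff_disjoint Int_Diff_disjoint Int_Diff_Un card_Un_disjoint finite_Diff finite_Int)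
      moreover have "card (nbrs E' u) \<ge> 2 * k - 2"
        using deg[OF uw(1)] realizes_card_nbrs[OF R'] uw X by auto
      moreover have "card {u, w} \<le> k" using uw X fX by (metis card_mono empty_subsetI insert_subset)
      ultimately show ?thesis using uw by simp
    qed
    define Z1 where "Z1 = nbrs E' x - X"
    define Z2 where "Z2 = nbrs E' y - X"
    have big: "card Z1 \<ge> k" "card Z2 \<ge> k"
      using large[of x y] large[of y x] xy by (auto simp: Z1_def Z2_def insert_commute)
    have ZV: "Z1 \<subseteq> V" "Z2 \<subseteq> V" using sgraph_nbrs_subset[OF G] by (auto simp: Z1_def Z2_def)
    have xyU: "{x, y} \<in> U" using xy by (auto simp: U_def)
    have e1: "{x, z} \<in> E' - U" if "z \<in> Z1" for z using that by (auto simp: Z1_def U_def in_nbrs)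
    have e2: "{y, z} \<in> E' - U" if "z \<in> Z2" for z using that by (auto simp: Z2_def U_def in_nbrs)
    have cross: "z1 = z2 \<or> {z1, z2} \<in> E'" if "z1 \<in> Z1" "z2 \<in> Z2" for z1 z2
      using max_overlap_switch2[OF M xyU xy(4,3) e1 e2] that by blast
    have "(\<forall>a\<in>Z1. \<forall>b\<in>Z1. a \<noteq> b \<longrightarrow> {a, b} \<in> E') \<or> (\<forall>a\<in>Z2. \<forall>b\<in>Z2. a \<noteq> b \<longrightarrow> {a, b} \<in> E')"
    proof (rule ccontr)
      assume "\<not> ?thesis"
      then obtain z1 z1' z2 z2' where z: "z1 \<in> Z1" "z1' \<in> Z1" "z1 \<noteq> z1'" "{z1, z1'} \<notin> E'"
        "z2 \<in> Z2" "z2' \<in> Z2" "z2 \<noteq> z2'" "{z2, z2'} \<notin> E'" by blast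
      \<comment> \<open>The edge \<open>z1'z2'\<close>, which exists by \<open>cross\<close>, serves
        as third edge of the exchange; its ends are non-adjacent to \<open>z1\<close> and
        \<open>z2\<close>, so nothing blocks it.\<close>
      have "z1' \<noteq> z2'" using cross[of z1 z2'] z by auto
      then have "{z1', z2'} \<in> E'" using cross z by blast
      moreover have "{z1', z2'} \<notin> U" using z by (auto simp: U_def Z1_def)
      ultimately show False
        using max_overlap_switch3[OF M xyU xy(4,3) e1[OF z(1)] e2[OF z(5)], of z1' z2'] z by auto
    qed
    then show thesis using that[OF R'] ZV big by blast
  qed
qed

section \<open>Joining the vertices of largest degree\<close>

definition join_edges :: "'a set \<Rightarrow> 'a set \<Rightarrow> 'a set set" where
  "join_edges H W = {e. e \<subseteq> H \<union> W \<and> card e = 2 \<and> e \<inter> H \<noteq> {}}"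

lemma card_insert_remove_eq:
  assumes "finite S" "x \<in> S" "y \<notin> S" shows "card (insert y (S - {x})) = card S"
proof -
  have "card (insert y (S - {x})) = Suc (card (S - {x}))" using assms by simp
  then show ?thesis using assms by (metis card_Suc_Diff1)
qed

text \<open>This is the arithmetic that closes the case of a missing edge between \<open>H\<close>
  and \<open>W\<close>. The lower bound on \<open>l\<close> decreases and the upper bound increases
  in \<open>a\<close>, so \<open>a\<close> is replaced by its largest value \<open>A\<close>, which
  is linear in \<open>\<gamma>\<close>.\<close>

lemma counting_contradiction:
  fixes t \<gamma> a n l :: nat
  assumes t3: "3 \<le> t" and \<gamma>: "2 \<le> \<gamma>" "\<gamma> \<le> 2 * t - 1" and a: "a \<le> \<gamma> * (3 * t + 2) + 1"
    and n: "20 * t^2 + 23 * t + 5 \<le> n"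
    and lower: "int \<gamma> * (int n - 2 * int t + 1 - int (t + 3 + a)) + 2 \<le> int l"
    and upper: "2 * l \<le> 2 * ((6 * t - 1) * (3 * t + 3)) + (a * (6 * t - 1) + (t + 1) * (a - 6 * t))"
  shows False
proof -
  define A where "A = \<gamma> * (3 * t + 2) + 1"
  define T where "T = int t"
  define g where "g = int \<gamma>"
  have T3: "3 \<le> T" using t3 by (simp add: T_def)
  have g: "2 \<le> g" "g \<le> 2 * T - 1" using \<gamma> t3 by (auto simp: g_def T_def)
  have iA: "int A = g * (3 * T + 2) + 1" by (simp add: A_def g_def T_def algebra_simps)
  have A6: "6 * t \<le> A"
    unfolding A_def using mult_le_mono1[OF \<gamma>(1), of "3 * t + 2"] by simp
  have i6: "int (6 * t - 1) = 6 * int t - 1" using t3 by simp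
  have "2 * l \<le> 2 * ((6 * t - 1) * (3 * t + 3)) + (A * (6 * t - 1) + (t + 1) * (A - 6 * t))"
    using upper a unfolding A_def[symmetric]
    by (meson add_le_mono diff_le_mono dual_order.trans le_refl mult_le_mono mult_le_mono1 mult_le_mono2)
  then have "int (2 * l) \<le> int (2 * ((6 * t - 1) * (3 * t + 3)) + (A * (6 * t - 1) + (t + 1) * (A - 6 * t)))"
    by linarith
  then have up: "2 * int l \<le> 2 * ((6 * T - 1) * (3 * T + 3)) + (int A * (6 * T - 1) + (T + 1) * (int A - 6 * T))"
    using A6 i6 by (simp only: of_nat_add of_nat_mult of_nat_numeral of_nat_1 of_nat_diff T_def)
  have "20 * T^2 + 23 * T + 5 \<le> int n"
    using n unfolding T_def by (metis (mono_tags, lifting) of_nat_le_iff of_nat_add of_nat_mult of_nat_numeral of_nat_power)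
  moreover have "int a \<le> int A" using a by (simp only: A_def of_nat_le_iff)
  ultimately have "20 * T^2 + 20 * T + 3 - int A \<le> int n - 2 * int t + 1 - int (t + 3 + a)"
    by (simp add: T_def)
  then have "g * (20 * T^2 + 20 * T + 3 - int A) \<le> int \<gamma> * (int n - 2 * int t + 1 - int (t + 3 + a))"
    unfolding g_def by (intro mult_left_mono) auto
  then have lo: "g * (20 * T^2 + 20 * T + 3 - int A) + 2 \<le> int l" using lower by linarith
  \<comment> \<open>After the substitution the lower bound is concave in \<open>g\<close> and the
    upper bound is linear, so their difference is controlled by the two ends \<open>g = 2\<close>
    and \<open>g = 2 T - 1\<close>; this product expresses the concavity.\<close>
  have conc: "(g - 2) * (2 * T - 1 - g) * (3 * T + 2) \<ge> 0" using g T3 by simp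
  have lin: "(g - 2) * (7 * T^2 + 12 * T) \<ge> 0" using g T3 by simp
  have TT: "3 * T \<le> T * T" using T3 by simp
  show False using up[unfolded iA] lo[unfolded iA] conc lin TT T3 unfolding power2_eq_square
    by (simp only: algebra_simps)
qed

text \<open>\<open>H\<close> and \<open>W\<close> are the top \<open>2 t - 1\<close> and the next
  \<open>t + 4\<close> vertices by degree. The bounds \<open>low\<close> and \<open>med\<close> hold
  when fewer than \<open>3 t + 1\<close> vertices have degree at least \<open>6 t\<close>; the four
  spare vertices in \<open>W\<close> are consumed by the two disjoint edges of a host.\<close>

locale maximal_join =
  fixes V H W :: "'a set" and d :: "'a \<Rightarrow> nat" and t :: nat and E :: "'a set set"
  assumes t3: "3 \<le> t"
    and HV: "H \<subseteq> V" and WV: "W \<subseteq> V" and disj: "H \<inter> W = {}"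
    and cardH: "card H = 2 * t - 1" and cardW: "card W = t + 4"
    and topH: "x \<in> H \<Longrightarrow> y \<in> V - H \<Longrightarrow> d y \<le> d x"
    and topW: "w \<in> W \<Longrightarrow> y \<in> V - H - W \<Longrightarrow> d y \<le> d w"
    and degH: "x \<in> H \<Longrightarrow> 4 * t + 2 \<le> d x"
    and degW: "w \<in> W \<Longrightarrow> 2 * t - 1 \<le> d w"
    and low: "y \<in> V - H - W \<Longrightarrow> d y \<le> 6 * t - 1"
    and med: "card {w \<in> W. 6 * t \<le> d w} \<le> t + 1"
    and nV: "20 * t^2 + 23 * t + 5 \<le> card V"
    and eV: "(2 * t - 1) * (card V - t) + 2 \<le> card E"
    and maxE: "max_overlap V d (join_edges H W) E"
begin

abbreviation "N \<equiv> nbrs E"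

definition "L = {e \<in> E. e \<inter> H = {}}"

lemma R: "realizes V d E"
  using maxE by (simp add: max_overlap_def)

lemma G: "sgraph V E"
  using R by (rule realizes_sgraph)

lemma fin: "finite V" "finite H" "finite W" "finite E" "finite (N x)"
  using sgraph_finite[OF G] sgraph_finite_edges[OF G] HV WV sgraph_finite_nbrs[OF G]
  by (auto intro: finite_subset)

lemma NV: "N x \<subseteq> V"
  by (rule sgraph_nbrs_subset[OF G])

lemma dN: "x \<in> V \<Longrightarrow> card (N x) = d x"
  by (rule realizes_card_nbrs[OF R])

lemma N_sym: "x \<in> N y \<longleftrightarrow> y \<in> N x"
  by (rule in_nbrs_commute)

lemma N_irrefl: "x \<notin> N x"
  by (rule sgraph_not_self[OF G])

lemma L_ends: "{p, q} \<in> L \<longleftrightarrow> q \<in> N p \<and> p \<notin> H \<and> q \<notin> H"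
  by (auto simp: L_def in_nbrs)

lemma join_edge_iff: "{x, y} \<in> join_edges H W \<longleftrightarrow>
    x \<in> H \<union> W \<and> y \<in> H \<union> W \<and> x \<noteq> y \<and> (x \<in> H \<or> y \<in> H)"
  by (auto simp: join_edges_def card_insert_if)

lemma switch2_maximal:
  assumes "{x, y} \<in> join_edges H W" "y \<notin> N x"
    and "x' \<in> N x" "y' \<in> N y" "{x, x'} \<notin> join_edges H W" "{y, y'} \<notin> join_edges H W"
  shows "x' = y' \<or> x' \<in> N y'"
  using max_overlap_switch2[OF maxE, of x y x' y'] assms
  by (auto simp: in_nbrs insert_commute join_edge_iff)

lemma switch3_maximal:
  assumes "{x, y} \<in> join_edges H W" "y \<notin> N x"
    and "x' \<in> N x" "y' \<in> N y" "{x, x'} \<notin> join_edges H W" "{y, y'} \<notin> join_edges H W"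
    and "{p, q} \<in> L"
  shows "p \<in> insert x' (N x') \<or> q \<in> insert y' (N y')"
  using max_overlap_switch3[OF maxE, of x y x' y' p q] assms
  by (auto simp: in_nbrs join_edge_iff L_def)

text \<open>A clique \<open>H\<close> fully joined to the outside accounts for
  \<open>r (n - t)\<close> edges, two fewer than there are. Each vertex of \<open>\<Gamma>\<close>
  with at most \<open>m\<close> outer neighbours loses \<open>n - r - m\<close> of these, and the
  loss must reappear among the edges avoiding \<open>H\<close>.\<close>

lemma outer_edges_lower_bound:
  assumes "\<Gamma> \<subseteq> H" and m: "\<And>b. b \<in> \<Gamma> \<Longrightarrow> card (N b - H) \<le> m"
  shows "int (card \<Gamma>) * (int (card V) - 2 * int t + 1 - int m) + 2 \<le> int (card L)"
proof -
  have f\<Gamma>: "finite \<Gamma>" using assms fin by (auto intro: finite_subset)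
  have "card E = card {e \<in> E. e \<inter> H \<noteq> {}} + card L"
    unfolding L_def by (rule card_edges_split[OF fin(4)])
  moreover have "card {e \<in> E. e \<inter> H \<noteq> {}} \<le> (card H choose 2) + (\<Sum>b\<in>H. card (N b - H))"
    by (rule card_edges_meeting[OF G fin(2)])
  moreover have "(\<Sum>b\<in>H. card (N b - H)) = (\<Sum>b\<in>H - \<Gamma>. card (N b - H)) + (\<Sum>b\<in>\<Gamma>. card (N b - H))"
    using assms fin by (intro sum.subset_diff) auto
  moreover have "(\<Sum>b\<in>H - \<Gamma>. card (N b - H)) \<le> (\<Sum>b\<in>H - \<Gamma>. card V - card H)"
    using card_nbrs_diff_le[OF G HV] by (intro sum_mono) auto
  moreover have "(\<Sum>b\<in>\<Gamma>. card (N b - H)) \<le> (\<Sum>b\<in>\<Gamma>. m)"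
    using m by (intro sum_mono) auto
  moreover have "card (H - \<Gamma>) = card H - card \<Gamma>" using assms f\<Gamma> by (simp add: card_Diff_subset)
  ultimately have *: "card E \<le> (card H choose 2) + (card H - card \<Gamma>) * (card V - card H)
      + card \<Gamma> * m + card L" by simp
  have \<Gamma>H: "card \<Gamma> \<le> card H" using assms fin by (intro card_mono) auto
  have HVc: "card H \<le> card V" using HV fin by (intro card_mono) auto
  have ch: "int (card H choose 2) = (2 * int t - 1) * (int t - 1)"
  proof -
    obtain s where s: "t = Suc s" using t3 by (cases t) auto
    have "card H = 2 * s + 1" using cardH s by simp
    then have "card H choose 2 = (2 * s + 1) * s" by (simp add: choose_two)
    then show ?thesis using s by (simp add: algebra_simps)
  qed
  have i1: "int (card H) = 2 * int t - 1" using cardH t3 by auto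
  have i2: "int (card V - card H) = int (card V) - 2 * int t + 1" using i1 HVc by simp
  have i3: "int (card H - card \<Gamma>) = 2 * int t - 1 - int (card \<Gamma>)" using i1 \<Gamma>H by simp
  have tV: "t \<le> card V" using nV by simp
  have "int ((2 * t - 1) * (card V - t) + 2) \<le> int ((card H choose 2)
      + (card H - card \<Gamma>) * (card V - card H) + card \<Gamma> * m + card L)"
    using * eV by linarith
  then have "(2 * int t - 1) * (int (card V) - int t) + 2 \<le> (2 * int t - 1) * (int t - 1)
      + (2 * int t - 1 - int (card \<Gamma>)) * (int (card V) - 2 * int t + 1)
      + int (card \<Gamma>) * int m + int (card L)"
    using i2 i3 ch tV t3 by (simp add: of_nat_diff)
  then show ?thesis by (simp add: algebra_simps)
qed

text \<open>For non-adjacent \<open>x\<close> and \<open>y\<close> in \<open>H\<close>, exchanges of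
  two edges force the neighbours of \<open>x\<close> outside \<open>H \<union> W\<close> into the
  closed neighbourhood of a single neighbour of \<open>y\<close> of small degree, and conversely.
  Both vertices then have at most \<open>7 t + 4\<close> outer neighbours, so about
  \<open>2 n\<close> edges avoid \<open>H\<close>; exchanges of three edges allow at most
  \<open>39 t^2 - 7 t + 3\<close>. Here the coefficient \<open>20\<close> of \<open>t^2\<close> in
  the bound on \<open>n\<close> is nearly exhausted: it yields \<open>40 t^2\<close> against
  \<open>39 t^2\<close>.\<close>

lemma H_clique:
  assumes xy: "x \<in> H" "y \<in> H" "x \<noteq> y"
  shows "{x, y} \<in> E"
proof (rule ccontr)
  assume non: "{x, y} \<notin> E"
  define Z where "Z v = N v - H - W" for v
  \<comment> \<open>\<open>H \<union> W\<close> has \<open>3 t + 3\<close> vertices, of which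
    \<open>v\<close> itself and \<open>v'\<close> are not neighbours of \<open>v\<close>. With
    degree at least \<open>4 t + 2\<close>, at least \<open>t + 1\<close> neighbours lie outside
    \<open>H \<union> W\<close>.\<close>
  have deg: "d v \<le> card (Z v) + (3 * t + 1)" if "v \<in> H" "v' \<in> H" "v \<noteq> v'" "{v, v'} \<notin> E" for v v'
  proof -
    have "N v \<subseteq> Z v \<union> (H \<union> W - {v, v'})"
      using that N_irrefl by (auto simp: Z_def in_nbrs)
    then have "card (N v) \<le> card (Z v \<union> (H \<union> W - {v, v'}))"
      using fin by (intro card_mono) (auto simp: Z_def)
    also have "\<dots> \<le> card (Z v) + card (H \<union> W - {v, v'})" by (rule card_Un_le)
    also have "card (H \<union> W - {v, v'}) = card (H \<union> W) - 2"
      using that fin by (subst card_Diff_subset) auto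
    also have "card (H \<union> W) = 3 * t + 3"
      using fin disj cardH cardW t3 by (simp add: card_Un_disjoint)
    finally show ?thesis using dN[of v] that HV by auto
  qed
  have dx: "d x \<le> card (Z x) + (3 * t + 1)" and dy: "d y \<le> card (Z y) + (3 * t + 1)"
    using deg[of x y] deg[of y x] xy non by (auto simp: insert_commute)
  have xyU: "{x, y} \<in> join_edges H W" "{y, x} \<in> join_edges H W" using xy by (auto simp: join_edge_iff)
  have nxy: "y \<notin> N x" "x \<notin> N y" using non by (auto simp: in_nbrs insert_commute)
  have "Z x \<noteq> {}" "Z y \<noteq> {}" using dx dy degH[OF xy(1)] degH[OF xy(2)] by auto
  then obtain z1 z2 where z: "z1 \<in> Z x" "z2 \<in> Z y" by blast
  have notU: "{x, z} \<notin> join_edges H W" "{y, z} \<notin> join_edges H W" if "z \<notin> H" "z \<notin> W" for z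
    using that by (auto simp: join_edge_iff)
  have cross: "a = b \<or> a \<in> N b" if "a \<in> Z x" "b \<in> Z y" for a b
    using switch2_maximal[OF xyU(1) nxy(1), of a b] that notU by (auto simp: Z_def)
  have zlow: "d z1 \<le> 6 * t - 1" "d z2 \<le> 6 * t - 1" using z low NV by (auto simp: Z_def)
  have zV: "z1 \<in> V" "z2 \<in> V" using z NV by (auto simp: Z_def)
  have "Z x \<subseteq> insert z2 (N z2)" "Z y \<subseteq> insert z1 (N z1)"
    using cross z N_sym by blast+
  then have "card (Z x) \<le> card (insert z2 (N z2))" "card (Z y) \<le> card (insert z1 (N z1))"
    using fin by (auto intro!: card_mono)
  then have cZ: "card (Z x) \<le> 6 * t" "card (Z y) \<le> 6 * t"
    using zlow dN[OF zV(1)] dN[OF zV(2)] fin t3 N_irrefl by (simp_all add: card_insert_if)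
  define M where "M = {w \<in> W. 6 * t \<le> d w}"
  define P where "P z = insert z (N z) - H" for z
  \<comment> \<open>A vertex of \<open>M\<close> has degree at most that of \<open>x\<close>, hence
    at most \<open>6 t + (3 t + 1)\<close>, which is \<open>6 t - 1\<close> plus
    \<open>3 t + 2\<close>.\<close>
  have bound: "d c \<le> 6 * t - 1 + (if c \<in> M then 3 * t + 2 else 0)" if "c \<in> V - H" for c
  proof (cases "c \<in> M")
    case True
    have "d c \<le> d x" using topH xy that by auto
    then show ?thesis using True dx cZ by auto
  next
    case False
    then show ?thesis using low[of c] that by (cases "c \<in> W") (auto simp: M_def)
  qed
  have sumP: "(\<Sum>c\<in>P z. card {e \<in> L. c \<in> e}) \<le> (6 * t - 1) * (6 * t - 1) + (t + 1) * (3 * t + 2)"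
    if z: "z \<in> V - H - W" "v \<in> H" "v \<in> N z" for z v
  proof -
    have PV: "P z \<subseteq> V - H" using z NV by (auto simp: P_def)
    have fP: "finite (P z)" using fin by (auto simp: P_def)
    \<comment> \<open>The neighbour \<open>v\<close> of \<open>z\<close> lies in \<open>H\<close>
      and drops out of \<open>P z\<close>, which makes up for \<open>z\<close> being added; hence
      \<open>6 t - 1\<close> and not \<open>6 t\<close>.\<close>
    have "P z \<subseteq> insert z (N z - {v})" using z by (auto simp: P_def)
    then have "card (P z) \<le> card (insert z (N z - {v}))" using fin by (intro card_mono) auto
    also have "\<dots> \<le> Suc (card (N z - {v}))" by (simp add: card_insert_le_m1 card_insert_if fin)
    also have "\<dots> = card (N z)" using z fin by (metis card_Suc_Diff1)
    finally have cP: "card (P z) \<le> 6 * t - 1" using dN low z by fastforce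
    have "(\<Sum>c\<in>P z. card {e \<in> L. c \<in> e}) \<le> (\<Sum>c\<in>P z. 6 * t - 1 + (if c \<in> M then 3 * t + 2 else 0))"
    proof (rule sum_mono)
      fix c assume "c \<in> P z"
      then have c: "c \<in> V - H" using PV by blast
      have "card {e \<in> L. c \<in> e} \<le> d c" using c by (intro card_edges_at_le[OF R]) (auto simp: L_def)
      then show "card {e \<in> L. c \<in> e} \<le> 6 * t - 1 + (if c \<in> M then 3 * t + 2 else 0)"
        using bound[OF c] by linarith
    qed
    also have "\<dots> = card (P z) * (6 * t - 1) + card (P z \<inter> M) * (3 * t + 2)"
      using fP by (simp only: sum.distrib sum.inter_restrict[symmetric] sum_constant) simp
    also have "\<dots> \<le> (6 * t - 1) * (6 * t - 1) + (t + 1) * (3 * t + 2)"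
    proof (intro add_mono mult_le_mono1 cP)
      have "card (P z \<inter> M) \<le> card M" using fin by (intro card_mono) (auto simp: M_def)
      then show "card (P z \<inter> M) \<le> t + 1" using med by (simp add: M_def)
    qed
    finally show ?thesis .
  qed
  have "2 * card L \<le> (\<Sum>c\<in>P z1. card {e \<in> L. c \<in> e}) + (\<Sum>c\<in>P z2. card {e \<in> L. c \<in> e})"
  proof (rule card_constrained_edges[OF G])
    show "p \<in> P z1 \<or> q \<in> P z2" if "{p, q} \<in> L" for p q
      using switch3_maximal[OF xyU(1) nxy(1), of z1 z2 p q] z that notU
      by (auto simp: Z_def P_def L_ends)
  qed (auto simp: L_def P_def fin)
  moreover have "(\<Sum>c\<in>P z1. card {e \<in> L. c \<in> e}) \<le> (6 * t - 1) * (6 * t - 1) + (t + 1) * (3 * t + 2)"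
    using sumP[of z1 x] z xy zV N_sym by (auto simp: Z_def)
  moreover have "(\<Sum>c\<in>P z2. card {e \<in> L. c \<in> e}) \<le> (6 * t - 1) * (6 * t - 1) + (t + 1) * (3 * t + 2)"
    using sumP[of z2 y] z xy zV N_sym by (auto simp: Z_def)
  ultimately have up: "card L \<le> (6 * t - 1) * (6 * t - 1) + (t + 1) * (3 * t + 2)" by linarith
  have out: "card (N b - H) \<le> 7 * t + 4" if "b \<in> {x, y}" for b
  proof -
    have "card (N b - H) \<le> card (Z b \<union> W)" using fin by (intro card_mono) (auto simp: Z_def)
    also have "\<dots> \<le> card (Z b) + card W" by (rule card_Un_le)
    finally show ?thesis using that cZ cardW by auto
  qed
  have "int (card {x, y}) * (int (card V) - 2 * int t + 1 - int (7 * t + 4)) + 2 \<le> int (card L)"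
    using xy out by (intro outer_edges_lower_bound) auto
  then have "2 * (int (card V) - 9 * int t - 3) + 2 \<le> int (card L)" using xy by simp
  moreover have "int (card L) \<le> (6 * int t - 1) * (6 * int t - 1) + (int t + 1) * (3 * int t + 2)"
  proof -
    have "int (card L) \<le> int ((6 * t - 1) * (6 * t - 1) + (t + 1) * (3 * t + 2))" using up by linarith
    moreover have "int (6 * t - 1) = 6 * int t - 1" using t3 by simp
    ultimately show ?thesis by (simp only: of_nat_add of_nat_mult of_nat_numeral of_nat_1)
  qed
  moreover have "20 * int t ^ 2 + 23 * int t + 5 \<le> int (card V)"
    using nV by (metis (mono_tags, lifting) of_nat_le_iff of_nat_add of_nat_mult of_nat_numeral of_nat_power)
  moreover have "int t * int t \<ge> 0" by simp
  ultimately show False by (simp add: algebra_simps power2_eq_square)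
qed


text \<open>\<open>W\<close> may contain vertices of unbounded degree, so the argument for
  \<open>H\<close> does not carry over. Instead a set \<open>\<Gamma>\<close> of vertices of
  \<open>H\<close> is found whose outer neighbours all lie in \<open>W\<close> or in the closed
  neighbourhood of one vertex \<open>u\<close>. A large degree of \<open>u\<close> requires a large
  \<open>\<Gamma>\<close>, and a large \<open>\<Gamma>\<close> forces many edges avoiding
  \<open>H\<close>; these two effects are played against each other.\<close>

lemma HW_joined:
  assumes vw: "v \<in> H" "w \<in> W"
  shows "{v, w} \<in> E"
proof (rule ccontr)
  assume non: "{v, w} \<notin> E"
  have nvw: "w \<notin> N v" "v \<notin> N w" using non by (auto simp: in_nbrs insert_commute)
  have wH: "w \<notin> H" using vw disj by auto
  have neH: "b \<noteq> w" if "b \<in> H" for b using that wH by auto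
  have wV: "w \<in> V" and vV: "v \<in> V" using vw HV WV by auto
  have U: "{b, w} \<in> join_edges H W" if "b \<in> H" for b
    using that vw wH by (auto simp: join_edge_iff)
  have notU: "{b, z} \<notin> join_edges H W" if "z \<notin> H" "z \<notin> W" for b z
    using that by (auto simp: join_edge_iff)
  have notU': "{b, z} \<notin> join_edges H W" if "z \<notin> H" "b \<notin> H" for b z
    using that by (auto simp: join_edge_iff)
  \<comment> \<open>\<open>w\<close> has at least \<open>card H\<close> neighbours and misses
    \<open>v\<close>, so one of them is outside \<open>H\<close>. The edge \<open>wu\<close> is not
    a join edge and may be given up in an exchange.\<close>
  obtain u where u: "u \<in> N w" "u \<notin> H"
  proof -
    have "\<not> N w \<subseteq> H - {v}"
    proof
      assume "N w \<subseteq> H - {v}"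
      then have "card (N w) \<le> card (H - {v})" using fin by (intro card_mono) auto
      also have "\<dots> < card H" using vw fin by (intro psubset_card_mono) auto
      finally show False using dN[OF wV] degW[OF vw(2)] cardH by simp
    qed
    then show thesis using that nvw by blast
  qed
  have uV: "u \<in> V" using u NV by auto
  define Z where "Z = N v - H - W"
  have fZ: "finite Z" using fin by (simp add: Z_def)
  have dv: "d v \<le> card Z + (3 * t + 1)"
  proof -
    have "N v \<subseteq> Z \<union> (H \<union> W - {v, w})"
      using nvw N_irrefl by (auto simp: Z_def)
    then have "card (N v) \<le> card (Z \<union> (H \<union> W - {v, w}))"
      using fin fZ by (intro card_mono) auto
    also have "\<dots> \<le> card Z + card (H \<union> W - {v, w})" by (rule card_Un_le)
    also have "card (H \<union> W - {v, w}) = card (H \<union> W) - 2"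
      using vw neH[OF vw(1)] fin by (subst card_Diff_subset) auto
    also have "card (H \<union> W) = 3 * t + 3"
      using fin disj cardH cardW t3 by (simp add: card_Un_disjoint)
    finally show ?thesis using dN[OF vV] by auto
  qed
  have cZ: "t + 1 \<le> card Z" using dv degH[OF vw(1)] by simp
  have near: "y = u \<or> y \<in> N u" if b: "b \<in> H" "b \<notin> N w" "y \<in> N b" "y \<notin> H" "y \<notin> W" for b y
    using switch2_maximal[OF U[OF b(1)], of y u] b u wH notU notU' N_sym[of w b] by auto
  have Zu: "Z \<subseteq> insert u (N u)"
    using near[OF vw(1) nvw(2)] by (auto simp: Z_def)
  have Zlow: "d z \<le> 6 * t - 1" "z \<in> V" if "z \<in> Z" for z
    using that low NV by (auto simp: Z_def)
  \<comment> \<open>Since \<open>w\<close> belongs to \<open>W\<close> and \<open>z\<close> does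
    not, \<open>d z \<le> d w\<close>. As \<open>z\<close> is adjacent to \<open>v\<close> and
    \<open>w\<close> is not, \<open>w\<close> has a neighbour \<open>b\<close> that \<open>z\<close>
    misses; outside \<open>H\<close> it would permit an exchange of \<open>vz\<close> and
    \<open>wb\<close>.\<close>
  have miss: "\<exists>b\<in>H. b \<noteq> v \<and> b \<notin> N z \<and> b \<in> N w" if z: "z \<in> Z" for z
  proof -
    have zz: "z \<in> N v" "z \<notin> H" "z \<notin> W" "v \<in> N z" "z \<in> V" using z NV N_sym by (auto simp: Z_def)
    have "\<exists>b. b \<in> N w \<and> b \<noteq> z \<and> b \<notin> N z"
    proof (rule ccontr)
      assume "\<not> ?thesis"
      then have sub: "N w - {z} \<subseteq> N z - {v, w}" using nvw N_irrefl by auto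
      have c1: "card (N w - {z}) \<le> card (N z - {v, w})" using sub fin by (intro card_mono) auto
      have "d w < d z"
      proof (cases "z \<in> N w")
        case True
        then have "w \<in> N z" using N_sym by blast
        then have "card (N z - {v, w}) = card (N z) - 2" using zz nvw vw wH fin
          by (subst card_Diff_subset) (auto simp: card_insert_if)
        moreover have "card {v, w} \<le> card (N z)" using zz \<open>w \<in> N z\<close> fin by (intro card_mono) auto
        moreover have "card {v, w} = 2" using neH[OF vw(1)] by simp
        moreover have "card (N w - {z}) = card (N w) - 1" "card (N w) > 0"
          using True fin by (auto simp: card_gt_0_iff)
        ultimately show ?thesis using c1 dN zz wV by auto
      next
        case False
        have "card (N z - {v, w}) \<le> card (N z - {v})" using fin by (intro card_mono) auto
        also have "\<dots> < card (N z)" using zz fin by (intro psubset_card_mono) auto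
        finally show ?thesis using False c1 dN zz wV by auto
      qed
      then show False using topW[OF vw(2), of z] zz by auto
    qed
    then obtain b where b: "b \<in> N w" "b \<noteq> z" "b \<notin> N z" by blast
    have "b \<in> H"
    proof (rule ccontr)
      assume "b \<notin> H"
      then have "z = b \<or> z \<in> N b"
        using switch2_maximal[OF U[OF vw(1)], of z b] nvw zz b wH notU notU' by auto
      then show False using b N_sym by blast
    qed
    then show ?thesis using b nvw by auto
  qed
  \<comment> \<open>These are the vertices of \<open>H\<close> that behave like \<open>v\<close>:
    their neighbours outside \<open>H \<union> W\<close> all lie in the closed neighbourhood of
    \<open>u\<close>.\<close>
  define \<Gamma> where "\<Gamma> = {b \<in> H. N b - H - W \<subseteq> insert u (N u)}"
  have v\<Gamma>: "v \<in> \<Gamma>" using Zu vw by (auto simp: \<Gamma>_def Z_def)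
  have miss\<Gamma>: "b \<in> \<Gamma>" if b: "b \<in> H" "b \<notin> N z" "b \<in> N w" and z: "z \<in> Z" for b z
  proof -
    have zz: "z \<in> N v" "z \<notin> H" "z \<notin> W" "v \<in> N z" using z N_sym by (auto simp: Z_def)
    have bv: "b \<noteq> v" using b zz by auto
    let ?E' = "E - {{v, z}, {w, b}} \<union> {{v, w}, {z, b}}"
    have R': "realizes V d ?E'"
      using zz b non vw wH by (intro switch2[OF R]) (auto simp: in_nbrs)
    \<comment> \<open>The switch trades the protected edge \<open>wb\<close> for \<open>vw\<close>, so maximality survives and
      \<open>b\<close> takes over the role of \<open>v\<close>.\<close>
    have fE: "finite (E \<inter> join_edges H W)" using fin by auto
    have "?E' \<inter> join_edges H W = insert {v, w} (E \<inter> join_edges H W - {{w, b}})"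
      using U[OF vw(1)] notU[OF zz(2,3)] by (auto simp: insert_commute)
    moreover have "{w, b} \<in> E \<inter> join_edges H W" using U[OF b(1)] b by (auto simp: in_nbrs insert_commute)
    ultimately have "card (?E' \<inter> join_edges H W) = card (E \<inter> join_edges H W)"
      using non fE card_insert_remove_eq[of "E \<inter> join_edges H W" "{w, b}" "{v, w}"] by simp
    then have M': "max_overlap V d (join_edges H W) ?E'"
      using maxE R' unfolding max_overlap_def by simp
    have "y \<in> insert u (N u)" if y: "y \<in> N b" "y \<notin> H" "y \<notin> W" for y
    proof (rule ccontr)
      assume ny: "y \<notin> insert u (N u)"
      have zw: "z \<noteq> w" and zb: "z \<noteq> b" and zy: "z \<noteq> y" using zz vw b y N_sym by auto
      have "{b, w} \<noteq> {v, w}" "{b, w} \<noteq> {z, b}" using bv zw zb neH[OF b(1)]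
        by (simp_all add: doubleton_eq_iff)
      then have bw: "{b, w} \<notin> ?E'" by (simp add: insert_commute)
      have "{b, y} \<noteq> {v, z}" "{b, y} \<noteq> {w, b}" using bv zb y vw neH[OF b(1)]
        by (auto simp: doubleton_eq_iff)
      then have by': "{b, y} \<in> ?E' - join_edges H W" using y(1) notU[OF y(2,3)] by (simp add: in_nbrs)
      have "{w, u} \<noteq> {v, z}" "{w, u} \<noteq> {w, b}" using neH[OF vw(1)] zw b u
        by (auto simp: doubleton_eq_iff)
      then have wu: "{w, u} \<in> ?E' - join_edges H W" using u notU'[OF u(2) wH] by (simp add: in_nbrs)
      have "y = u \<or> {y, u} \<in> ?E'"
        using max_overlap_switch2[OF M' U[OF b(1)] bw neH[OF b(1)] by' wu] .
      moreover have "{y, u} \<noteq> {v, w}" "{y, u} \<noteq> {z, b}" using y u vw b(1) 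
        by (auto simp: doubleton_eq_iff)
      ultimately have "{y, u} \<in> E" using ny by simp
      then show False using ny by (auto simp: in_nbrs insert_commute)
    qed
    then show ?thesis using b by (auto simp: \<Gamma>_def)
  qed
  define \<gamma> where "\<gamma> = card \<Gamma>"
  define \<zeta> where "\<zeta> = card Z"
  have \<Gamma>H: "\<Gamma> \<subseteq> H" by (auto simp: \<Gamma>_def)
  have f\<Gamma>: "finite \<Gamma>" using \<Gamma>H fin by (auto intro: finite_subset)
  have \<gamma>_le: "\<gamma> \<le> 2 * t - 1" unfolding \<gamma>_def cardH[symmetric] using \<Gamma>H fin by (intro card_mono)
  have \<gamma>2: "2 \<le> \<gamma>"
  proof -
    obtain z where "z \<in> Z" using cZ fZ by fastforce
    then obtain b where "b \<in> \<Gamma>" "b \<noteq> v" using miss miss\<Gamma> by blast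
    then have "card {b, v} \<le> \<gamma>" using v\<Gamma> f\<Gamma> unfolding \<gamma>_def by (intro card_mono) auto
    then show ?thesis using \<open>b \<noteq> v\<close> by simp
  qed
  have du: "d u \<le> d b" if "b \<in> H" for b using topH[OF that] uV u by auto
  have cu: "card (N u) \<le> \<zeta> + (3 * t + 1)" using du[OF vw(1)] dv dN[OF uV] by (simp add: \<zeta>_def)
  \<comment> \<open>The missed vertices lie in \<open>N u - N b\<close>, which is no larger than
    \<open>N b - N u\<close> because \<open>d u \<le> d b\<close>. For \<open>b\<close> in
    \<open>\<Gamma>\<close> the latter consists of \<open>u\<close> and of vertices of
    \<open>H \<union> W\<close> other than \<open>b\<close> and \<open>w\<close>, at most
    \<open>1 + (3 t + 1)\<close> in all.\<close>
  have missed: "card {z \<in> Z - {u}. b \<notin> N z} \<le> 3 * t + 2" if b: "b \<in> \<Gamma>" for b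
  proof -
    have bH: "b \<in> H" and bV: "b \<in> V" using b \<Gamma>H HV by auto
    have "{z \<in> Z - {u}. b \<notin> N z} \<subseteq> N u - N b" using Zu N_sym by blast
    then have "card {z \<in> Z - {u}. b \<notin> N z} \<le> card (N u - N b)" using fin by (intro card_mono) auto
    also have "\<dots> \<le> card (N b - N u)"
    proof -
      have "card (N u) = card (N u - N b) + card (N u \<inter> N b)"
        "card (N b) = card (N b - N u) + card (N u \<inter> N b)"
        using fin by (metis Int_commute Diff_disjoint Int_Diff_disjoint Un_Diff_Int card_Un_disjoint finite_Diff finite_Int inf_commute)+
      then show ?thesis using du[OF bH] dN[OF uV] dN[OF bV] by simp
    qed
    also have "\<dots> \<le> card (insert u (H \<union> W - {b, w}))"
    proof (rule card_mono)
      have "w \<in> N u" using u N_sym by blast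
      then show "N b - N u \<subseteq> insert u (H \<union> W - {b, w})"
        using b N_irrefl by (auto simp: \<Gamma>_def)
    qed (use fin in auto)
    also have "\<dots> \<le> Suc (card (H \<union> W - {b, w}))" using fin by (simp add: card_insert_if)
    also have "card (H \<union> W - {b, w}) = card (H \<union> W) - 2"
      using bH vw neH[OF bH] fin by (subst card_Diff_subset) auto
    also have "card (H \<union> W) = 3 * t + 3"
      using fin disj cardH cardW t3 by (simp add: card_Un_disjoint)
    finally show ?thesis by simp
  qed
  have \<zeta>_le: "\<zeta> \<le> (\<gamma> - 1) * (3 * t + 2) + 1"
  proof -
    have "Z - {u} \<subseteq> (\<Union>b\<in>\<Gamma> - {v}. {z \<in> Z - {u}. b \<notin> N z})" using miss miss\<Gamma> by blast
    then have "card (Z - {u}) \<le> card (\<Union>b\<in>\<Gamma> - {v}. {z \<in> Z - {u}. b \<notin> N z})"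
      using f\<Gamma> fZ by (intro card_mono) auto
    also have "\<dots> \<le> (\<Sum>b\<in>\<Gamma> - {v}. card {z \<in> Z - {u}. b \<notin> N z})"
      using f\<Gamma> by (intro card_UN_le) auto
    also have "\<dots> \<le> (\<Sum>b\<in>\<Gamma> - {v}. 3 * t + 2)" using missed by (intro sum_mono) auto
    also have "\<dots> = (\<gamma> - 1) * (3 * t + 2)" using v\<Gamma> f\<Gamma> by (simp add: \<gamma>_def)
    finally have "card (Z - {u}) \<le> (\<gamma> - 1) * (3 * t + 2)" .
    moreover have "card Z \<le> Suc (card (Z - {u}))" by (simp add: card_Diff_singleton_if) arith
    ultimately show ?thesis by (simp add: \<zeta>_def)
  qed
  \<comment> \<open>A bound for the closed neighbourhood of \<open>u\<close>:
    \<open>d u \<le> d v \<le> \<zeta> + 3 t + 1\<close>, plus one for \<open>u\<close>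
    itself.\<close>
  define a where "a = \<zeta> + 3 * t + 2"
  define P where "P = insert u (N u) - H"
  have fP: "finite P" using fin by (simp add: P_def)
  have cP: "card P \<le> a"
  proof -
    have "card P \<le> card (insert u (N u))" unfolding P_def using fin by (intro card_mono) auto
    also have "\<dots> \<le> Suc (card (N u))" using fin by (simp add: card_insert_if)
    finally show ?thesis using cu by (simp add: a_def)
  qed
  have lower: "int \<gamma> * (int (card V) - 2 * int t + 1 - int (t + 3 + a)) + 2 \<le> int (card L)"
    unfolding \<gamma>_def
  proof (rule outer_edges_lower_bound[OF \<Gamma>H])
    fix b assume b: "b \<in> \<Gamma>"
    have "w \<in> P" using u N_sym wH by (auto simp: P_def)
    then have "N b - H \<subseteq> (W - {w}) \<union> P" using b by (auto simp: \<Gamma>_def P_def)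
    then have "card (N b - H) \<le> card ((W - {w}) \<union> P)" using fin fP by (intro card_mono) auto
    also have "\<dots> \<le> card (W - {w}) + card P" by (rule card_Un_le)
    finally show "card (N b - H) \<le> t + 3 + a" using vw cardW cP fin by simp
  qed
  obtain z0 where z0: "z0 \<in> Z" "z0 \<noteq> u"
  proof -
    have "\<not> Z \<subseteq> {u}" using cZ t3 card_mono[of "{u}" Z] by auto
    then show thesis using that by blast
  qed
  \<comment> \<open>An edge avoiding \<open>H\<close> with an end \<open>q\<close> outside
    \<open>P\<close> has its other end in the closed neighbourhood of every \<open>z\<close> in
    \<open>Z\<close>, so that end lies in \<open>K\<close>. Vertices of \<open>K\<close> are few,
    being close to \<open>z0\<close>, and most of their degree is spent on \<open>Z\<close>.\<close>
  define K where "K = {c \<in> V - H. Z - {u} \<subseteq> insert c (N c)}"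
  define Lin where "Lin = {e \<in> L. e \<subseteq> P}"
  have fL: "finite L" using fin by (simp add: L_def)
  have constr: "p \<in> insert z (N z) \<or> q \<in> P" if "{p, q} \<in> L" "z \<in> Z" for p q z
  proof -
    have "z \<in> N v" "z \<notin> H" "z \<notin> W" using that by (auto simp: Z_def)
    then show ?thesis
      using switch3_maximal[OF U[OF vw(1)] nvw(1), of z u p q] that u wH notU notU'
      by (auto simp: P_def L_ends)
  qed
  have cK: "card K \<le> 6 * t - 1"
  proof -
    have "K \<subseteq> insert z0 (N z0) - {v}" using z0 N_sym vw by (auto simp: K_def)
    then have "card K \<le> card (insert z0 (N z0) - {v})" using fin by (intro card_mono) auto
    also have "v \<in> N z0" using z0 N_sym by (auto simp: Z_def)
    then have "card (insert z0 (N z0) - {v}) \<le> card (N z0)" using fin N_irrefl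
      by (simp add: card_insert_if)
    finally show ?thesis using Zlow[OF z0(1)] dN by simp
  qed
  have Kout: "card (N c - insert u (N u)) \<le> 3 * t + 3" if c: "c \<in> K" for c
  proof -
    have cV: "c \<in> V" "c \<notin> H" using c by (auto simp: K_def)
    have "N c - insert u (N u) \<subseteq> N c - (Z - {u, c})" using Zu by auto
    then have "card (N c - insert u (N u)) \<le> card (N c - (Z - {u, c}))" using fin by (intro card_mono) auto
    \<comment> \<open>The vertex \<open>c\<close> is adjacent to all of \<open>Z\<close> except
      possibly \<open>u\<close> and \<open>c\<close>, so at least \<open>\<zeta> - 2\<close> of its
      at most \<open>\<zeta> + 3 t + 1\<close> neighbours lie near \<open>u\<close>; the difference
      is \<open>3 t + 3\<close>.\<close>
    also have "\<dots> = card (N c) - card (Z - {u, c})" using c fZ by (intro card_Diff_subset) (auto simp: K_def)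
    also have "card (Z - {u, c}) \<ge> card Z - card {u, c}" by (intro diff_card_le_card_Diff) auto
    moreover have "card {u, c} \<le> 2" by (simp add: card_insert_if)
    ultimately have "card (N c - insert u (N u)) \<le> d c - (card Z - 2)" using dN[OF cV(1)] by linarith
    moreover have "d c \<le> d v" using topH[OF vw(1)] cV by auto
    ultimately show ?thesis using dv cZ t3 by linarith
  qed
  have out: "card (L - Lin) \<le> (6 * t - 1) * (3 * t + 3)"
  proof -
    have "L - Lin \<subseteq> (\<Union>c\<in>K. (\<lambda>q. {c, q}) ` (N c - insert u (N u)))"
    proof
      fix e assume e: "e \<in> L - Lin"
      then have "e \<in> E" "\<not> e \<subseteq> P" by (auto simp: L_def Lin_def)
      then obtain p' q' where e': "e = {p', q'}" "p' \<notin> P \<or> q' \<notin> P"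
        by (metis sgraph_edge[OF G] empty_subsetI insert_subset)
      then obtain p q where pq: "e = {p, q}" "q \<notin> P" by (cases "q' \<in> P") (auto simp: insert_commute)
      have pqL: "{p, q} \<in> L" using e pq by auto
      then have qp: "q \<in> N p" "p \<notin> H" "q \<notin> H" by (simp_all add: L_ends)
      have "p \<in> N q" using qp N_sym by blast
      then have pV: "p \<in> V" using NV by blast
      have "z \<in> insert p (N p)" if "z \<in> Z" for z
      proof -
        have "p \<in> insert z (N z)" using constr[OF pqL that] pq(2) by blast
        then show ?thesis using N_sym by blast
      qed
      then have "p \<in> K" using pV qp by (auto simp: K_def)
      moreover have "q \<in> N p - insert u (N u)" using qp pq by (auto simp: P_def)
      ultimately show "e \<in> (\<Union>c\<in>K. (\<lambda>q. {c, q}) ` (N c - insert u (N u)))" using pq by blast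
    qed
    moreover have fK: "finite K" using fin by (simp add: K_def)
    ultimately have "card (L - Lin) \<le> card (\<Union>c\<in>K. (\<lambda>q. {c, q}) ` (N c - insert u (N u)))"
      using fin by (intro card_mono) auto
    also have "\<dots> \<le> (\<Sum>c\<in>K. card ((\<lambda>q. {c, q}) ` (N c - insert u (N u))))"
      using fK by (rule card_UN_le)
    also have "\<dots> \<le> (\<Sum>c\<in>K. 3 * t + 3)"
      using Kout fin by (intro sum_mono) (meson card_image_le finite_Diff order_trans)
    also have "\<dots> \<le> (6 * t - 1) * (3 * t + 3)" unfolding sum_constant of_nat_id by (rule mult_le_mono1[OF cK])
    finally show ?thesis .
  qed
  define M where "M = {w \<in> W. 6 * t \<le> d w}"
  \<comment> \<open>Within \<open>P\<close> each degree is at most \<open>a - 1\<close>, and it is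
    at most \<open>6 t - 1\<close> except at the vertices of \<open>M\<close>, of which there are at
    most \<open>t + 1\<close>. The surplus at those is
    \<open>(a - 1) - (6 t - 1) = a - 6 t\<close>.\<close>
  have "in": "2 * card Lin \<le> a * (6 * t - 1) + (t + 1) * (a - 6 * t)"
  proof -
    have "2 * card Lin = (\<Sum>e\<in>Lin. 2)" by simp
    also have "\<dots> = (\<Sum>e\<in>Lin. card (e \<inter> P))"
    proof (rule sum.cong[OF refl])
      fix e assume e: "e \<in> Lin"
      then have "e \<inter> P = e" by (auto simp: Lin_def)
      then show "2 = card (e \<inter> P)" using e G by (auto simp: Lin_def L_def sgraph_def)
    qed
    also have "\<dots> = (\<Sum>c\<in>P. card {e \<in> Lin. c \<in> e})"
      using fP fL by (intro sum_card_incident[symmetric]) (auto simp: Lin_def)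
    also have "\<dots> \<le> (\<Sum>c\<in>P. 6 * t - 1 + (if c \<in> M then a - 6 * t else 0))"
    proof (rule sum_mono)
      fix c assume c: "c \<in> P"
      then have cV: "c \<in> V - H" using uV NV by (auto simp: P_def)
      have "card {e \<in> Lin. c \<in> e} \<le> d c"
        using cV by (intro card_edges_at_le[OF R]) (auto simp: Lin_def L_def)
      moreover have "d c \<le> 6 * t - 1" if "c \<notin> M" using that low[of c] cV by (cases "c \<in> W") (auto simp: M_def)
      moreover have "card {e \<in> Lin. c \<in> e} \<le> a - 1"
      proof -
        have "{e \<in> Lin. c \<in> e} \<subseteq> (\<lambda>y. {c, y}) ` (P - {c})"
        proof
          fix e assume e: "e \<in> {e \<in> Lin. c \<in> e}"
          then have "e \<in> E" by (auto simp: Lin_def L_def)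
          then obtain p q where "e = {p, q}" "p \<noteq> q" using sgraph_edge[OF G] by metis
          then show "e \<in> (\<lambda>y. {c, y}) ` (P - {c})" using e by (auto simp: Lin_def insert_commute)
        qed
        then have "card {e \<in> Lin. c \<in> e} \<le> card (P - {c})"
          using fP by (meson card_image_le card_mono finite_Diff finite_imageI order_trans)
        also have "\<dots> = card P - 1" using c fP by simp
        finally show ?thesis using cP by simp
      qed
      ultimately show "card {e \<in> Lin. c \<in> e} \<le> 6 * t - 1 + (if c \<in> M then a - 6 * t else 0)"
        using t3 by (cases "c \<in> M") auto
    qed
    also have "\<dots> = card P * (6 * t - 1) + card (P \<inter> M) * (a - 6 * t)"
      using fP by (simp only: sum.distrib sum.inter_restrict[symmetric] sum_constant) simp
    also have "\<dots> \<le> a * (6 * t - 1) + (t + 1) * (a - 6 * t)"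
    proof (intro add_mono mult_le_mono1 cP)
      have "card (P \<inter> M) \<le> card M" using fin by (intro card_mono) (auto simp: M_def)
      then show "card (P \<inter> M) \<le> t + 1" using med by (simp add: M_def)
    qed
    finally show ?thesis .
  qed
  have "card L = card (L - Lin) + card Lin"
  proof -
    have "Lin \<subseteq> L" by (auto simp: Lin_def)
    then show ?thesis using fL by (metis card_Diff_subset finite_subset card_mono le_add_diff_inverse2)
  qed
  then have upper: "2 * card L \<le> 2 * ((6 * t - 1) * (3 * t + 3)) + (a * (6 * t - 1) + (t + 1) * (a - 6 * t))"
    using out "in" by linarith
  have a_le: "a \<le> \<gamma> * (3 * t + 2) + 1"
  proof -
    have "(\<gamma> - 1) * (3 * t + 2) + (3 * t + 2) = \<gamma> * (3 * t + 2)" using \<gamma>2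
      by (metis Suc_diff_1 add.commute less_le_trans mult_Suc zero_less_numeral)
    then show ?thesis using \<zeta>_le by (simp add: a_def)
  qed
  show False
    by (rule counting_contradiction[OF t3 \<gamma>2 \<gamma>_le a_le nV lower upper])
qed

end

section \<open>Hosts with many vertices of large degree\<close>

definition clique :: "'a set set \<Rightarrow> 'a set \<Rightarrow> bool" where
  "clique E K \<longleftrightarrow> (\<forall>x\<in>K. \<forall>y\<in>K. x \<noteq> y \<longrightarrow> {x, y} \<in> E)"

definition joined :: "'a set set \<Rightarrow> 'a set \<Rightarrow> 'a set \<Rightarrow> bool" where
  "joined E A B \<longleftrightarrow> (\<forall>a\<in>A. \<forall>b\<in>B. {a, b} \<in> E)"

text \<open>\<open>W\<close> has room for the \<open>t + 2 = (3 t + 1) - (2 t - 1)\<close> vertices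
  of a 2-tree that the clique cannot take.\<close>

definition cherry_host :: "'a set \<Rightarrow> nat \<Rightarrow> 'a set set \<Rightarrow> bool" where
  "cherry_host V t E \<longleftrightarrow> (\<exists>H W a b c. H \<subseteq> V \<and> W \<subseteq> V \<and> H \<inter> W = {} \<and>
    card H = 2 * t - 1 \<and> t + 2 \<le> card W \<and> clique E H \<and> joined E H W \<and>
    {a, b, c} \<subseteq> W \<and> a \<noteq> b \<and> b \<noteq> c \<and> a \<noteq> c \<and> {a, b} \<in> E \<and> {b, c} \<in> E)"

text \<open>Each of \<open>z1\<close>, \<open>z2\<close> may miss one vertex of the clique: vertices of the second colour class of
  a 2-tree have non-neighbours to spare.\<close>

definition matching_host :: "'a set \<Rightarrow> nat \<Rightarrow> 'a set set \<Rightarrow> bool" where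
  "matching_host V t E \<longleftrightarrow> (\<exists>H F w1 z1 w2 z2 x1 x2. H \<subseteq> V \<and> F \<union> {w1, z1, w2, z2} \<subseteq> V \<and>
    H \<inter> (F \<union> {w1, z1, w2, z2}) = {} \<and> F \<inter> {w1, z1, w2, z2} = {} \<and> distinct [w1, z1, w2, z2] \<and>
    card H = 2 * t - 1 \<and> t \<le> card F \<and> clique E H \<and> joined E H (F \<union> {w1, w2}) \<and>
    x1 \<in> H \<and> x2 \<in> H \<and> joined E (H - {x1}) {z1} \<and> joined E (H - {x2}) {z2} \<and>
    {w1, z1} \<in> E \<and> {w2, z2} \<in> E)"

lemma cherry_hostI:
  assumes "H \<subseteq> V" "W \<subseteq> V" "H \<inter> W = {}" "card H = 2 * t - 1" "t + 2 \<le> card W" "clique E H"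
    "joined E H W" "{a, b, c} \<subseteq> W" "a \<noteq> b" "b \<noteq> c" "a \<noteq> c" "{a, b} \<in> E" "{b, c} \<in> E"
  shows "cherry_host V t E"
  using assms unfolding cherry_host_def by blast

lemma matching_hostI:
  assumes "H \<subseteq> V" "F \<union> {w1, z1, w2, z2} \<subseteq> V" "H \<inter> (F \<union> {w1, z1, w2, z2}) = {}"
    "F \<inter> {w1, z1, w2, z2} = {}" "distinct [w1, z1, w2, z2]" "card H = 2 * t - 1" "t \<le> card F"
    "clique E H" "joined E H (F \<union> {w1, w2})" "x1 \<in> H" "x2 \<in> H"
    "joined E (H - {x1}) {z1}" "joined E (H - {x2}) {z2}" "{w1, z1} \<in> E" "{w2, z2} \<in> E"
  shows "matching_host V t E"
  using assms unfolding matching_host_def by blast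

lemma card_remove_few:
  assumes "finite W" "m + length xs \<le> card W" shows "m \<le> card (W - set xs)"
proof -
  have "card W - card (set xs) \<le> card (W - set xs)" by (intro diff_card_le_card_Diff) auto
  moreover have "card (set xs) \<le> length xs" by (rule card_length)
  ultimately show ?thesis using assms by linarith
qed

lemma exists_outside_few:
  assumes "finite W" "length xs < card W" obtains z where "z \<in> W" "z \<notin> set xs"
proof -
  have "1 \<le> card (W - set xs)" using assms by (intro card_remove_few) auto
  then have "W - set xs \<noteq> {}" by force
  then show thesis using that by blast
qed

lemma outer_neighbour:
  assumes R: "realizes V d E" and "finite H" "w \<in> V" "card H < d w"
  obtains z where "{w, z} \<in> E" "z \<notin> H" "z \<in> V" "z \<noteq> w"
proof -
  have G: "sgraph V E" using R by (rule realizes_sgraph)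
  have "\<not> nbrs E w \<subseteq> H"
    using card_mono[of H "nbrs E w"] realizes_card_nbrs[OF R] assms by auto
  then obtain z where "z \<in> nbrs E w" "z \<notin> H" by blast
  then show thesis using that sgraph_ends[OF G] sgraph_no_loop[OF G] by (metis in_nbrs)
qed

text \<open>Exchanging \<open>wu\<close> and \<open>zy\<close> for \<open>wz\<close> and
  \<open>uy\<close> moves an edge that leaves \<open>H \<union> W\<close> into \<open>W\<close>. The
  price is the single join edge \<open>zy\<close>, which is why a matching host tolerates one
  missing vertex of the clique at each \<open>z\<close>.\<close>

lemma trade_edge:
  assumes R: "realizes V d E" and J: "joined E H W" "clique E H" "H \<inter> W = {}"
    and w: "w \<in> W" "{w, u} \<in> E" "u \<notin> H" and y: "y \<in> H" "{u, y} \<notin> E"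
    and z: "z \<in> W" "z \<noteq> w" "{w, z} \<notin> E"
  obtains E' where "realizes V d E'" "{w, z} \<in> E'"
    "\<And>e. e \<in> E \<Longrightarrow> e \<noteq> {w, u} \<Longrightarrow> e \<noteq> {z, y} \<Longrightarrow> e \<in> E'"
    "\<And>e. e \<in> E' \<Longrightarrow> e \<in> E \<or> e = {w, z} \<or> e = {u, y}"
    "clique E' H" "joined E' H (W - {z})" "joined E' (H - {y}) {z}"
proof -
  let ?E' = "E - {{w, u}, {z, y}} \<union> {{w, z}, {u, y}}"
  have zy: "{z, y} \<in> E" using J z y by (auto simp: joined_def insert_commute)
  have "realizes V d ?E'"
    using w y z zy by (intro switch2[OF R]) auto
  moreover have keep: "{h, x} \<in> ?E'" if "{h, x} \<in> E" "h \<in> H" "x \<in> H \<union> W" "x = z \<Longrightarrow> h \<noteq> y" for h x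
  proof -
    have "{h, x} \<noteq> {w, u}" using that(2) w J(3) by (auto simp: doubleton_eq_iff)
    moreover have "{h, x} \<noteq> {z, y}" using that(2,4) z J(3) by (auto simp: doubleton_eq_iff)
    ultimately show ?thesis using that(1) by simp
  qed
  have zH: "z \<notin> H" using z J(3) by auto
  have "clique ?E' H"
    unfolding clique_def
  proof (intro ballI impI)
    fix h x assume "h \<in> H" "x \<in> H" "h \<noteq> x"
    then show "{h, x} \<in> ?E'" using J(2) zH by (intro keep) (auto simp: clique_def)
  qed
  moreover have "joined ?E' H (W - {z})"
    unfolding joined_def
  proof (intro ballI)
    fix h x assume "h \<in> H" "x \<in> W - {z}"
    then show "{h, x} \<in> ?E'" using J(1) by (intro keep) (auto simp: joined_def)
  qed
  moreover have "joined ?E' (H - {y}) {z}"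
    unfolding joined_def
  proof (intro ballI)
    fix h x assume "h \<in> H - {y}" "x \<in> {z}"
    then show "{h, x} \<in> ?E'" using J(1) z by (intro keep) (auto simp: joined_def)
  qed
  ultimately show thesis using that[of ?E'] by auto
qed

text \<open>A second edge inside \<open>W\<close> gives a cherry or a matching at once. Otherwise a
  vertex \<open>w\<close> of degree at least \<open>2 t\<close> away from \<open>ff'\<close> has a
  neighbour \<open>u\<close> outside \<open>H \<union> W\<close>: either \<open>u\<close> is joined
  to \<open>H\<close> and \<open>wu\<close> is the second edge, or it misses some \<open>y\<close>
  in \<open>H\<close> and the edge is traded into \<open>W\<close>.\<close>

lemma host_from_edge:
  assumes R: "realizes V d E" and sub: "H \<subseteq> V" "W \<subseteq> V" "H \<inter> W = {}" and t3: "3 \<le> t"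
    and cards: "card H = 2 * t - 1" "t + 4 \<le> card W" and J: "clique E H" "joined E H W"
    and f: "f \<in> W" "f' \<in> W" "f \<noteq> f'" "{f, f'} \<in> E"
    and three: "3 \<le> card {w \<in> W. 2 * t \<le> d w}"
  shows "\<exists>E'. realizes V d E' \<and> (cherry_host V t E' \<or> matching_host V t E')"
proof -
  have G: "sgraph V E" using R by (rule realizes_sgraph)
  have fin: "finite V" "finite H" "finite W"
    using sgraph_finite[OF G] sub by (auto intro: finite_subset)
  have "H \<noteq> {}" using cards t3 by auto
  \<comment> \<open>A matching host names a vertex of \<open>H\<close> that each \<open>z\<close>
    may miss; where nothing is missed, any vertex of \<open>H\<close> serves.\<close>
  then obtain x0 where x0: "x0 \<in> H" by blast
  have disjoint_edges: ?thesis
    if p: "p \<in> W" "q \<in> W" "{p, q} \<in> E" "p \<noteq> q" "p \<notin> {f, f'}" "q \<notin> {f, f'}" for p q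
  proof -
    have "matching_host V t E"
    proof (rule matching_hostI[of H V "W - set [f, f', p, q]" f f' p q t E x0 x0])
      show "t \<le> card (W - set [f, f', p, q])" using fin cards by (intro card_remove_few) auto
    qed (use p f J sub cards x0 in \<open>auto simp: joined_def\<close>)
    then show ?thesis using R by blast
  qed
  have sharing_edges: ?thesis
    if p: "a \<in> W" "b \<in> W" "c \<in> W" "{a, b} \<in> E" "{b, c} \<in> E" "a \<noteq> c" for a b c
  proof -
    have "a \<noteq> b" "b \<noteq> c" using p sgraph_no_loop[OF G] by auto
    then have "cherry_host V t E"
      using p J sub cards by (intro cherry_hostI[of H V W t E a b c]) auto
    then show ?thesis using R by blast
  qed
  show ?thesis
  proof (cases "\<exists>p q. p \<in> W \<and> q \<in> W \<and> {p, q} \<in> E \<and> {p, q} \<noteq> {f, f'}")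
    case True
    then obtain p q where p: "p \<in> W" "q \<in> W" "{p, q} \<in> E" "{p, q} \<noteq> {f, f'}" by blast
    have pq: "p \<noteq> q" using p sgraph_no_loop[OF G] by auto
    show ?thesis
    proof (cases "p \<notin> {f, f'} \<and> q \<notin> {f, f'}")
      case True
      then show ?thesis using disjoint_edges p pq by blast
    next
      case False
      then consider "p = f" "q \<noteq> f'" | "p = f'" "q \<noteq> f" | "q = f" "p \<noteq> f'" | "q = f'" "p \<noteq> f"
        using p pq by auto
      then show ?thesis
      proof cases
        case 1 then show ?thesis using sharing_edges[of q f f'] p f pq by (auto simp: insert_commute)
      next
        case 2 then show ?thesis using sharing_edges[of q f' f] p f pq by (auto simp: insert_commute)
      next
        case 3 then show ?thesis using sharing_edges[of p f f'] p f pq by (auto simp: insert_commute)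
      next
        case 4 then show ?thesis using sharing_edges[of p f' f] p f pq by (auto simp: insert_commute)
      qed
    qed
  next
    case False
    then have only: "{p, q} = {f, f'}" if "p \<in> W" "q \<in> W" "{p, q} \<in> E" for p q using that by blast
    obtain w where w: "w \<in> W" "2 * t \<le> d w" "w \<notin> {f, f'}"
      using exists_outside_few[of "{w \<in> W. 2 * t \<le> d w}" "[f, f']"] three fin by auto
    have "w \<in> V" "card H < d w" using w sub cards t3 by auto
    then obtain u where u: "{w, u} \<in> E" "u \<notin> H" "u \<in> V" "u \<noteq> w"
      using outer_neighbour[OF R fin(2)] by metis
    have uW: "u \<notin> W" using only[of w u] w u by (auto simp: doubleton_eq_iff)
    show ?thesis
    proof (cases "\<forall>y\<in>H. {u, y} \<in> E")
      case True
      have "matching_host V t E"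
      proof (rule matching_hostI[of H V "W - set [f, f', w]" f f' w u t E x0 x0])
        show "t \<le> card (W - set [f, f', w])" using fin cards by (intro card_remove_few) auto
      qed (use True w u uW f J sub cards x0 in \<open>auto simp: joined_def insert_commute\<close>)
      then show ?thesis using R by blast
    next
      case False
      then obtain y where y: "y \<in> H" "{u, y} \<notin> E" by blast
      obtain z where z: "z \<in> W" "z \<notin> set [f, f', w]"
        using exists_outside_few[of W "[f, f', w]"] fin cards t3 by auto
      have wz: "{w, z} \<notin> E" using only[of w z] w z by (auto simp: doubleton_eq_iff)
      obtain E' where E': "realizes V d E'" "{w, z} \<in> E'"
        "\<And>e. e \<in> E \<Longrightarrow> e \<noteq> {w, u} \<Longrightarrow> e \<noteq> {z, y} \<Longrightarrow> e \<in> E'"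
        "\<And>e. e \<in> E' \<Longrightarrow> e \<in> E \<or> e = {w, z} \<or> e = {u, y}"
        "clique E' H" "joined E' H (W - {z})" "joined E' (H - {y}) {z}"
        using trade_edge[OF R J(2,1) sub(3) w(1) u(1,2) y z(1) _ wz] z by auto
      have "{f, f'} \<in> E'" using E'(3)[of "{f, f'}"] f w z by (auto simp: doubleton_eq_iff)
      then have "matching_host V t E'"
      proof (intro matching_hostI[of H V "W - set [f, f', w, z]" f f' w z t E' x0 y])
        show "t \<le> card (W - set [f, f', w, z])" using fin cards by (intro card_remove_few) auto
      qed (use w z y f E' J sub cards x0 in \<open>auto simp: joined_def\<close>)
      then show ?thesis using E'(1) by blast
    qed
  qed
qed

text \<open>With no edge inside \<open>W\<close>, both edges of the host have to be produced. Two
  vertices of degree at least \<open>2 t\<close> have neighbours outside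
  \<open>H \<union> W\<close>; each such edge is used as it stands if its outer end is joined to
  \<open>H\<close>, and is traded into \<open>W\<close> otherwise.\<close>

lemma host_from_join:
  assumes R: "realizes V d E" and sub: "H \<subseteq> V" "W \<subseteq> V" "H \<inter> W = {}" and t3: "3 \<le> t"
    and cards: "card H = 2 * t - 1" "t + 4 \<le> card W" and J: "clique E H" "joined E H W"
    and three: "3 \<le> card {w \<in> W. 2 * t \<le> d w}"
  shows "\<exists>E'. realizes V d E' \<and> (cherry_host V t E' \<or> matching_host V t E')"
proof (cases "\<exists>f f'. f \<in> W \<and> f' \<in> W \<and> f \<noteq> f' \<and> {f, f'} \<in> E")
  case True
  then show ?thesis using host_from_edge[OF R sub t3 cards J] three by blast
next
  case False
  have G: "sgraph V E" using R by (rule realizes_sgraph)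
  have fin: "finite V" "finite H" "finite W"
    using sgraph_finite[OF G] sub by (auto intro: finite_subset)
  have indep: "{p, q} \<notin> E" if "p \<in> W" "q \<in> W" for p q
    using False that sgraph_no_loop[OF G] by blast
  let ?D = "{w \<in> W. 2 * t \<le> d w}"
  obtain w1 where w1: "w1 \<in> W" "2 * t \<le> d w1"
    using exists_outside_few[of ?D "[]"] three fin by auto
  obtain w2 where w2: "w2 \<in> W" "2 * t \<le> d w2" "w2 \<noteq> w1"
    using exists_outside_few[of ?D "[w1]"] three fin by auto
  have "w1 \<in> V" "card H < d w1" using w1 sub cards t3 by auto
  then obtain u1 where u1: "{w1, u1} \<in> E" "u1 \<notin> H" "u1 \<in> V" "u1 \<noteq> w1"
    using outer_neighbour[OF R fin(2)] by metis
  have "w2 \<in> V" "card H < d w2" using w2 sub cards t3 by auto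
  then obtain u2 where u2: "{w2, u2} \<in> E" "u2 \<notin> H" "u2 \<in> V" "u2 \<noteq> w2"
    using outer_neighbour[OF R fin(2)] by metis
  have uW: "u1 \<notin> W" "u2 \<notin> W" using indep w1 w2 u1 u2 by auto
  show ?thesis
  proof (cases "\<forall>y\<in>H. {u1, y} \<in> E")
    case True
    have "3 \<le> card {w \<in> insert u1 W. 2 * t \<le> d w}"
      using three fin by (auto intro: order_trans[OF _ card_mono])
    then show ?thesis
      using True J uW u1 w1 sub cards fin
      by (intro host_from_edge[OF R sub(1) _ _ t3 cards(1), of "insert u1 W" w1 u1])
        (auto simp: joined_def insert_commute)
  next
    case False
    then obtain y1 where y1: "y1 \<in> H" "{u1, y1} \<notin> E" by blast
    obtain z1 where z1: "z1 \<in> W" "z1 \<notin> set [w1, w2]"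
      using exists_outside_few[of W "[w1, w2]"] fin cards t3 by auto
    obtain E1 where E1: "realizes V d E1" "{w1, z1} \<in> E1"
      "\<And>e. e \<in> E \<Longrightarrow> e \<noteq> {w1, u1} \<Longrightarrow> e \<noteq> {z1, y1} \<Longrightarrow> e \<in> E1"
      "\<And>e. e \<in> E1 \<Longrightarrow> e \<in> E \<or> e = {w1, z1} \<or> e = {u1, y1}"
      "clique E1 H" "joined E1 H (W - {z1})" "joined E1 (H - {y1}) {z1}"
      using trade_edge[OF R J(2,1) sub(3) w1(1) u1(1,2) y1 z1(1) _ indep] z1 w1 by auto
    have e2: "{w2, u2} \<in> E1" using E1(3)[of "{w2, u2}"] u2 w2 y1 w1 uW z1
      by (auto simp: doubleton_eq_iff)
    show ?thesis
    proof (cases "\<forall>y\<in>H. {u2, y} \<in> E1")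
      case True
      have "matching_host V t E1"
      proof (rule matching_hostI[of H V "W - set [w1, z1, w2]" w1 z1 w2 u2 t E1 y1 y1])
        show "t \<le> card (W - set [w1, z1, w2])" using fin cards by (intro card_remove_few) auto
      qed (use True w1 w2 z1 y1 u2 uW e2 E1 sub cards in \<open>auto simp: joined_def insert_commute\<close>)
      then show ?thesis using E1(1) by blast
    next
      case False
      then obtain y2 where y2: "y2 \<in> H" "{u2, y2} \<notin> E1" by blast
      obtain z2 where z2: "z2 \<in> W" "z2 \<notin> set [w1, z1, w2]"
        using exists_outside_few[of W "[w1, z1, w2]"] fin cards t3 by auto
      have nz: "{w2, z2} \<notin> E1" using E1(4)[of "{w2, z2}"] indep[of w2 z2] w1 w2 z2 z1 y1 sub(3)
        by (auto simp: doubleton_eq_iff)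
      \<comment> \<open>The second trade works with \<open>W - {z1}\<close>, because
        \<open>z1\<close> has already lost its edge to \<open>y1\<close>.\<close>
      have disj': "H \<inter> (W - {z1}) = {}" using sub by auto
      obtain E2 where E2: "realizes V d E2" "{w2, z2} \<in> E2"
        "\<And>e. e \<in> E1 \<Longrightarrow> e \<noteq> {w2, u2} \<Longrightarrow> e \<noteq> {z2, y2} \<Longrightarrow> e \<in> E2"
        "\<And>e. e \<in> E2 \<Longrightarrow> e \<in> E1 \<or> e = {w2, z2} \<or> e = {u2, y2}"
        "clique E2 H" "joined E2 H (W - {z1} - {z2})" "joined E2 (H - {y2}) {z2}"
        using trade_edge[OF E1(1) E1(6,5) disj' _ e2 u2(2) y2 _ _ nz] z2 w2 z1 by auto
      have "{w1, z1} \<in> E2" using E2(3)[of "{w1, z1}"] E1(2) w1 w2 z1 z2 by (auto simp: doubleton_eq_iff)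
      moreover have "joined E2 (H - {y1}) {z1}"
        using E1(7) E2(3) z1 z2 w2 uW sub(3) by (fastforce simp: joined_def doubleton_eq_iff)
      ultimately have "matching_host V t E2"
      proof (intro matching_hostI[of H V "W - set [w1, z1, w2, z2]" w1 z1 w2 z2 t E2 y1 y2])
        show "t \<le> card (W - set [w1, z1, w2, z2])" using fin cards by (intro card_remove_few) auto
      qed (use w1 w2 z1 z2 y1 y2 E2 sub cards in \<open>auto simp: joined_def\<close>)
      then show ?thesis using E2(1) by blast
    qed
  qed
qed

section \<open>Hosts with few vertices of large degree\<close>

definition clique_host :: "'a set \<Rightarrow> nat \<Rightarrow> 'a set set \<Rightarrow> bool" where
  "clique_host V t E \<longleftrightarrow> (\<exists>K\<subseteq>V. 3 * t + 1 \<le> card K \<and> clique E K)"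

text \<open>The sparse part is a complete graph on \<open>2 t + 2\<close> vertices minus the perfect
  matching of the pairs \<open>2 k\<close>, \<open>2 k + 1\<close>; pairs are recognised by
  \<open>div 2\<close>. Together with \<open>H\<close> this makes \<open>3 t + 1\<close>
  vertices.\<close>

definition cocktail_host :: "'a set \<Rightarrow> nat \<Rightarrow> 'a set set \<Rightarrow> bool" where
  "cocktail_host V t E \<longleftrightarrow> (\<exists>H \<phi>. H \<subseteq> V \<and> card H = t - 1 \<and> inj_on \<phi> {..<2 * t + 2} \<and>
    \<phi> ` {..<2 * t + 2} \<subseteq> V - H \<and> clique E H \<and> joined E H (\<phi> ` {..<2 * t + 2}) \<and>
    (\<forall>i<2 * t + 2. \<forall>j<2 * t + 2. i div 2 \<noteq> j div 2 \<longrightarrow> {\<phi> i, \<phi> j} \<in> E))"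

text \<open>\<open>P\<close> receives at most \<open>s + 1\<close> vertices of the second colour
  class, \<open>Q\<close> their neighbours in the largest class, and \<open>I\<close> offers room
  for the rest of that class.\<close>

definition bipartite_host :: "'a set \<Rightarrow> nat \<Rightarrow> nat \<Rightarrow> 'a set set \<Rightarrow> bool" where
  "bipartite_host V t s E \<longleftrightarrow> (\<exists>H P Q I. H \<subseteq> V \<and> P \<union> Q \<union> I \<subseteq> V - H \<and>
    P \<inter> (Q \<union> I) = {} \<and> Q \<inter> I = {} \<and>
    card H = 2 * t - 1 - s \<and> card P = s + 1 \<and> card Q = 2 * s \<and> card I = t + 2 - s \<and>
    clique E H \<and> joined E H (P \<union> Q \<union> I) \<and> joined E P Q)"

text \<open>Odd positions are meant for up to two vertices of the second class, even positions for
  their neighbours in the largest class. Seven vertices accommodate both two disjoint neighbourhoods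
  of size two and two that share a vertex.\<close>

definition path_host :: "'a set \<Rightarrow> nat \<Rightarrow> 'a set set \<Rightarrow> bool" where
  "path_host V t E \<longleftrightarrow> (\<exists>H \<phi> I. H \<subseteq> V \<and> inj_on \<phi> {..<7::nat} \<and> \<phi> ` {..<7} \<union> I \<subseteq> V - H \<and>
    \<phi> ` {..<7} \<inter> I = {} \<and> card H = 2 * t - 2 \<and> card I = t - 1 \<and>
    clique E H \<and> joined E H (\<phi> ` {..<7} \<union> I) \<and> (\<forall>i<6. {\<phi> i, \<phi> (Suc i)} \<in> E))"

definition sparse_host :: "'a set \<Rightarrow> nat \<Rightarrow> 'a set set \<Rightarrow> bool" where
  "sparse_host V t E \<longleftrightarrow> clique_host V t E \<or> cocktail_host V t E \<or> path_host V t E \<or>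
    (\<exists>s. 2 \<le> s \<and> s < t \<and> bipartite_host V t s E)"

lemma exists_top_set:
  fixes d :: "'a \<Rightarrow> nat"
  assumes "finite V" "m \<le> card V"
  obtains S where "S \<subseteq> V" "card S = m" "\<And>x y. x \<in> S \<Longrightarrow> y \<in> V - S \<Longrightarrow> d y \<le> d x"
  using assms
proof (induction m arbitrary: thesis)
  case 0
  then show ?case by (metis card.empty empty_iff empty_subsetI)
next
  case (Suc m)
  then obtain S where S: "S \<subseteq> V" "card S = m" "\<And>x y. x \<in> S \<Longrightarrow> y \<in> V - S \<Longrightarrow> d y \<le> d x"
    by (metis Suc_leD)
  have fS: "finite S" using S Suc.prems by (auto intro: finite_subset)
  have "V - S \<noteq> {}"
  proof
    assume "V - S = {}"
    then have "V = S" using S by auto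
    then show False using S Suc.prems by simp
  qed
  then have "\<exists>m. m \<in> V - S \<and> (\<forall>y\<in>V - S. d y \<le> d m)"
    using Suc.prems(2) Max_in[of "d ` (V - S)"] Max_ge[of "d ` (V - S)"]
    by (smt (verit) finite_Diff finite_imageI image_iff image_is_empty)
  then obtain x where x: "x \<in> V - S" "\<And>y. y \<in> V - S \<Longrightarrow> d y \<le> d x" by blast
  have "insert x S \<subseteq> V" "card (insert x S) = Suc m" using x S fS by auto
  moreover have "d y \<le> d z" if "z \<in> insert x S" "y \<in> V - insert x S" for y z
    using that x S by auto
  ultimately show ?case using Suc.prems(1) by blast
qed

lemma joined_mono: "joined E A B \<Longrightarrow> A' \<subseteq> A \<Longrightarrow> B' \<subseteq> B \<Longrightarrow> joined E A' B'"
  by (auto simp: joined_def)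

lemma int_two_choose: "2 * int (j choose 2) = int j * (int j - 1)"
proof -
  have "even (j * (j - 1))" by (cases j) auto
  then have "2 * (j choose 2) = j * (j - 1)" by (simp add: choose_two)
  then show ?thesis by (cases j) (auto simp flip: of_nat_mult simp: algebra_simps)
qed

text \<open>Each of the \<open>s\<close> vertices lacking in the clique leaves about
  \<open>n\<close> edges unaccounted for, which pays for the edges of the sparse rest and for the
  term \<open>\<mu> (\<mu> + 1)\<close> with \<open>\<mu> = 4 t + 1\<close>.\<close>

lemma edge_count_slack:
  fixes t s h n w c e :: nat
  assumes "1 \<le> t" and s: "1 \<le> s" "s \<le> 2 * t - 1" and h: "h = 2 * t - 1 - s"
    and n: "20 * t^2 + 23 * t + 5 \<le> n" and e: "(2 * t - 1) * (n - t) + 2 \<le> e"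
    and c: "c \<le> s * w" and w: "w \<le> 4 * t + 3"
  shows "(h choose 2) + h * (n - h) + c + (4 * t + 1) * (4 * t + 1 + 1) < e"
proof -
  define T where "T = int t"
  define S where "S = int s"
  define N where "N = int n"
  have T: "1 \<le> T" "1 \<le> S" "S \<le> 2 * T - 1" using assms by (auto simp: T_def S_def)
  have ih: "int h = 2 * T - 1 - S" using assms by (auto simp: T_def S_def)
  have N: "20 * T^2 + 23 * T + 5 \<le> N"
    using n unfolding T_def N_def
    by (metis (mono_tags, lifting) of_nat_le_iff of_nat_add of_nat_mult of_nat_numeral of_nat_power)
  have TT: "T \<le> T * T" using T by simp
  have "t \<le> n" "h \<le> n" using n h by auto
  then have e': "(2 * T - 1) * (N - T) + 2 \<le> int e"
    using e assms(1) zle_int[of "(2 * t - 1) * (n - t) + 2" e]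
    by (simp add: T_def N_def of_nat_diff)
  have ch: "2 * int (h choose 2) = int h * (int h - 1)" by (rule int_two_choose)
  have "c \<le> s * (4 * t + 3)" using c mult_le_mono2[OF w, of s] by linarith
  then have "int c \<le> int (s * (4 * t + 3))" by (simp only: of_nat_le_iff)
  then have c': "int c \<le> S * (4 * T + 3)" by (simp add: S_def T_def)
  have "S * (N - 6 * T - 3) \<ge> 1 * (20 * T^2 + 17 * T + 2)"
    using T N by (intro mult_mono) auto
  moreover have "S * (2 * T - 1 - S) \<ge> 0" using T by simp
  ultimately have "2 * (int (h choose 2) + int h * (N - int h) + int c + (4 * T + 1) * (4 * T + 2)) < 2 * int e"
    using e' c' ch T TT unfolding ih by (simp add: algebra_simps power2_eq_square)
  then have "int (h choose 2) + int h * (N - int h) + int c + (4 * T + 1) * (4 * T + 1 + 1) < int e"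
    by (simp add: algebra_simps)
  moreover have ih': "int (n - h) = N - int h" using \<open>h \<le> n\<close> by (simp add: N_def)
  ultimately have "int ((h choose 2) + h * (n - h) + c + (4 * t + 1) * (4 * t + 1 + 1)) < int e"
    using ih' by (simp only: of_nat_add of_nat_mult of_nat_numeral of_nat_1 N_def T_def)
  then show ?thesis by (simp only: of_nat_less_iff)
qed

text \<open>A vertex of \<open>W\<close> needs degree \<open>card H + 2 s = 2 t - 1 + s\<close>, and
  a vertex of \<open>H\<close> needs \<open>card (H \<union> W) - 1 \<le> 4 t + 2\<close>; these are
  precisely the degree assumptions. The rest \<open>C\<close> may be any graph on \<open>W\<close>
  of maximum degree \<open>2 s\<close>.\<close>

lemma core_realizable:
  assumes R: "realizes V d E" and t: "1 \<le> t" and s: "1 \<le> s" "s \<le> 2 * t - 1"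
    and H: "H \<subseteq> V" "card H = 2 * t - 1 - s" "\<And>x. x \<in> H \<Longrightarrow> 4 * t + 2 \<le> d x"
    and low: "\<And>x. x \<in> V - H \<Longrightarrow> d x \<le> 4 * t + 1"
    and n: "20 * t^2 + 23 * t + 5 \<le> card V" and e: "(2 * t - 1) * (card V - t) + 2 \<le> card E"
    and W: "W \<subseteq> V - H" "\<And>w. w \<in> W \<Longrightarrow> 2 * t - 1 + s \<le> d w" "card W \<le> 2 * t + 4 + s"
    and C: "sgraph W C" "\<And>w. w \<in> W \<Longrightarrow> card (nbrs C w) \<le> 2 * s"
  obtains E' where "realizes V d E'" "clique E' H" "joined E' H W" "C \<subseteq> E'"
proof -
  have fin: "finite V" "finite H" "finite W" "finite C"
    using realizes_sgraph[OF R] sgraph_finite[of V E] H W sgraph_finite_edges[OF C(1)]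
    by (auto intro: finite_subset)
  define U where "U = join_edges H W \<union> C"
  have U: "sgraph (H \<union> W) U" using fin C by (auto simp: U_def join_edges_def sgraph_def)
  have join: "{h, x} \<in> U" if "h \<in> H" "x \<in> H \<union> W" "h \<noteq> x" for h x
    using that by (auto simp: U_def join_edges_def)
  have cHW: "card (H \<union> W) \<le> 4 * t + 3"
    using card_Un_le[of H W] H W s by simp
  have degU: "card (nbrs U x) \<le> d x" if x: "x \<in> H \<union> W" for x
  proof (cases "x \<in> H")
    case True
    have "nbrs U x \<subseteq> H \<union> W - {x}" using sgraph_nbrs_subset[OF U] sgraph_not_self[OF U] by blast
    then have "card (nbrs U x) \<le> card (H \<union> W - {x})" using fin by (intro card_mono) auto
    also have "\<dots> = card (H \<union> W) - 1" using x by simp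
    finally show ?thesis using H(3)[OF True] cHW by linarith
  next
    case False
    then have "x \<in> W" using x by simp
    have "nbrs U x \<subseteq> H \<union> nbrs C x" using False by (auto simp: U_def in_nbrs join_edges_def)
    then have "card (nbrs U x) \<le> card (H \<union> nbrs C x)"
      using fin sgraph_finite_nbrs[OF C(1)] by (intro card_mono) auto
    also have "\<dots> \<le> card H + card (nbrs C x)" by (rule card_Un_le)
    finally show ?thesis using C(2)[OF \<open>x \<in> W\<close>] W(2)[OF \<open>x \<in> W\<close>] H(2) s by linarith
  qed
  have "{e \<in> U. e \<inter> H = {}} \<subseteq> C" by (auto simp: U_def join_edges_def)
  then have "card {e \<in> U. e \<inter> H = {}} \<le> card C" using fin by (intro card_mono)
  moreover have "2 * card C \<le> (\<Sum>w\<in>W. 2 * s)"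
    using C(2) handshake[OF C(1)] sum_mono[of W "\<lambda>w. card (nbrs C w)" "\<lambda>_. 2 * s"] by simp
  ultimately have c: "card {e \<in> U. e \<inter> H = {}} \<le> s * card W" by (simp add: mult.commute)
  have "card W \<le> 4 * t + 3" using W s by simp
  from edge_count_slack[OF t s H(2) n e c this]
  have big: "(card H choose 2) + card H * (card V - card H) + card {e \<in> U. e \<inter> H = {}}
      + (4 * t + 1) * (4 * t + 1 + 1) < card E" .
  obtain E' where E': "realizes V d E'" "U \<subseteq> E'"
    using realizes_containing[OF R _ _ U join degU low big] H W by blast
  have J: "{h, x} \<in> E'" if "h \<in> H" "x \<in> H \<union> W" "h \<noteq> x" for h x
    using join[OF that] E'(2) by blast
  have "clique E' H" "joined E' H W" "C \<subseteq> E'"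
    using E'(2) J W(1) by (fastforce simp: clique_def joined_def U_def)+
  then show thesis using that E'(1) by blast
qed

text \<open>If there were fewer, the sum of degrees would grow with \<open>n\<close> at rate at most
  \<open>(2 t - 2 + s) + (2 t - 1 - s) = 4 t - 3\<close>, whereas twice the number of edges grows at
  rate \<open>4 t - 2\<close>. The remaining terms are quadratic in \<open>t\<close> and are
  absorbed by the bound on \<open>n\<close>.\<close>

lemma many_candidates:
  assumes R: "realizes V d E" and t: "1 \<le> t" and s: "1 \<le> s" "s \<le> 2 * t - 1"
    and H: "H \<subseteq> V" "card H = 2 * t - 1 - s"
    and low: "\<And>x. x \<in> V - H \<Longrightarrow> d x \<le> 4 * t + 1"
    and n: "20 * t^2 + 23 * t + 5 \<le> card V" and e: "(2 * t - 1) * (card V - t) + 2 \<le> card E"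
  shows "2 * t + 4 + s \<le> card {x \<in> V - H. 2 * t - 1 + s \<le> d x}"
proof (rule ccontr)
  let ?Q = "{x \<in> V - H. 2 * t - 1 + s \<le> d x}"
  define q where "q = card ?Q"
  assume "\<not> ?thesis"
  then have q: "q \<le> 2 * t + 3 + s" by (simp add: q_def)
  have G: "sgraph V E" using R by (rule realizes_sgraph)
  have fin: "finite V" "finite H" using sgraph_finite[OF G] H by (auto intro: finite_subset)
  have "2 * card E = (\<Sum>x\<in>V. d x)" by (rule realizes_card_edges[OF R])
  also have "\<dots> = (\<Sum>x\<in>V - H. d x) + (\<Sum>x\<in>H. d x)" using H fin by (intro sum.subset_diff) auto
  also have "(\<Sum>x\<in>H. d x) \<le> (\<Sum>x\<in>H. card V - 1)"
  proof (rule sum_mono)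
    fix x assume "x \<in> H"
    then have x: "x \<in> V" using H by auto
    have "nbrs E x \<subseteq> V - {x}" using sgraph_nbrs_subset[OF G] sgraph_not_self[OF G] by blast
    then have "card (nbrs E x) \<le> card (V - {x})" using fin by (intro card_mono) auto
    then show "d x \<le> card V - 1" using x realizes_card_nbrs[OF R x] by simp
  qed
  also have "(\<Sum>x\<in>V - H. d x) \<le> (\<Sum>x\<in>V - H. (2 * t - 2 + s) + (if x \<in> ?Q then 2 * t + 3 - s else 0))"
  proof (rule sum_mono)
    fix x assume x: "x \<in> V - H"
    show "d x \<le> (2 * t - 2 + s) + (if x \<in> ?Q then 2 * t + 3 - s else 0)"
    proof (cases "x \<in> ?Q")
      case True
      then show ?thesis using low[OF x] s t by simp
    next
      case False
      then have "d x < 2 * t - 1 + s" using x by auto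
      then show ?thesis using t by simp
    qed
  qed
  also have "\<dots> = card (V - H) * (2 * t - 2 + s) + card ((V - H) \<inter> ?Q) * (2 * t + 3 - s)"
    using fin by (simp only: sum.distrib sum.inter_restrict[symmetric] finite_Diff sum_constant) (simp add: algebra_simps)
  also have "(V - H) \<inter> ?Q = ?Q" by auto
  also have "card (V - H) = card V - card H" using H fin by (simp add: card_Diff_subset)
  finally have E: "2 * card E \<le> (card V - card H) * (2 * t - 2 + s) + q * (2 * t + 3 - s)
      + card H * (card V - 1)" by (simp add: q_def)
  have "q * (2 * t + 3 - s) \<le> (2 * t + 3 + s) * (2 * t + 3 - s)" by (rule mult_le_mono1[OF q])
  then have *: "2 * ((2 * t - 1) * (card V - t) + 2) \<le> (card V - card H) * (2 * t - 2 + s)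
      + (2 * t + 3 + s) * (2 * t + 3 - s) + card H * (card V - 1)"
    using order_trans[OF mult_le_mono2[OF e, of 2] order_trans[OF E]] by (simp only: add_le_cancel_left add_le_cancel_right)
  define T where "T = int t"
  define S where "S = int s"
  define N where "N = int (card V)"
  have T: "1 \<le> T" "1 \<le> S" "S \<le> 2 * T - 1" using t s by (auto simp: T_def S_def)
  have N: "20 * T^2 + 23 * T + 5 \<le> N"
    using n unfolding T_def N_def
    by (metis (mono_tags, lifting) of_nat_le_iff of_nat_add of_nat_mult of_nat_numeral of_nat_power)
  have "card H \<le> card V" using H fin by (intro card_mono) auto
  have i: "int (2 * t - 1) = 2 * T - 1" "int (card V - t) = N - T" "int (card V - card H) = N - (2 * T - 1 - S)"
    "int (2 * t - 2) = 2 * T - 2" "int (2 * t + 3 - s) = 2 * T + 3 - S"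
    "int (card H) = 2 * T - 1 - S" "int (card V - 1) = N - 1" "int t = T" "int s = S"
    using t s n H(2) \<open>card H \<le> card V\<close> by (auto simp: T_def S_def N_def of_nat_diff)
  have "int (2 * ((2 * t - 1) * (card V - t) + 2)) \<le> int ((card V - card H) * (2 * t - 2 + s)
      + (2 * t + 3 + s) * (2 * t + 3 - s) + card H * (card V - 1))" using * by linarith
  then have "2 * ((2 * T - 1) * (N - T) + 2) \<le> (N - (2 * T - 1 - S)) * (2 * T - 2 + S)
      + (2 * T + 3 + S) * (2 * T + 3 - S) + (2 * T - 1 - S) * (N - 1)"
    by (simp only: of_nat_add of_nat_mult of_nat_numeral of_nat_1 i)
  moreover have "(2 * T - 1 - S) * (2 * T - 2 + S) \<ge> 0" using T by simp
  moreover have "S * S \<ge> 0" "T \<le> T * T" using T by simp_all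
  ultimately show False using N T unfolding power2_eq_square by (simp only: algebra_simps)
qed

lemma exists_subset_card:
  assumes "finite A" "m \<le> card A" obtains B where "B \<subseteq> A" "card B = m" "finite B"
  using assms by (meson finite_subset obtain_subset_with_card_n)

text \<open>The deficit \<open>s\<close> decides which graph of maximum degree \<open>2 s\<close>
  serves as sparse rest: for \<open>s > t\<close> a clique on \<open>t + 2 + s\<close> vertices, for
  \<open>s = t\<close> a cocktail party graph on \<open>2 t + 2\<close> vertices, for
  \<open>2 \<le> s < t\<close> a complete bipartite graph with sides \<open>s + 1\<close> and
  \<open>2 s\<close>, and for \<open>s = 1\<close> a path.\<close>

lemma exists_sparse_host:
  assumes R: "realizes V d E" and t: "3 \<le> t"
    and few: "card {x \<in> V. 4 * t + 2 \<le> d x} < 2 * t - 1"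
    and n: "20 * t^2 + 23 * t + 5 \<le> card V" and e: "(2 * t - 1) * (card V - t) + 2 \<le> card E"
  shows "\<exists>E'. realizes V d E' \<and> sparse_host V t E'"
proof -
  define H where "H = {x \<in> V. 4 * t + 2 \<le> d x}"
  define s where "s = 2 * t - 1 - card H"
  have s: "1 \<le> s" "s \<le> 2 * t - 1" and cH: "card H = 2 * t - 1 - s" using few by (auto simp: s_def H_def)
  have HV: "H \<subseteq> V" and degH: "\<And>x. x \<in> H \<Longrightarrow> 4 * t + 2 \<le> d x"
    and low: "\<And>x. x \<in> V - H \<Longrightarrow> d x \<le> 4 * t + 1" by (auto simp: H_def)
  have t1: "1 \<le> t" using t by simp
  have fV: "finite V" using realizes_sgraph[OF R] by (rule sgraph_finite)
  let ?Q = "{x \<in> V - H. 2 * t - 1 + s \<le> d x}"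
  have fQ: "finite ?Q" using fV by simp
  have cQ: "2 * t + 4 + s \<le> card ?Q" by (rule many_candidates[OF R t1 s HV cH low n e])
  have core: "\<exists>E'. realizes V d E' \<and> clique E' H \<and> joined E' H W \<and> C \<subseteq> E'"
    if W: "W \<subseteq> ?Q" "card W \<le> 2 * t + 4 + s" "sgraph W C" "\<And>w. w \<in> W \<Longrightarrow> card (nbrs C w) \<le> 2 * s" for W C
  proof -
    have "W \<subseteq> V - H" "\<And>w. w \<in> W \<Longrightarrow> 2 * t - 1 + s \<le> d w" using W by auto
    then show ?thesis using core_realizable[OF R t1 s HV cH degH low n e _ _ W(2-4)] by metis
  qed
  have cHn: "card H + s = 2 * t - 1" using cH s by simp
  consider "t < s" | "s = t" | "2 \<le> s" "s < t" | "s = 1" using s by linarith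
  then show ?thesis
  proof cases
    case 1
    obtain W where W: "W \<subseteq> ?Q" "card W = t + 2 + s" "finite W"
      using exists_subset_card[OF fQ, of "t + 2 + s"] cQ by auto
    define C where "C = {e. e \<subseteq> W \<and> card e = 2}"
    have C: "sgraph W C" using W by (auto simp: C_def sgraph_def)
    have "card (nbrs C w) \<le> 2 * s" if "w \<in> W" for w
    proof -
      have "nbrs C w \<subseteq> W - {w}" using sgraph_nbrs_subset[OF C] sgraph_not_self[OF C] by blast
      then have "card (nbrs C w) \<le> card (W - {w})" using W by (intro card_mono) auto
      then show ?thesis using W that 1 by simp
    qed
    then obtain E' where E': "realizes V d E'" "clique E' H" "joined E' H W" "C \<subseteq> E'"
      using core[OF W(1) _ C] W 1 by auto
    have "clique E' (H \<union> W)"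
      unfolding clique_def
    proof (intro ballI impI)
      fix x y assume xy: "x \<in> H \<union> W" "y \<in> H \<union> W" "x \<noteq> y"
      then have "{x, y} \<in> C" if "x \<in> W" "y \<in> W" using that by (auto simp: C_def)
      then show "{x, y} \<in> E'"
        using E' xy unfolding clique_def joined_def by (metis UnE insert_commute subsetD)
    qed
    moreover have "card (H \<union> W) = card H + card W"
      using W HV fV by (intro card_Un_disjoint) (auto intro: finite_subset)
    then have "3 * t + 1 \<le> card (H \<union> W)" using W cHn by simp
    moreover have "H \<union> W \<subseteq> V" using W HV by auto
    ultimately have "clique_host V t E'" unfolding clique_host_def by blast
    then show ?thesis using E' unfolding sparse_host_def by blast
  next
    case 2
    obtain W where W: "W \<subseteq> ?Q" "card W = 2 * t + 2" "finite W"
      using exists_subset_card[OF fQ, of "2 * t + 2"] cQ by auto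
    obtain \<phi> where \<phi>: "bij_betw \<phi> {..<2 * t + 2} W"
      using ex_bij_betw_nat_finite[OF W(3)] W(2) by (auto simp: atLeast0LessThan)
    define C where "C = {{\<phi> i, \<phi> j} |i j. i < 2 * t + 2 \<and> j < 2 * t + 2 \<and> i div 2 \<noteq> j div 2}"
    have inj: "inj_on \<phi> {..<2 * t + 2}" and im: "\<phi> ` {..<2 * t + 2} = W"
      using \<phi> by (auto simp: bij_betw_def)
    have \<phi>_eq: "\<phi> i = \<phi> j \<longleftrightarrow> i = j" if "i < 2 * t + 2" "j < 2 * t + 2" for i j
      using inj that by (auto simp: inj_on_def)
    have C: "sgraph W C" unfolding sgraph_def
    proof (intro conjI ballI W(3))
      fix e assume "e \<in> C"
      then obtain i j where ij: "e = {\<phi> i, \<phi> j}" "i < 2 * t + 2" "j < 2 * t + 2" "i \<noteq> j"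
        by (auto simp: C_def)
      then show "e \<subseteq> W" using im by auto
      show "card e = 2" using ij \<phi>_eq by auto
    qed
    have "card (nbrs C w) \<le> 2 * s" if w: "w \<in> W" for w
    proof -
      obtain i where i: "w = \<phi> i" "i < 2 * t + 2" using w im by auto
      let ?p = "{2 * (i div 2), Suc (2 * (i div 2))}"
      have "nbrs C w \<subseteq> \<phi> ` ({..<2 * t + 2} - ?p)"
      proof
        fix y assume "y \<in> nbrs C w"
        then obtain k j where kj: "{w, y} = {\<phi> k, \<phi> j}" "k < 2 * t + 2" "j < 2 * t + 2" "k div 2 \<noteq> j div 2"
          by (auto simp: C_def in_nbrs)
        then consider "w = \<phi> k" "y = \<phi> j" | "w = \<phi> j" "y = \<phi> k" by (auto simp: doubleton_eq_iff)
        then show "y \<in> \<phi> ` ({..<2 * t + 2} - ?p)"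
        proof cases
          case 1
          then have "k = i" using i kj \<phi>_eq by auto
          then have "j \<in> {..<2 * t + 2} - ?p" using kj by auto
          then show ?thesis using 1 by blast
        next
          case 2
          then have "j = i" using i kj \<phi>_eq by auto
          then have "k \<in> {..<2 * t + 2} - ?p" using kj by auto
          then show ?thesis using 2 by blast
        qed
      qed
      then have "card (nbrs C w) \<le> card (\<phi> ` ({..<2 * t + 2} - ?p))" by (intro card_mono) auto
      also have "\<dots> \<le> card ({..<2 * t + 2} - ?p)" by (intro card_image_le) auto
      also have "\<dots> = 2 * t"
      proof -
        have "?p \<subseteq> {..<2 * t + 2}" using i(2) by (auto; presburger)
        then show ?thesis by (subst card_Diff_subset) auto
      qed
      finally show ?thesis using 2 by simp
    qed
    then obtain E' where E': "realizes V d E'" "clique E' H" "joined E' H W" "C \<subseteq> E'"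
      using core[OF W(1) _ C] W 2 by auto
    have "card H = t - 1" using cHn 2 by simp
    moreover have "W \<subseteq> V - H" using W by auto
    moreover have "{\<phi> i, \<phi> j} \<in> E'" if "i < 2 * t + 2" "j < 2 * t + 2" "i div 2 \<noteq> j div 2" for i j
      using that E'(4) by (auto simp: C_def)
    ultimately have "cocktail_host V t E'"
      unfolding cocktail_host_def using HV inj im E'(2,3) by blast
    then show ?thesis using E' unfolding sparse_host_def by blast
  next
    case 3
    obtain P where P: "P \<subseteq> ?Q" "card P = s + 1" "finite P"
      using exists_subset_card[OF fQ, of "s + 1"] cQ by auto
    have "2 * s \<le> card (?Q - P)" using P cQ 3 by (simp add: card_Diff_subset)
    then obtain Q where Q: "Q \<subseteq> ?Q - P" "card Q = 2 * s" "finite Q"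
      using exists_subset_card[of "?Q - P" "2 * s"] fQ by auto
    have "t + 2 - s \<le> card (?Q - P - Q)" using P Q cQ 3 by (simp add: card_Diff_subset)
    then obtain I where I: "I \<subseteq> ?Q - P - Q" "card I = t + 2 - s" "finite I"
      using exists_subset_card[of "?Q - P - Q" "t + 2 - s"] fQ by auto
    define C where "C = {{p, q} |p q. p \<in> P \<and> q \<in> Q}"
    have W: "P \<union> Q \<union> I \<subseteq> ?Q" using P Q I by auto
    have "card (P \<union> Q \<union> I) \<le> card P + card Q + card I"
      using card_Un_le[of P Q] card_Un_le[of "P \<union> Q" I] by linarith
    then have cW: "card (P \<union> Q \<union> I) \<le> 2 * t + 4 + s" using P Q I 3 by simp
    have C: "sgraph (P \<union> Q \<union> I) C" unfolding sgraph_def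
    proof (intro conjI ballI)
      fix e assume "e \<in> C"
      then obtain p q where pq: "e = {p, q}" "p \<in> P" "q \<in> Q" by (auto simp: C_def)
      then have "p \<noteq> q" using Q by auto
      then show "e \<subseteq> P \<union> Q \<union> I" "card e = 2" using pq by auto
    qed (use P Q I in auto)
    have "card (nbrs C w) \<le> 2 * s" if "w \<in> P \<union> Q \<union> I" for w
    proof -
      have "nbrs C w \<subseteq> P \<or> nbrs C w \<subseteq> Q"
      proof (cases "w \<in> P")
        case True
        then show ?thesis using Q by (auto simp: in_nbrs C_def doubleton_eq_iff)
      next
        case False
        then show ?thesis by (auto simp: in_nbrs C_def doubleton_eq_iff)
      qed
      then have "card (nbrs C w) \<le> card P \<or> card (nbrs C w) \<le> card Q"
        using P Q card_mono by metis
      then show ?thesis using P Q 3 by auto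
    qed
    then obtain E' where E': "realizes V d E'" "clique E' H" "joined E' H (P \<union> Q \<union> I)" "C \<subseteq> E'"
      using core[OF W cW C] by auto
    have "joined E' P Q" using E'(4) by (auto simp: joined_def C_def)
    moreover have "P \<union> Q \<union> I \<subseteq> V - H" using W by auto
    moreover have "P \<inter> (Q \<union> I) = {}" "Q \<inter> I = {}" using Q I by auto
    ultimately have "bipartite_host V t s E'"
      unfolding bipartite_host_def using HV cH P(2) Q(2) I(2) E'(2,3) by blast
    then show ?thesis using E' 3 unfolding sparse_host_def by blast
  next
    case 4
    obtain P where P: "P \<subseteq> ?Q" "card P = 7" "finite P"
      using exists_subset_card[OF fQ, of 7] cQ t by auto
    have "t - 1 \<le> card (?Q - P)" using P cQ by (simp add: card_Diff_subset)
    then obtain I where I: "I \<subseteq> ?Q - P" "card I = t - 1" "finite I"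
      using exists_subset_card[of "?Q - P" "t - 1"] fQ by auto
    obtain \<phi> where \<phi>: "bij_betw \<phi> {..<7::nat} P"
      using ex_bij_betw_nat_finite[OF P(3)] P(2) by (auto simp: atLeast0LessThan)
    have inj: "inj_on \<phi> {..<7}" and im: "\<phi> ` {..<7} = P"
      using \<phi> by (auto simp: bij_betw_def)
    have \<phi>_eq: "\<phi> i = \<phi> j \<longleftrightarrow> i = j" if "i < 7" "j < 7" for i j
      using inj that by (auto simp: inj_on_def)
    define C where "C = {{\<phi> i, \<phi> (Suc i)} |i. i < 6}"
    have W: "P \<union> I \<subseteq> ?Q" using P I by auto
    have cW: "card (P \<union> I) \<le> 2 * t + 4 + s"
      using card_Un_le[of P I] P I 4 t by simp
    have C: "sgraph (P \<union> I) C" unfolding sgraph_def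
    proof (intro conjI ballI)
      fix e assume "e \<in> C"
      then obtain i where i: "e = {\<phi> i, \<phi> (Suc i)}" "i < 6" by (auto simp: C_def)
      then show "e \<subseteq> P \<union> I" using im by auto
      show "card e = 2" using i \<phi>_eq[of i "Suc i"] by auto
    qed (use P I in auto)
    have "card (nbrs C w) \<le> 2 * s" if "w \<in> P \<union> I" for w
    proof (cases "w \<in> P")
      case True
      then obtain i where i: "w = \<phi> i" "i < 7" using im by auto
      \<comment> \<open>At the two ends of the path, \<open>i - 1 = 0\<close> and position
        \<open>7\<close> name no real neighbour; the set is meant as an upper bound only.\<close>
      have "nbrs C w \<subseteq> {\<phi> (i - 1), \<phi> (Suc i)}"
      proof
        fix y assume "y \<in> nbrs C w"
        then obtain k where k: "{w, y} = {\<phi> k, \<phi> (Suc k)}" "k < 6" by (auto simp: C_def in_nbrs)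
        then consider "w = \<phi> k" "y = \<phi> (Suc k)" | "w = \<phi> (Suc k)" "y = \<phi> k" by (auto simp: doubleton_eq_iff)
        then show "y \<in> {\<phi> (i - 1), \<phi> (Suc i)}"
        proof cases
          case 1
          then have "k = i" using i k \<phi>_eq[of k i] by auto
          then show ?thesis using 1 by blast
        next
          case 2
          then have "Suc k = i" using i k \<phi>_eq[of "Suc k" i] by auto
          then show ?thesis using 2 by auto
        qed
      qed
      then have "card (nbrs C w) \<le> card {\<phi> (i - 1), \<phi> (Suc i)}" by (intro card_mono) auto
      also have "\<dots> \<le> 2" by (simp add: card_insert_if)
      finally show ?thesis using 4 by simp
    next
      case False
      then have "nbrs C w = {}" using im by (auto simp: in_nbrs C_def doubleton_eq_iff)
      then show ?thesis by simp
    qed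
    then obtain E' where E': "realizes V d E'" "clique E' H" "joined E' H (P \<union> I)" "C \<subseteq> E'"
      using core[OF W cW C] by auto
    have "\<phi> ` {..<7} \<union> I \<subseteq> V - H" "\<phi> ` {..<7} \<inter> I = {}" using W I im by auto
    moreover have "card H = 2 * t - 2" using cH 4 by simp
    moreover have "joined E' H (\<phi> ` {..<7} \<union> I)" using E' im by simp
    moreover have "\<forall>i<6. {\<phi> i, \<phi> (Suc i)} \<in> E'" using E' by (auto simp: C_def)
    ultimately have "path_host V t E'"
      unfolding path_host_def using HV inj I(2) E'(2) by blast
    then show ?thesis using E' unfolding sparse_host_def by blast
  qed
qed

section \<open>Numbers of vertices of given degree and the choice of a host\<close>

lemma card_edges_le_sum_outside:
  assumes R: "realizes V d E" and J: "J \<subseteq> V"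
  shows "card E \<le> (card J choose 2) + (\<Sum>x\<in>V - J. d x)"
proof -
  have G: "sgraph V E" using R by (rule realizes_sgraph)
  have fin: "finite V" "finite E" "finite J"
    using sgraph_finite[OF G] sgraph_finite_edges[OF G] J by (auto intro: finite_subset)
  let ?I = "{e. e \<subseteq> J \<and> card e = 2}"
  have "E \<subseteq> ?I \<union> (\<Union>x\<in>V - J. {e \<in> E. x \<in> e})" using G by (auto simp: sgraph_def)
  then have "card E \<le> card (?I \<union> (\<Union>x\<in>V - J. {e \<in> E. x \<in> e}))"
    using fin by (intro card_mono) (auto intro: finite_subset[of _ "Pow J"])
  also have "\<dots> \<le> card ?I + card (\<Union>x\<in>V - J. {e \<in> E. x \<in> e})" by (rule card_Un_le)
  also have "card (\<Union>x\<in>V - J. {e \<in> E. x \<in> e}) \<le> (\<Sum>x\<in>V - J. card {e \<in> E. x \<in> e})"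
    using fin by (intro card_UN_le) auto
  also have "\<dots> = (\<Sum>x\<in>V - J. d x)"
    using card_incident[OF G] realizes_card_nbrs[OF R] by (intro sum.cong) auto
  also have "card ?I = card J choose 2" using fin by (simp add: n_subsets)
  finally show ?thesis by simp
qed

lemma card_edges_le_threshold:
  assumes R: "realizes V d E" and "1 \<le> m"
  shows "card E \<le> (card {x \<in> V. m \<le> d x} choose 2) + (card V - card {x \<in> V. m \<le> d x}) * (m - 1)"
proof -
  let ?J = "{x \<in> V. m \<le> d x}"
  have fV: "finite V" using R realizes_sgraph sgraph_finite by metis
  have "(\<Sum>x\<in>V - ?J. d x) \<le> (\<Sum>x\<in>V - ?J. m - 1)" by (intro sum_mono) auto
  also have "\<dots> = (card V - card ?J) * (m - 1)" using fV by (simp add: card_Diff_subset)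
  finally show ?thesis using card_edges_le_sum_outside[OF R, of ?J] by auto
qed

text \<open>This guarantees that \<open>H \<union> W\<close>, the top \<open>3 t + 3\<close>
  vertices, have degree at least \<open>card H\<close>. With at most \<open>3 t + 2\<close> such
  vertices the number of edges grows with \<open>n\<close> only at rate \<open>2 t - 2\<close>
  instead of \<open>2 t - 1\<close>.\<close>

lemma many_of_degree_clique:
  assumes R: "realizes V d E" and t: "1 \<le> t"
    and n: "20 * t^2 + 23 * t + 5 \<le> card V" and e: "(2 * t - 1) * (card V - t) + 2 \<le> card E"
  shows "3 * t + 3 \<le> card {x \<in> V. 2 * t - 1 \<le> d x}"
proof (rule ccontr)
  define j where "j = card {x \<in> V. 2 * t - 1 \<le> d x}"
  assume "\<not> ?thesis"
  then have j: "j \<le> 3 * t + 2" by (simp add: j_def)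
  have fV: "finite V" using R realizes_sgraph sgraph_finite by metis
  have jn: "j \<le> card V" unfolding j_def using fV by (intro card_mono) auto
  define T where "T = int t"
  define N where "N = int (card V)"
  define K where "K = int j"
  have T: "1 \<le> T" "0 \<le> K" "K \<le> 3 * T + 2" using t j by (auto simp: T_def K_def)
  have N: "20 * T^2 + 23 * T + 5 \<le> N"
    using n unfolding T_def N_def
    by (metis (mono_tags, lifting) of_nat_le_iff of_nat_add of_nat_mult of_nat_numeral of_nat_power)
  have "(2 * t - 1) * (card V - t) + 2 \<le> (j choose 2) + (card V - j) * (2 * t - 1 - 1)"
    using card_edges_le_threshold[OF R, of "2 * t - 1"] t e unfolding j_def by linarith
  then have "int ((2 * t - 1) * (card V - t) + 2) \<le> int ((j choose 2) + (card V - j) * (2 * t - 1 - 1))"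
    by (simp only: of_nat_le_iff)
  moreover have "int (2 * t - 1) = 2 * T - 1" "int (card V - t) = N - T"
    "int (card V - j) = N - K" "int (2 * t - 1 - 1) = 2 * T - 2"
    using t n jn by (auto simp: T_def N_def K_def of_nat_diff)
  ultimately have "(2 * T - 1) * (N - T) + 2 \<le> int (j choose 2) + (N - K) * (2 * T - 2)"
    by (simp only: of_nat_add of_nat_mult of_nat_numeral)
  moreover have "2 * int (j choose 2) = K * (K - 1)" unfolding K_def by (rule int_two_choose)
  ultimately have "2 * ((2 * T - 1) * (N - T) + 2) \<le> K * (K - 1) + 2 * ((N - K) * (2 * T - 2))"
    by (simp add: algebra_simps)
  moreover have "(3 * T + 2 - K) * K \<ge> 0" "(T - 1) * K \<ge> 0" "T * (3 * T + 2 - K) \<ge> 0" "0 \<le> T * T" using T by simp_all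
  ultimately show False using N T unfolding power2_eq_square by (simp only: algebra_simps)
qed

text \<open>This is where two surplus edges are decisive. With \<open>j\<close> vertices of degree
  at least \<open>2 t\<close>, there are at most \<open>r (n - t)\<close> edges for
  \<open>j = 2 t - 1\<close> and \<open>j = 2 t\<close>, and at most \<open>r (n - t) + 1\<close>
  for \<open>j = 2 t + 1\<close>.\<close>

lemma many_of_larger_degree:
  assumes R: "realizes V d E" and t: "1 \<le> t" and n: "t \<le> card V"
    and e: "(2 * t - 1) * (card V - t) + 2 \<le> card E"
    and j: "2 * t - 1 \<le> card {x \<in> V. 2 * t \<le> d x}"
  shows "2 * t + 2 \<le> card {x \<in> V. 2 * t \<le> d x}"
proof (rule ccontr)
  define j where "j = card {x \<in> V. 2 * t \<le> d x}"
  assume "\<not> ?thesis"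
  then have j: "j = 2 * t - 1 \<or> j = 2 * t \<or> j = 2 * t + 1" using j by (auto simp: j_def)
  have fV: "finite V" using R realizes_sgraph sgraph_finite by metis
  have jn: "j \<le> card V" unfolding j_def using fV by (intro card_mono) auto
  define T where "T = int t"
  define N where "N = int (card V)"
  define K where "K = int j"
  have T: "1 \<le> T" "K = 2 * T - 1 \<or> K = 2 * T \<or> K = 2 * T + 1" using t j by (auto simp: T_def K_def)
  have "(2 * t - 1) * (card V - t) + 2 \<le> (j choose 2) + (card V - j) * (2 * t - 1)"
    using card_edges_le_threshold[OF R, of "2 * t"] t e unfolding j_def by linarith
  then have "int ((2 * t - 1) * (card V - t) + 2) \<le> int ((j choose 2) + (card V - j) * (2 * t - 1))"
    by (simp only: of_nat_le_iff)
  moreover have "int (2 * t - 1) = 2 * T - 1" "int (card V - t) = N - T" "int (card V - j) = N - K"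
    using t n jn by (auto simp: T_def N_def K_def of_nat_diff)
  ultimately have "(2 * T - 1) * (N - T) + 2 \<le> int (j choose 2) + (N - K) * (2 * T - 1)"
    by (simp only: of_nat_add of_nat_mult of_nat_numeral)
  moreover have "2 * int (j choose 2) = K * (K - 1)" unfolding K_def by (rule int_two_choose)
  ultimately have "2 * ((2 * T - 1) * (N - T) + 2) \<le> K * (K - 1) + 2 * ((N - K) * (2 * T - 1))"
    by (simp add: algebra_simps)
  then show False using T(2) by (elim disjE) (simp_all add: algebra_simps)
qed

text \<open>The case of \<open>3 t + 1\<close> vertices of degree at least \<open>6 t\<close> is
  split off because it yields a clique outright; its failure bounds the degrees in and beyond
  \<open>W\<close>, as the join argument demands.\<close>

lemma exists_host:
  assumes R: "realizes V d E" and t: "3 \<le> t"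
    and n: "20 * t^2 + 23 * t + 5 \<le> card V" and e: "(2 * t - 1) * (card V - t) + 2 \<le> card E"
  shows "\<exists>E'. realizes V d E' \<and> (sparse_host V t E' \<or> cherry_host V t E' \<or> matching_host V t E')"
proof -
  have fV: "finite V" using R realizes_sgraph sgraph_finite by metis
  consider "3 * t + 1 \<le> card {x \<in> V. 6 * t \<le> d x}" | "card {x \<in> V. 4 * t + 2 \<le> d x} < 2 * t - 1"
    | "card {x \<in> V. 6 * t \<le> d x} \<le> 3 * t" "2 * t - 1 \<le> card {x \<in> V. 4 * t + 2 \<le> d x}"
    by linarith
  then show ?thesis
  proof cases
    case 1
    obtain X where X: "X \<subseteq> {x \<in> V. 6 * t \<le> d x}" "card X = 3 * t + 1" "finite X"
      using exists_subset_card[OF _ 1] fV by auto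
    have "X \<subseteq> V" "\<And>x. x \<in> X \<Longrightarrow> 2 * (3 * t + 1) - 2 \<le> d x" using X by auto
    then obtain E' K where "realizes V d E'" "K \<subseteq> V" "card K \<ge> 3 * t + 1"
      "\<And>x y. x \<in> K \<Longrightarrow> y \<in> K \<Longrightarrow> x \<noteq> y \<Longrightarrow> {x, y} \<in> E'"
      using realizes_clique[OF R _ X(2)] by metis
    then show ?thesis unfolding sparse_host_def clique_host_def clique_def by blast
  next
    case 2
    then show ?thesis using exists_sparse_host[OF R t _ n e] by blast
  next
    case 3
    have "card {x \<in> V. 4 * t + 2 \<le> d x} \<le> card V" using fV by (intro card_mono) auto
    then obtain H where H: "H \<subseteq> V" "card H = 2 * t - 1" "\<And>x y. x \<in> H \<Longrightarrow> y \<in> V - H \<Longrightarrow> d y \<le> d x"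
      using exists_top_set[OF fV, of "2 * t - 1" d] 3 by auto
    have fH: "finite H" using H fV by (auto intro: finite_subset)
    have "card (V - H) = card V - card H" using H fH by (simp add: card_Diff_subset)
    then have "t + 4 \<le> card (V - H)" using H(2) n t by simp
    then obtain W where W: "W \<subseteq> V - H" "card W = t + 4"
      "\<And>x y. x \<in> W \<Longrightarrow> y \<in> V - H - W \<Longrightarrow> d y \<le> d x"
      using exists_top_set[of "V - H" "t + 4" d] fV by auto
    have fW: "finite W" using W fV by (auto intro: finite_subset)
    have cHW: "card (H \<union> W) = 3 * t + 3"
      using H W fH fW t by (subst card_Un_disjoint) auto
    have degH: "4 * t + 2 \<le> d x" if "x \<in> H" for x
    proof (rule ccontr)
      assume "\<not> ?thesis"
      then have "{x \<in> V. 4 * t + 2 \<le> d x} \<subseteq> H - {x}" using H(3)[OF that] by fastforce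
      then have "card {x \<in> V. 4 * t + 2 \<le> d x} \<le> card (H - {x})" using fH by (intro card_mono) auto
      also have "\<dots> < card H" using fH that by (intro psubset_card_mono) auto
      finally show False using 3 H(2) by simp
    qed
    have degW: "2 * t - 1 \<le> d w" if "w \<in> W" for w
    proof (rule ccontr)
      assume neg: "\<not> ?thesis"
      then have "{x \<in> V. 2 * t - 1 \<le> d x} \<subseteq> H \<union> W - {w}" using W(3)[OF that] by fastforce
      then have "card {x \<in> V. 2 * t - 1 \<le> d x} \<le> card (H \<union> W - {w})" using fH fW by (intro card_mono) auto
      also have "\<dots> < card (H \<union> W)" using fH fW that by (intro psubset_card_mono) auto
      finally show False using many_of_degree_clique[OF R _ n e] t cHW by simp
    qed
    have low: "d y \<le> 6 * t - 1" if "y \<in> V - H - W" for y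
    proof (rule ccontr)
      assume "\<not> ?thesis"
      then have y: "6 * t \<le> d y" by simp
      have "d y \<le> d x" if "x \<in> H \<union> W" for x
        using that H(3)[of x y] W(3)[of x y] \<open>y \<in> V - H - W\<close> by blast
      then have "H \<union> W \<subseteq> {x \<in> V. 6 * t \<le> d x}"
        using y H(1) W(1) order_trans by blast
      then have "card (H \<union> W) \<le> card {x \<in> V. 6 * t \<le> d x}" using fV by (intro card_mono) auto
      then show False using 3 cHW by simp
    qed
    \<comment> \<open>One such \<open>w\<close> forces all of \<open>H\<close> to have degree at
      least \<open>6 t\<close>. With \<open>t + 2\<close> of them in \<open>W\<close> there would be
      \<open>3 t + 1\<close> vertices of that degree.\<close>
    have med: "card {w \<in> W. 6 * t \<le> d w} \<le> t + 1"
    proof (cases "{w \<in> W. 6 * t \<le> d w} = {}")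
      case False
      then obtain w where w: "w \<in> W" "6 * t \<le> d w" by blast
      have "H \<union> {w \<in> W. 6 * t \<le> d w} \<subseteq> {x \<in> V. 6 * t \<le> d x}"
      proof
        fix x assume x: "x \<in> H \<union> {w \<in> W. 6 * t \<le> d w}"
        have "d w \<le> d x" if "x \<in> H" using H(3)[OF that, of w] w W(1) by blast
        then show "x \<in> {x \<in> V. 6 * t \<le> d x}" using x w(2) H(1) W(1) by auto
      qed
      then have "card (H \<union> {w \<in> W. 6 * t \<le> d w}) \<le> card {x \<in> V. 6 * t \<le> d x}"
        using fV by (intro card_mono) auto
      moreover have "card (H \<union> {w \<in> W. 6 * t \<le> d w}) = card H + card {w \<in> W. 6 * t \<le> d w}"
        using fH fW W by (intro card_Un_disjoint) auto
      ultimately show ?thesis using 3 H(2) by simp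
    next
      case True
      show ?thesis unfolding True by simp
    qed
    \<comment> \<open>Of at least \<open>2 t + 2\<close> vertices of degree at least
      \<open>2 t\<close>, at most \<open>2 t - 1\<close> belong to \<open>H\<close>.\<close>
    have three: "3 \<le> card {w \<in> W. 2 * t \<le> d w}"
    proof (rule ccontr)
      assume neg: "\<not> ?thesis"
      have "\<not> W \<subseteq> {w \<in> W. 2 * t \<le> d w}"
      proof
        assume "W \<subseteq> {w \<in> W. 2 * t \<le> d w}"
        then have "card W \<le> card {w \<in> W. 2 * t \<le> d w}" using fW by (intro card_mono) auto
        then show False using neg W(2) by simp
      qed
      then obtain w where w: "w \<in> W" "d w < 2 * t" by (auto simp: subset_iff not_le)
      have sub: "{x \<in> V. 2 * t \<le> d x} \<subseteq> H \<union> {w \<in> W. 2 * t \<le> d w}" using W(3)[OF w(1)] w(2) by fastforce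
      have "card {x \<in> V. 2 * t \<le> d x} \<le> card (H \<union> {w \<in> W. 2 * t \<le> d w})"
        using sub fH fW by (intro card_mono) auto
      also have "\<dots> \<le> card H + card {w \<in> W. 2 * t \<le> d w}" by (rule card_Un_le)
      finally have "card {x \<in> V. 2 * t \<le> d x} < 2 * t + 2" using neg H(2) t by simp
      moreover have "card H \<le> card {x \<in> V. 2 * t \<le> d x}"
        using fV H(1) degH by (intro card_mono) fastforce+
      ultimately show False using many_of_larger_degree[OF R _ _ e] H(2) t n by simp
    qed
    obtain E1 where M: "max_overlap V d (join_edges H W) E1" using exists_max_overlap[OF R] .
    then have R1: "realizes V d E1" by (simp add: max_overlap_def)
    have e1: "(2 * t - 1) * (card V - t) + 2 \<le> card E1"
      using e realizes_card_edges_eq[OF R R1] by simp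
    interpret maximal_join V H W d t E1
      using t H W degH degW low med n e1 M by unfold_locales auto
    have "clique E1 H" "joined E1 H W" using H_clique HW_joined by (auto simp: clique_def joined_def)
    moreover have "W \<subseteq> V" "H \<inter> W = {}" "t + 4 \<le> card W" using W by auto
    ultimately show ?thesis using host_from_join[OF R1 H(1) _ _ t H(2) _ _ _ three] by blast
  qed
qed

section \<open>Embedding three-coloured graphs with forests between the classes\<close>

definition embeds :: "'b set \<Rightarrow> 'b set set \<Rightarrow> 'a set \<Rightarrow> 'a set set \<Rightarrow> bool" where
  "embeds X T V E \<longleftrightarrow> (\<exists>f. inj_on f X \<and> f ` X \<subseteq> V \<and> (\<forall>x y. {x, y} \<in> T \<longrightarrow> {f x, f y} \<in> E))"

text \<open>In the embeddings the images of a few critical vertices are fixed beforehand, typically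
  the neighbours of one vertex of the second class, and the rest of the class is placed
  arbitrarily.\<close>

lemma extend_inj:
  assumes "finite A" "finite M" "card A \<le> card M" "N \<subseteq> A" "inj_on f N" "f ` N \<subseteq> M"
  obtains g where "inj_on g A" "g ` A \<subseteq> M" "\<And>x. x \<in> N \<Longrightarrow> g x = f x"
proof -
  have fN: "finite N" using assms by (auto intro: finite_subset)
  have "card (A - N) = card A - card N" using assms fN by (simp add: card_Diff_subset)
  moreover have "card (M - f ` N) = card M - card N"
    using assms fN by (simp add: card_Diff_subset card_image)
  ultimately have "card (A - N) \<le> card (M - f ` N)" using assms by simp
  then obtain h where h: "inj_on h (A - N)" "h ` (A - N) \<subseteq> M - f ` N"
    using card_le_inj[of "A - N" "M - f ` N"] assms by auto
  define g where "g x = (if x \<in> N then f x else h x)" for x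
  have "inj_on g (N \<union> (A - N))"
    unfolding g_def using h by (intro inj_on_disjoint_Un assms(5)) auto
  then have "inj_on g A" using assms(4) by (simp add: Un_absorb1)
  moreover have "g ` A \<subseteq> M" using h assms by (auto simp: g_def)
  ultimately show thesis using that by (auto simp: g_def)
qed

text \<open>\<open>X0\<close> goes into the clique, where every edge is available, so only edges
  that meet \<open>S\<close> need attention.\<close>

lemma embeds_glue:
  assumes T: "sgraph X T" and X: "X = X0 \<union> S" "X0 \<inter> S = {}"
    and g0: "inj_on g0 X0" "g0 ` X0 \<subseteq> H" and g: "inj_on g S" "g ` S \<subseteq> W"
    and HW: "H \<inter> W = {}" "H \<subseteq> V" "W \<subseteq> V" and H: "clique E H"
    and cross: "\<And>x y. x \<in> X0 \<Longrightarrow> y \<in> S \<Longrightarrow> {x, y} \<in> T \<Longrightarrow> {g0 x, g y} \<in> E"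
    and inside: "\<And>x y. x \<in> S \<Longrightarrow> y \<in> S \<Longrightarrow> {x, y} \<in> T \<Longrightarrow> {g x, g y} \<in> E"
  shows "embeds X T V E"
proof -
  define f where "f x = (if x \<in> X0 then g0 x else g x)" for x
  have fX0: "f x = g0 x" if "x \<in> X0" for x using that by (simp add: f_def)
  have fS: "f x = g x" if "x \<in> S" for x using that X by (auto simp: f_def)
  have "inj_on f (X0 \<union> S)"
    unfolding f_def using g0 g HW by (intro inj_on_disjoint_Un) auto
  then have inj: "inj_on f X" using X by simp
  have im: "f ` X \<subseteq> V"
  proof
    fix y assume "y \<in> f ` X"
    then obtain x where "x \<in> X0 \<and> y = g0 x \<or> x \<in> S \<and> y = g x" using X fX0 fS by auto
    then show "y \<in> V" using g0(2) g(2) HW(2,3) by auto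
  qed
  have "{f x, f y} \<in> E" if xy: "{x, y} \<in> T" for x y
  proof -
    have ends: "x \<in> X0 \<union> S" "y \<in> X0 \<union> S" "x \<noteq> y" using sgraph_ends[OF T xy] sgraph_no_loop[OF T xy] X by auto
    consider "x \<in> X0" "y \<in> X0" | "x \<in> X0" "y \<in> S" | "x \<in> S" "y \<in> X0" | "x \<in> S" "y \<in> S" using ends by blast
    then show ?thesis
    proof cases
      case 1
      then have "g0 x \<in> H" "g0 y \<in> H" "g0 x \<noteq> g0 y" using g0 ends by (auto simp: inj_on_def)
      then show ?thesis using H 1 fX0 by (auto simp: clique_def)
    next
      case 2 then show ?thesis using cross xy fX0 fS by simp
    next
      case 3 then show ?thesis using cross[of y x] xy fX0 fS by (simp add: insert_commute)
    next
      case 4 then show ?thesis using inside xy fS by simp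
    qed
  qed
  then show ?thesis unfolding embeds_def using inj im by blast
qed

lemma embeds_join:
  assumes T: "sgraph X T" and S: "S \<subseteq> X" and c: "card X \<le> card H + card S" and fH: "finite H"
    and g: "inj_on g S" "g ` S \<subseteq> W"
    and HW: "H \<inter> W = {}" "H \<subseteq> V" "W \<subseteq> V" and H: "clique E H" and J: "joined E H W"
    and inside: "\<And>x y. x \<in> S \<Longrightarrow> y \<in> S \<Longrightarrow> {x, y} \<in> T \<Longrightarrow> {g x, g y} \<in> E"
  shows "embeds X T V E"
proof -
  have fX: "finite X" using T by (rule sgraph_finite)
  have "card (X - S) = card X - card S" using S fX by (intro card_Diff_subset) (auto intro: finite_subset)
  then have "card (X - S) \<le> card H" using c by simp
  then obtain g0 where g0: "inj_on g0 (X - S)" "g0 ` (X - S) \<subseteq> H"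
    using card_le_inj[of "X - S" H] fX fH by auto
  have "{g0 x, g y} \<in> E" if "x \<in> X - S" "y \<in> S" for x y
    using J g0 g that unfolding joined_def by blast
  then show ?thesis
    using S by (intro embeds_glue[OF T _ _ g0 g HW H _ inside]) auto
qed

lemma sum_card_nbrs_le:
  assumes T: "sgraph X T" and fin: "finite A" "finite B" and "A \<inter> B = {}"
  shows "(\<Sum>a\<in>A. card (nbrs T a \<inter> B)) \<le> card {e \<in> T. e \<subseteq> A \<union> B}"
proof -
  let ?S = "SIGMA a:A. nbrs T a \<inter> B"
  have "(\<Sum>a\<in>A. card (nbrs T a \<inter> B)) = card ?S" using fin by (simp add: card_SigmaI)
  also have "inj_on (\<lambda>(a, b). {a, b}) ?S" using assms by (auto simp: inj_on_def doubleton_eq_iff)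
  then have "card ?S = card ((\<lambda>(a, b). {a, b}) ` ?S)" by (simp add: card_image)
  also have "\<dots> \<le> card {e \<in> T. e \<subseteq> A \<union> B}"
    using sgraph_finite_edges[OF T] by (intro card_mono) (auto simp: in_nbrs)
  finally show ?thesis .
qed

text \<open>A forest between \<open>A\<close> and \<open>B\<close> has fewer than
  \<open>card A + card B \<le> 2 * card A\<close> edges, so some \<open>a\<close> has at most one
  neighbour \<open>b\<close> in \<open>B\<close>. Removing both and repeating collects
  \<open>R\<close>. Its purpose is the complement: the vertices of \<open>B - R\<close> have their
  neighbours among only \<open>card A - m\<close> vertices of \<open>A\<close>.\<close>

lemma forest_pruning:
  assumes T: "sgraph X T" and "finite A" "finite B" "A \<inter> B = {}"
    and forest: "\<And>Y. Y \<subseteq> A \<union> B \<Longrightarrow> Y \<noteq> {} \<Longrightarrow> card {e \<in> T. e \<subseteq> Y} + 1 \<le> card Y"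
    and "card B \<le> card A" "m \<le> card B"
  shows "\<exists>R\<subseteq>B. card R = m \<and> m \<le> card {a \<in> A. nbrs T a \<inter> B \<subseteq> R}"
  using assms(2-)
proof (induction m arbitrary: A B)
  case 0
  then show ?case by (intro exI[of _ "{}"]) auto
next
  case (Suc m)
  have B: "B \<noteq> {}" using Suc.prems by auto
  have "\<exists>a\<in>A. card (nbrs T a \<inter> B) \<le> 1"
  proof (rule ccontr)
    assume "\<not> ?thesis"
    then have "(\<Sum>a\<in>A. 2) \<le> (\<Sum>a\<in>A. card (nbrs T a \<inter> B))" by (intro sum_mono) force
    also have "\<dots> \<le> card {e \<in> T. e \<subseteq> A \<union> B}" using Suc.prems by (intro sum_card_nbrs_le[OF T])
    also have "\<dots> + 1 \<le> card (A \<union> B)" using Suc.prems B by (intro Suc.prems) auto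
    also have "card (A \<union> B) = card A + card B" using Suc.prems by (intro card_Un_disjoint)
    finally show False using Suc.prems by simp
  qed
  then obtain a where a: "a \<in> A" "card (nbrs T a \<inter> B) \<le> 1" by blast
  obtain b where b: "b \<in> B" "nbrs T a \<inter> B \<subseteq> {b}"
  proof (cases "nbrs T a \<inter> B = {}")
    case True
    then show thesis using that B by blast
  next
    case False
    then obtain b where "b \<in> nbrs T a \<inter> B" by blast
    moreover have "y = b" if "y \<in> nbrs T a \<inter> B" for y
      using a(2) that calculation Suc.prems(2) card_le_Suc0_iff_eq[of "nbrs T a \<inter> B"] by auto
    ultimately show thesis using that by blast
  qed
  have "\<exists>R\<subseteq>B - {b}. card R = m \<and> m \<le> card {x \<in> A - {a}. nbrs T x \<inter> (B - {b}) \<subseteq> R}"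
    using Suc.prems a b by (intro Suc.IH) auto
  then obtain R where R: "R \<subseteq> B - {b}" "card R = m" "m \<le> card {x \<in> A - {a}. nbrs T x \<inter> (B - {b}) \<subseteq> R}"
    by blast
  have fR: "finite R" using R Suc.prems by (auto intro: finite_subset)
  have "Suc m \<le> card (insert a {x \<in> A - {a}. nbrs T x \<inter> (B - {b}) \<subseteq> R})"
    using R Suc.prems by simp
  also have "\<dots> \<le> card {x \<in> A. nbrs T x \<inter> B \<subseteq> insert b R}"
    using Suc.prems a b by (intro card_mono) auto
  finally have "Suc m \<le> card {x \<in> A. nbrs T x \<inter> B \<subseteq> insert b R}" .
  moreover have "b \<notin> R" using R by auto
  then have "card (insert b R) = Suc m" using R fR by simp
  moreover have "insert b R \<subseteq> B" using R b by auto
  ultimately show ?case by blast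
qed

text \<open>Being a forest is expressed by counting edges on every nonempty subset of two classes.
  This form passes to subsets, and both averaging arguments and the absence of 4-cycles follow by
  counting.\<close>

locale tri_forest =
  fixes X :: "'b set" and T :: "'b set set" and A B C :: "'b set" and t :: nat
  assumes T: "sgraph X T" and X: "X = A \<union> B \<union> C"
    and disj: "A \<inter> B = {}" "A \<inter> C = {}" "B \<inter> C = {}"
    and proper: "{x, y} \<in> T \<Longrightarrow> \<not> {x, y} \<subseteq> A \<and> \<not> {x, y} \<subseteq> B \<and> \<not> {x, y} \<subseteq> C"
    and forest: "Y \<subseteq> A \<union> B \<or> Y \<subseteq> A \<union> C \<or> Y \<subseteq> B \<union> C \<Longrightarrow> Y \<noteq> {} \<Longrightarrow>
      card {e \<in> T. e \<subseteq> Y} + 1 \<le> card Y"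
    and sorted: "card C \<le> card B" "card B \<le> card A"
    and cardX: "card X = 3 * t + 1" and t3: "3 \<le> t"
begin

abbreviation "NA b \<equiv> nbrs T b \<inter> A"

lemma finX: "finite X" using T by (rule sgraph_finite)

lemma fin: "finite A" "finite B" "finite C" using finX X by auto

lemma card_sum: "card A + card B + card C = 3 * t + 1"
proof -
  have "card X = card (A \<union> B) + card C" unfolding X using fin disj by (intro card_Un_disjoint) auto
  also have "card (A \<union> B) = card A + card B" using fin disj by (intro card_Un_disjoint) auto
  finally show ?thesis using cardX by simp
qed

lemma card_A: "t + 1 \<le> card A"
  using card_sum sorted by simp

lemma card_B: "2 * t \<le> 2 * card B + (card A - (t + 1))"
  using card_sum sorted by simp

text \<open>The \<open>k * card B'\<close> or more edges between \<open>A\<close> and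
  \<open>B'\<close> form a forest; vertices of \<open>B\<close> with many neighbours in the largest
  class are therefore rare.\<close>

lemma few_large:
  assumes "B' \<subseteq> B" "\<And>b. b \<in> B' \<Longrightarrow> k \<le> card (NA b)"
  shows "B' = {} \<or> k * card B' + 1 \<le> card A + card B'"
proof (cases "B' = {}")
  case False
  have fB: "finite B'" using assms fin by (auto intro: finite_subset)
  have d: "B' \<inter> A = {}" using assms disj by auto
  have "k * card B' = (\<Sum>b\<in>B'. k)" by simp
  also have "\<dots> \<le> (\<Sum>b\<in>B'. card (NA b))" using assms by (intro sum_mono) auto
  also have "\<dots> \<le> card {e \<in> T. e \<subseteq> B' \<union> A}" by (rule sum_card_nbrs_le[OF T fB fin(1) d])
  also have "\<dots> + 1 \<le> card (B' \<union> A)" using assms False by (intro forest) auto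
  also have "card (B' \<union> A) = card B' + card A" using d fB fin by (intro card_Un_disjoint)
  finally show ?thesis by simp
qed simp

text \<open>Four edges on four vertices violate the forest count. Hence two vertices of
  \<open>B\<close> share at most one neighbour in \<open>A\<close> and at most one in
  \<open>C\<close>.\<close>

lemma no_four_cycle:
  assumes "{x, x', y, y'} \<subseteq> A \<union> B \<or> {x, x', y, y'} \<subseteq> B \<union> C"
    "x \<noteq> x'" "y \<noteq> y'" "{x, y} \<in> T" "{x, y'} \<in> T" "{x', y} \<in> T" "{x', y'} \<in> T"
  shows False
proof -
  have ne: "x \<noteq> y" "x \<noteq> y'" "x' \<noteq> y" "x' \<noteq> y'" using assms sgraph_no_loop[OF T] by auto
  have "card {{x, y}, {x, y'}, {x', y}, {x', y'}} \<le> card {e \<in> T. e \<subseteq> {x, x', y, y'}}"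
    using assms sgraph_finite_edges[OF T] by (intro card_mono) auto
  moreover have "card {{x, y}, {x, y'}, {x', y}, {x', y'}} = 4"
    using assms ne by (simp add: doubleton_eq_iff card_insert_if)
  moreover have "card {e \<in> T. e \<subseteq> {x, x', y, y'}} + 1 \<le> card {x, x', y, y'}"
    using assms by (intro forest) auto
  moreover have "card {x, x', y, y'} = 4" using assms ne by (simp add: card_insert_if)
  ultimately show False by simp
qed

text \<open>In a matching host the clique is not fully joined to \<open>z1\<close> and
  \<open>z2\<close>, so the placement \<open>g0\<close> into the clique is an argument here and its
  compatibility with \<open>S\<close> is the hypothesis \<open>cross\<close>. With a full join,
  treated next, any placement works.\<close>

lemma embeds_split:
  assumes sub: "A0 \<subseteq> A" "S \<subseteq> B"
    and gA: "inj_on gA A0" "gA ` A0 \<subseteq> M" and gS: "inj_on gS S" "gS ` S \<subseteq> P"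
    and g0: "inj_on g0 (X - (A0 \<union> S))" "g0 ` (X - (A0 \<union> S)) \<subseteq> H"
    and PM: "P \<inter> M = {}" and HPM: "P \<union> M \<subseteq> V - H" and HV: "H \<subseteq> V"
    and J: "joined E H M" and H: "clique E H"
    and cross: "\<And>x u. x \<in> X - (A0 \<union> S) \<Longrightarrow> u \<in> S \<Longrightarrow> {x, u} \<in> T \<Longrightarrow> {g0 x, gS u} \<in> E"
    and ins: "\<And>u v. u \<in> S \<Longrightarrow> v \<in> A0 \<Longrightarrow> {u, v} \<in> T \<Longrightarrow> {gS u, gA v} \<in> E"
  shows "embeds X T V E"
proof -
  define g where "g x = (if x \<in> S then gS x else gA x)" for x
  have SA: "S \<inter> A0 = {}" using sub disj by auto
  have g_S: "g x = gS x" if "x \<in> S" for x using that by (simp add: g_def)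
  have g_A: "g x = gA x" if "x \<in> A0" for x using that SA by (auto simp: g_def)
  have dis: "gS ` S \<inter> gA ` A0 = {}" using gS(2) gA(2) PM by blast
  have "inj_on g (S \<union> A0)"
    unfolding g_def by (rule inj_on_disjoint_Un[OF gS(1) gA(1) dis])
  then have inj: "inj_on g (A0 \<union> S)" by (simp add: Un_commute)
  have im: "g ` (A0 \<union> S) \<subseteq> P \<union> M"
  proof
    fix y assume "y \<in> g ` (A0 \<union> S)"
    then obtain x where "x \<in> S \<and> y = gS x \<or> x \<in> A0 \<and> y = gA x" using g_S g_A by auto
    then show "y \<in> P \<union> M" using gS(2) gA(2) by auto
  qed
  show ?thesis
  proof (rule embeds_glue[OF T _ _ g0 inj im])
    show "X = (X - (A0 \<union> S)) \<union> (A0 \<union> S)" using sub X by auto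
    show "{g0 x, g y} \<in> E" if xy: "x \<in> X - (A0 \<union> S)" "y \<in> A0 \<union> S" "{x, y} \<in> T" for x y
    proof (cases "y \<in> S")
      case True
      then show ?thesis using cross xy g_S by simp
    next
      case False
      then have "y \<in> A0" using xy by simp
      moreover have "g0 x \<in> H" using g0(2) xy(1) by blast
      moreover have "gA y \<in> M" using gA(2) \<open>y \<in> A0\<close> by blast
      ultimately show ?thesis using J g_A by (auto simp: joined_def)
    qed
    show "{g x, g y} \<in> E" if xy: "x \<in> A0 \<union> S" "y \<in> A0 \<union> S" "{x, y} \<in> T" for x y
    proof -
      consider "x \<in> S" "y \<in> A0" | "y \<in> S" "x \<in> A0"
        using proper[OF xy(3)] xy sub by blast
      then show ?thesis
        by cases (use ins[of x y] ins[of y x] g_S g_A xy(3) in \<open>simp_all add: insert_commute\<close>)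
    qed
  qed (use HPM HV H in auto)
qed

lemma embeds_split_joined:
  assumes sub: "A0 \<subseteq> A" "S \<subseteq> B"
    and gA: "inj_on gA A0" "gA ` A0 \<subseteq> M" and gS: "inj_on gS S" "gS ` S \<subseteq> P"
    and PM: "P \<inter> M = {}" and HPM: "P \<union> M \<subseteq> V - H" and HV: "H \<subseteq> V"
    and J: "joined E H (P \<union> M)" and H: "clique E H"
    and fV: "finite V" and c: "card X \<le> card H + card A0 + card S"
    and ins: "\<And>u v. u \<in> S \<Longrightarrow> v \<in> A0 \<Longrightarrow> {u, v} \<in> T \<Longrightarrow> {gS u, gA v} \<in> E"
  shows "embeds X T V E"
proof -
  have f: "finite A0" "finite S" "finite H" using sub fin HV fV by (auto intro: finite_subset)
  have "card (A0 \<union> S) = card A0 + card S" using f sub disj by (intro card_Un_disjoint) auto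
  moreover have "card (X - (A0 \<union> S)) = card X - card (A0 \<union> S)"
    using f sub X by (intro card_Diff_subset) auto
  ultimately have "card (X - (A0 \<union> S)) \<le> card H" using c by simp
  then obtain g0 where g0: "inj_on g0 (X - (A0 \<union> S))" "g0 ` (X - (A0 \<union> S)) \<subseteq> H"
    using card_le_inj[of "X - (A0 \<union> S)" H] f finX by auto
  have "joined E H M" using J by (auto simp: joined_def)
  moreover have "{g0 x, gS u} \<in> E" if "x \<in> X - (A0 \<union> S)" "u \<in> S" for x u
    using J g0(2) gS(2) that unfolding joined_def by blast
  ultimately show ?thesis using embeds_split[OF sub gA gS g0 PM HPM HV _ H _ ins] by blast
qed

lemma embeds_clique_host:
  assumes "finite V" "clique_host V t E" shows "embeds X T V E"
proof -
  obtain K where K: "K \<subseteq> V" "3 * t + 1 \<le> card K" "clique E K" using assms by (auto simp: clique_host_def)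
  have "card X \<le> card K" "finite K" using K cardX assms by (auto intro: finite_subset)
  then obtain f where "inj_on f X" "f ` X \<subseteq> K" using card_le_inj[OF finX, of K] by auto
  then show ?thesis
    using K by (intro embeds_glue[OF T, of X "{}" f K f "{}" V E]) auto
qed

text \<open>The part outside \<open>H\<close> must take \<open>t + 2 + s\<close> vertices. If the
  largest class is that big, independence suffices. Otherwise all of \<open>A\<close> goes there
  together with \<open>s + 1 - e\<close> vertices of \<open>B\<close> placed in \<open>P\<close>,
  chosen such that their neighbours in \<open>A\<close> fit into \<open>Q\<close>.\<close>

lemma embeds_bipartite_host:
  assumes fV: "finite V" and s: "2 \<le> s" "s < t" and host: "bipartite_host V t s E"
  shows "embeds X T V E"
proof -
  obtain H P Q I where H: "H \<subseteq> V" "P \<union> Q \<union> I \<subseteq> V - H" "P \<inter> (Q \<union> I) = {}" "Q \<inter> I = {}"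
    "card H = 2 * t - 1 - s" "card P = s + 1" "card Q = 2 * s" "card I = t + 2 - s"
    "clique E H" "joined E H (P \<union> Q \<union> I)" "joined E P Q"
    using host unfolding bipartite_host_def by blast
  have finH: "finite H" "finite P" "finite Q" "finite I" using H fV by (auto intro: finite_subset)
  have cQI: "card (Q \<union> I) = t + 2 + s" using H finH s by (simp add: card_Un_disjoint)
  show ?thesis
  proof (cases "t + 2 + s \<le> card A")
    case True
    then obtain S where S: "S \<subseteq> A" "card S = t + 2 + s" "finite S"
      using exists_subset_card[OF fin(1)] by metis
    obtain g where g: "inj_on g S" "g ` S \<subseteq> Q \<union> I"
      using card_le_inj[of S "Q \<union> I"] S cQI finH by auto
    show ?thesis
    proof (rule embeds_join[OF T _ _ finH(1) g(1)])
      show "{g x, g y} \<in> E" if "x \<in> S" "y \<in> S" "{x, y} \<in> T" for x y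
        using that S proper by blast
    qed (use S X cardX H g s in auto)
  next
    case False
    define e where "e = card A - (t + 1)"
    have e: "card A = t + 1 + e" "e \<le> s" using False card_A by (auto simp: e_def)
    have B2: "2 * t \<le> 2 * card B + e" using card_B by (simp add: e_def)
    have "\<exists>S\<subseteq>B. card S = s + 1 - e \<and> card (\<Union>b\<in>S. NA b) \<le> 2 * s"
    proof (cases "e = s")
      case True
      \<comment> \<open>A single vertex of \<open>B\<close> is wanted. If all had more than
        \<open>2 s\<close> neighbours in \<open>A\<close>, the forest count would give
        \<open>2 s * card B \<le> t + s\<close>, although \<open>2 * card B \<ge> 2 t - s\<close>
        and \<open>s < t\<close>.\<close>
      have "\<exists>b\<in>B. card (NA b) \<le> 2 * s"
      proof (rule ccontr)
        assume "\<not> ?thesis"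
        then have "B = {} \<or> (2 * s + 1) * card B + 1 \<le> card A + card B"
          by (intro few_large) (auto simp: not_le Suc_le_eq)
        then have "2 * s * card B \<le> t + s" using e True by auto
        moreover have "s * (2 * t) \<le> s * (2 * card B + s)" using B2 True by (intro mult_le_mono2) simp
        ultimately have "2 * (s * t) \<le> t + s + s * s" by (simp add: algebra_simps)
        moreover obtain u where "t = s + 1 + u" using s by (metis add.commute less_iff_Suc_add plus_1_eq_Suc add.assoc Suc_eq_plus1)
        moreover have "2 * s \<le> s * s" "u \<le> s * u" using s by simp_all
        ultimately show False using s by (simp add: algebra_simps)
      qed
      then obtain b where "b \<in> B" "card (NA b) \<le> 2 * s" by blast
      then show ?thesis using True by (intro exI[of _ "{b}"]) auto
    next
      case False
      then have es: "e < s" using e by simp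
      \<comment> \<open>All but \<open>s + 1 - e\<close> vertices of \<open>B\<close> are pruned.
        The neighbours of the others number at most \<open>card A - m = t + 2 + s - card B\<close>,
        which is at most \<open>2 s\<close> for \<open>2 \<le> s\<close> and \<open>e < s\<close>;
        for \<open>s = 1\<close> it can be \<open>3\<close>, which is why that case has the path as
        host.\<close>
      define m where "m = card B - (s + 1 - e)"
      have mB: "m \<le> card B" "card B - m = s + 1 - e" using B2 es s by (auto simp: m_def)
      obtain R where R: "R \<subseteq> B" "card R = m" "m \<le> card {a \<in> A. nbrs T a \<inter> B \<subseteq> R}"
        using forest_pruning[OF T fin(1,2) disj(1) _ sorted(2) mB(1)] forest by blast
      have "(\<Union>b\<in>B - R. NA b) \<subseteq> A - {a \<in> A. nbrs T a \<inter> B \<subseteq> R}"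
        by (auto simp: in_nbrs insert_commute)
      then have "card (\<Union>b\<in>B - R. NA b) \<le> card (A - {a \<in> A. nbrs T a \<inter> B \<subseteq> R})"
        using fin by (intro card_mono) auto
      also have "\<dots> = card A - card {a \<in> A. nbrs T a \<inter> B \<subseteq> R}" using fin by (intro card_Diff_subset) auto
      also have "\<dots> \<le> card A - m" using R by simp
      also have "\<dots> \<le> 2 * s" using e es s B2 unfolding m_def by linarith
      finally have "card (\<Union>b\<in>B - R. NA b) \<le> 2 * s" .
      moreover have "card (B - R) = s + 1 - e"
        using R fin mB by (simp add: card_Diff_subset finite_subset)
      ultimately show ?thesis by blast
    qed
    then obtain S where S: "S \<subseteq> B" "card S = s + 1 - e" "card (\<Union>b\<in>S. NA b) \<le> 2 * s" by blast
    have fS: "finite S" using S fin by (auto intro: finite_subset)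
    define N where "N = (\<Union>b\<in>S. NA b)"
    have N: "N \<subseteq> A" "finite N" "card N \<le> card Q" using fin H S by (auto simp: N_def intro: finite_subset)
    obtain f0 where f0: "inj_on f0 N" "f0 ` N \<subseteq> Q" using card_le_inj[OF N(2) finH(3) N(3)] by auto
    have "finite (Q \<union> I)" "card A \<le> card (Q \<union> I)" "f0 ` N \<subseteq> Q \<union> I" using finH cQI e f0 by auto
    then obtain gA where gA: "inj_on gA A" "gA ` A \<subseteq> Q \<union> I" "\<And>x. x \<in> N \<Longrightarrow> gA x = f0 x"
      using extend_inj[OF fin(1) _ _ N(1) f0(1)] by metis
    have "card S \<le> card P" using S H by simp
    then obtain gS where gS: "inj_on gS S" "gS ` S \<subseteq> P" using card_le_inj[OF fS finH(2)] by auto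
    have "{gS u, gA v} \<in> E" if "u \<in> S" "v \<in> A" "{u, v} \<in> T" for u v
    proof -
      have "v \<in> N" using that by (auto simp: N_def in_nbrs)
      then have "gA v \<in> Q" using gA(3) f0 by auto
      moreover have "gS u \<in> P" using that gS by auto
      ultimately show ?thesis using H(11) by (auto simp: joined_def)
    qed
    moreover have "card X \<le> card H + card A + card S" using cardX H e S s by simp
    ultimately show ?thesis
    proof (intro embeds_split_joined[of A S gA "Q \<union> I" gS P V H E])
      show "P \<union> (Q \<union> I) \<subseteq> V - H" using H(2) by auto
      show "joined E H (P \<union> (Q \<union> I))" using H(10) by (simp add: Un_assoc)
    qed (use S gA gS H fV in auto)
  qed
qed

end

text \<open>\<open>N1\<close> surrounds position 1 and occupies positions 0 and 2. If
  \<open>N2\<close> shares a vertex with it, that vertex takes position 2 and \<open>N2\<close>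
  surrounds position 3; if it is disjoint, it surrounds position 5.\<close>

lemma path_positions:
  assumes "card N1 \<le> 2" "card N2 \<le> 2" "card (N1 \<inter> N2) \<le> 1" "finite N1" "finite N2"
  obtains f :: "'b \<Rightarrow> nat" and i where "i = 3 \<or> i = 5" "inj_on f (N1 \<union> N2)" "f ` (N1 \<union> N2) \<subseteq> {0, 2, 4, 6}"
    "\<And>v. v \<in> N1 \<Longrightarrow> f v = 0 \<or> f v = 2" "\<And>v. v \<in> N2 \<Longrightarrow> f v = i - 1 \<or> f v = i + 1"
proof (cases "N1 \<inter> N2 = {}")
  case True
  have "card N1 \<le> card {0, 2::nat}" "card N2 \<le> card {4, 6::nat}" using assms by simp_all
  then obtain f1 f2 where f1: "inj_on f1 N1" "f1 ` N1 \<subseteq> {0, 2::nat}"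
    and f2: "inj_on f2 N2" "f2 ` N2 \<subseteq> {4, 6::nat}"
    using card_le_inj[OF assms(4), of "{0, 2::nat}"] card_le_inj[OF assms(5), of "{4, 6::nat}"] by blast
  let ?f = "\<lambda>v. if v \<in> N1 then f1 v else f2 v"
  have v1: "f1 v = 0 \<or> f1 v = 2" if "v \<in> N1" for v using f1(2) that by blast
  have v2: "f2 v = 4 \<or> f2 v = 6" if "v \<in> N2" for v using f2(2) that by blast
  have nv: "v \<notin> N1" if "v \<in> N2" for v using True that by blast
  have "f1 x \<noteq> f2 y" if "x \<in> N1" "y \<in> N2" for x y using v1[OF that(1)] v2[OF that(2)] by linarith
  then have "f1 ` N1 \<inter> f2 ` N2 = {}" by blast
  then have "inj_on ?f (N1 \<union> N2)" by (rule inj_on_disjoint_Un[OF f1(1) f2(1)])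
  moreover have "?f ` (N1 \<union> N2) \<subseteq> {0, 2, 4, 6}"
  proof
    fix y assume "y \<in> ?f ` (N1 \<union> N2)"
    then obtain v where "v \<in> N1 \<union> N2" "y = ?f v" by blast
    then show "y \<in> {0, 2, 4, 6}" using v1[of v] v2[of v] by (cases "v \<in> N1") auto
  qed
  moreover have "?f v = 0 \<or> ?f v = 2" if "v \<in> N1" for v using v1[OF that] that by simp
  moreover have "?f v = 5 - 1 \<or> ?f v = 5 + 1" if "v \<in> N2" for v using v2[OF that] nv[OF that] by simp
  ultimately show thesis using that[of 5 ?f] by blast
next
  case False
  then obtain c where c: "c \<in> N1" "c \<in> N2" by blast
  have one: "x = c" if "x \<in> N1" "x \<in> N2" for x
    using that c assms card_le_Suc0_iff_eq[of "N1 \<inter> N2"] by auto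
  have "card (N1 - {c}) \<le> Suc 0" "card (N2 - {c}) \<le> Suc 0" using c assms by simp_all
  then have two1: "x = y" if "x \<in> N1 - {c}" "y \<in> N1 - {c}" for x y
    using that assms(4) card_le_Suc0_iff_eq[of "N1 - {c}"] by blast
  have two2: "x = y" if "x \<in> N2 - {c}" "y \<in> N2 - {c}" for x y
    using that assms(5) \<open>card (N2 - {c}) \<le> Suc 0\<close> card_le_Suc0_iff_eq[of "N2 - {c}"] by blast
  define f where "f v = (if v = c then 2 else if v \<in> N1 then 0 else (4::nat))" for v
  have "inj_on f (N1 \<union> N2)"
  proof (rule inj_onI)
    fix x y assume xy: "x \<in> N1 \<union> N2" "y \<in> N1 \<union> N2" "f x = f y"
    then consider "x = c" "y = c" | "x \<in> N1 - {c}" "y \<in> N1 - {c}" | "x \<in> N2 - {c}" "y \<in> N2 - {c}"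
      unfolding f_def by (cases "x = c"; cases "y = c"; cases "x \<in> N1"; cases "y \<in> N1") simp_all
    then show "x = y" by cases (use two1 two2 in blast)+
  qed
  moreover have "f ` (N1 \<union> N2) \<subseteq> {0, 2, 4, 6}" by (auto simp: f_def)
  moreover have "f v = 0 \<or> f v = 2" if "v \<in> N1" for v using that by (simp add: f_def)
  moreover have "f v = 3 - 1 \<or> f v = 3 + 1" if "v \<in> N2" for v using that one[of v] by (auto simp: f_def)
  ultimately show thesis using that[of 3 f] by blast
qed

section \<open>Embedding into cherry, path, matching and cocktail party hosts\<close>

context tri_forest
begin

lemma exists_small_B:
  assumes "B' \<subseteq> B" "card A < (k - 1) * card B' + 1" "1 \<le> k"
  obtains b where "b \<in> B'" "card (NA b) < k"
proof -
  have "\<exists>b\<in>B'. card (NA b) < k"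
  proof (rule ccontr)
    assume "\<not> ?thesis"
    then have "B' = {} \<or> k * card B' + 1 \<le> card A + card B'"
      using assms(1) by (intro few_large) auto
    moreover have "k * card B' = (k - 1) * card B' + card B'"
      using assms(3) by (cases k) auto
    ultimately have "B' = {}" using assms(2) by linarith
    then show False using assms(2) card_A by simp
  qed
  then show thesis using that by blast
qed

text \<open>When the largest class alone can supply all vertices to be placed outside the clique,
  the edges of the sparse part are irrelevant to the embedding.\<close>

lemma embeds_independent:
  assumes "finite V" "H \<subseteq> V" "M \<subseteq> V - H" "joined E H M" "clique E H"
    "m \<le> card A" "m \<le> card M" "3 * t + 1 \<le> card H + m"
  shows "embeds X T V E"
proof -
  obtain A0 where A0: "A0 \<subseteq> A" "card A0 = m" "finite A0"
    using exists_subset_card[OF fin(1) assms(6)] by metis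
  have "finite M" using assms by (auto intro: finite_subset)
  then obtain g where g: "inj_on g A0" "g ` A0 \<subseteq> M" using card_le_inj[of A0 M] A0 assms by auto
  show ?thesis
    using assms A0 g cardX by (intro embeds_split_joined[of A0 "{}" g M g "{}" V H E]) auto
qed

text \<open>If \<open>card A = t + 1\<close>, one further vertex has to leave the clique. By
  averaging some \<open>x\<close> in \<open>B\<close> has at most two neighbours in
  \<open>A\<close>; it becomes the centre of the cherry and they become its ends.\<close>

lemma embeds_cherry_host:
  assumes fV: "finite V" and host: "cherry_host V t E" shows "embeds X T V E"
proof -
  obtain H W a b c where H: "H \<subseteq> V" "W \<subseteq> V" "H \<inter> W = {}" "card H = 2 * t - 1" "t + 2 \<le> card W"
    "clique E H" "joined E H W" "{a, b, c} \<subseteq> W" "a \<noteq> b" "b \<noteq> c" "a \<noteq> c" "{a, b} \<in> E" "{b, c} \<in> E"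
    using host unfolding cherry_host_def by (elim exE conjE) (rule that; assumption)
  have fW: "finite W" using H fV by (auto intro: finite_subset)
  show ?thesis
  proof (cases "t + 2 \<le> card A")
    case True
    moreover have "W \<subseteq> V - H" using H(2,3) by blast
    ultimately show ?thesis
      using H(4,5) t3 by (intro embeds_independent[OF fV H(1) _ H(7,6), of "t + 2"]) simp_all
  next
    case False
    then have cA: "card A = t + 1" using card_A by simp
    have "card A < (3 - 1) * card B + 1" using cA card_B t3 by simp
    then obtain x where x: "x \<in> B" "card (NA x) < 3"
      using exists_small_B[OF subset_refl, of 3] by auto
    have "finite (NA x)" "finite {a, c}" "card (NA x) \<le> card {a, c}" using x H(11) fin by simp_all
    then obtain f0 where f0: "inj_on f0 (NA x)" "f0 ` NA x \<subseteq> {a, c}"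
      by (metis card_le_inj)
    have "{a, c} \<subseteq> W - {b}" using H(8-11) by auto
    then have "f0 ` NA x \<subseteq> W - {b}" using f0(2) by (rule order_trans[rotated])
    moreover have "b \<in> W" using H(8) by simp
    then have "card A \<le> card (W - {b})" using fW H(5) cA by simp
    moreover have "finite (W - {b})" "NA x \<subseteq> A" using fW by simp_all
    ultimately
    obtain gA where gA: "inj_on gA A" "gA ` A \<subseteq> W - {b}" "\<And>v. v \<in> NA x \<Longrightarrow> gA v = f0 v"
      using extend_inj[OF fin(1) _ _ _ f0(1)] by metis
    have ins: "{b, gA v} \<in> E" if "v \<in> A" "{x, v} \<in> T" for v
    proof -
      have "v \<in> NA x" using that by (simp add: in_nbrs)
      then have "gA v \<in> {a, c}" using gA(3) f0(2) by auto
      then show ?thesis using H by (auto simp: insert_commute)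
    qed
    have J: "joined E H ({b} \<union> (W - {b}))" using H by (auto simp: joined_def)
    show ?thesis
    proof (rule embeds_split_joined[OF subset_refl _ gA(1,2) _ _ _ _ H(1) J H(6) fV])
      show "{b} \<union> (W - {b}) \<subseteq> V - H" using \<open>b \<in> W\<close> H(2,3) by blast
      show "card X \<le> card H + card A + card {x}" using cA cardX H(4) t3 by simp
    qed (use x ins in auto)
  qed
qed

text \<open>The independent set of even positions and \<open>I\<close> has \<open>t + 3\<close>
  vertices, so \<open>A\<close> falls short by at most two, and as many vertices of \<open>B\<close>
  go to odd positions. Each has at most two neighbours in \<open>A\<close>, and two of them share at
  most one, since there is no 4-cycle.\<close>

lemma embeds_path_host:
  assumes fV: "finite V" and host: "path_host V t E" shows "embeds X T V E"
proof -
  obtain H \<phi> I where H: "H \<subseteq> V" "inj_on \<phi> {..<7::nat}" "\<phi> ` {..<7} \<union> I \<subseteq> V - H"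
    "\<phi> ` {..<7} \<inter> I = {}" "card H = 2 * t - 2" "card I = t - 1"
    "clique E H" "joined E H (\<phi> ` {..<7} \<union> I)" "\<forall>i<6. {\<phi> i, \<phi> (Suc i)} \<in> E"
    using host unfolding path_host_def by (elim exE conjE) (rule that; assumption)
  define M where "M = \<phi> ` {0, 2, 4, 6} \<union> I"
  define P where "P = \<phi> ` {1, 3, 5}"
  have \<phi>_eq: "\<phi> i = \<phi> j \<longleftrightarrow> i = j" if "i < 7" "j < 7" for i j
    using H(2) that by (auto simp: inj_on_def)
  have PM7: "P \<union> M \<subseteq> \<phi> ` {..<7} \<union> I" unfolding P_def M_def by auto
  have sub: "P \<union> M \<subseteq> V - H" using PM7 H(3) by blast
  have J: "joined E H (P \<union> M)" using H(8) PM7 by (rule joined_mono[OF _ subset_refl])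
  have fM: "finite M" using sub fV by (auto intro: finite_subset)
  have PM: "P \<inter> M = {}"
  proof -
    have "\<phi> ` {1, 3, 5} \<inter> \<phi> ` {0, 2, 4, 6} = {}" using \<phi>_eq by auto
    moreover have "\<phi> ` {1, 3, 5} \<subseteq> \<phi> ` {..<7}" by auto
    ultimately show ?thesis using H(4) unfolding P_def M_def by blast
  qed
  have cM: "card M = t + 3"
  proof -
    have "\<phi> ` {0, 2, 4, 6} \<subseteq> \<phi> ` {..<7}" by auto
    then have "\<phi> ` {0, 2, 4, 6} \<inter> I = {}" using H(4) by blast
    moreover have "finite I" using H(3) fV by (auto intro: finite_subset)
    moreover have c4: "inj_on \<phi> {0, 2, 4, 6}" by (rule inj_on_subset[OF H(2)]) auto
    ultimately have "card M = card (\<phi> ` {0, 2, 4, 6}) + card I"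
      unfolding M_def by (intro card_Un_disjoint) auto
    also have "card (\<phi> ` {0, 2, 4, 6}) = 4" using c4 by (simp add: card_image)
    finally show ?thesis using H(6) t3 by simp
  qed
  have odd_edge: "{\<phi> i, \<phi> j} \<in> E" if "i = 1 \<or> i = 3 \<or> i = 5" "j = i - 1 \<or> j = i + 1" for i j
  proof -
    have e: "{\<phi> k, \<phi> (Suc k)} \<in> E" if "k < 6" for k using H(9) that by blast
    have "{\<phi> 0, \<phi> 1} \<in> E" "{\<phi> 1, \<phi> 2} \<in> E" "{\<phi> 2, \<phi> 3} \<in> E"
      "{\<phi> 3, \<phi> 4} \<in> E" "{\<phi> 4, \<phi> 5} \<in> E" "{\<phi> 5, \<phi> 6} \<in> E"
      using e[of 0] e[of 1] e[of 2] e[of 3] e[of 4] e[of 5] by (simp_all add: eval_nat_numeral)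
    then show ?thesis using that by (elim disjE) (simp_all add: insert_commute numeral_2_eq_2)
  qed
  consider "t + 3 \<le> card A" | "card A = t + 2" | "card A = t + 1" using card_A by linarith
  then show ?thesis
  proof cases
    case 1
    have "joined E H M" using J by (auto simp: joined_def)
    moreover have "M \<subseteq> V - H" using sub by blast
    ultimately show ?thesis
      using 1 H(5) cM t3 by (intro embeds_independent[OF fV H(1) _ _ H(7), of M "t + 3"]) simp_all
  next
    case 2
    have "card A < (3 - 1) * card B + 1" using 2 card_B t3 by simp
    then obtain x where x: "x \<in> B" "card (NA x) < 3"
      using exists_small_B[OF subset_refl, of 3] by auto
    have "inj_on \<phi> {0, 2}" by (rule inj_on_subset[OF H(2)]) auto
    then have "card (\<phi> ` {0, 2}) = 2" by (simp add: card_image)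
    then have "finite (NA x)" "finite (\<phi> ` {0, 2})" "card (NA x) \<le> card (\<phi> ` {0, 2})"
      using x fin by simp_all
    then obtain f0 where f0: "inj_on f0 (NA x)" "f0 ` NA x \<subseteq> \<phi> ` {0, 2}"
      by (metis card_le_inj)
    have "\<phi> ` {0, 2} \<subseteq> M" by (auto simp: M_def)
    then have "f0 ` NA x \<subseteq> M" using f0(2) by (rule order_trans[rotated])
    moreover have "card A \<le> card M" "NA x \<subseteq> A" using cM 2 by simp_all
    ultimately
    obtain gA where gA: "inj_on gA A" "gA ` A \<subseteq> M" "\<And>v. v \<in> NA x \<Longrightarrow> gA v = f0 v"
      using extend_inj[OF fin(1) fM _ _ f0(1)] by metis
    have ins: "{\<phi> 1, gA v} \<in> E" if "v \<in> A" "{x, v} \<in> T" for v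
    proof -
      have "v \<in> NA x" using that by (simp add: in_nbrs)
      then have "gA v \<in> \<phi> ` {0, 2}" using gA(3) f0(2) by auto
      then show ?thesis using odd_edge[of 1] by auto
    qed
    have "\<phi> 1 \<in> P" by (simp add: P_def)
    then have im: "(\<lambda>_. \<phi> 1) ` {x} \<subseteq> P" by simp
    show ?thesis
    proof (rule embeds_split_joined[OF subset_refl _ gA(1,2) _ im PM sub H(1) J H(7) fV])
      show "card X \<le> card H + card A + card {x}" using 2 cardX H(5) t3 by simp
    qed (use x ins in auto)
  next
    case 3
    \<comment> \<open>At most \<open>t div 2\<close> vertices of \<open>B\<close> have three or more
      neighbours in \<open>A\<close>, and \<open>card B \<ge> t\<close>; with
      \<open>t \<ge> 3\<close> two others remain.\<close>
    define B2 where "B2 = {b \<in> B. card (NA b) < 3}"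
    have "3 \<le> card (NA b)" if "b \<in> B - B2" for b using that by (auto simp: B2_def)
    then have "card (B - B2) * 2 + 1 \<le> t + 1 \<or> B - B2 = {}"
      using few_large[of "B - B2" 3] 3 by auto
    moreover have "card B2 + card (B - B2) = card B"
      using fin by (simp add: B2_def card_Diff_subset card_mono)
    moreover have "card (B - B2) = 0" if "B - B2 = {}" using that by (simp only: card.empty)
    ultimately have "2 \<le> card B2" using card_B 3 t3 by linarith
    moreover have "finite B2" using fin by (simp add: B2_def)
    ultimately obtain b1 b2 where b: "b1 \<in> B2" "b2 \<in> B2" "b2 \<noteq> b1"
      by (metis card_le_Suc0_iff_eq not_less_eq_eq numeral_2_eq_2)
    have bB: "b1 \<in> B" "b2 \<in> B" "card (NA b1) \<le> 2" "card (NA b2) \<le> 2" using b by (auto simp: B2_def)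
    have "card (NA b1 \<inter> NA b2) \<le> 1"
    proof -
      have "x = y" if "x \<in> NA b1 \<inter> NA b2" "y \<in> NA b1 \<inter> NA b2" for x y
        using no_four_cycle[of b1 b2 x y] that b bB by (auto simp: in_nbrs)
      then show ?thesis using fin by (subst One_nat_def, subst card_le_Suc0_iff_eq) auto
    qed
    then obtain f :: "'b \<Rightarrow> nat" and i where f: "i = 3 \<or> i = 5" "inj_on f (NA b1 \<union> NA b2)" "f ` (NA b1 \<union> NA b2) \<subseteq> {0, 2, 4, 6}"
      "\<And>v. v \<in> NA b1 \<Longrightarrow> f v = 0 \<or> f v = 2" "\<And>v. v \<in> NA b2 \<Longrightarrow> f v = i - 1 \<or> f v = i + 1"
      by (rule path_positions[OF bB(3,4)]) (use fin in simp_all)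
    have "f ` (NA b1 \<union> NA b2) \<subseteq> {..<7}" using f(3) by (rule order_trans) auto
    then have "inj_on \<phi> (f ` (NA b1 \<union> NA b2))" by (rule inj_on_subset[OF H(2)])
    then have "inj_on (\<phi> \<circ> f) (NA b1 \<union> NA b2)" using f(2) comp_inj_on by blast
    moreover have "card A \<le> card M" "NA b1 \<union> NA b2 \<subseteq> A" using cM 3 by auto
    moreover have "(\<phi> \<circ> f) ` (NA b1 \<union> NA b2) \<subseteq> M" unfolding M_def image_comp[symmetric] using f(3) by blast
    ultimately obtain gA where gA: "inj_on gA A" "gA ` A \<subseteq> M"
      "\<And>v. v \<in> NA b1 \<union> NA b2 \<Longrightarrow> gA v = (\<phi> \<circ> f) v"
      using extend_inj[OF fin(1) fM] by metis
    define gS where "gS u = (if u = b1 then \<phi> 1 else \<phi> i)" for u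
    have ins: "{gS u, gA v} \<in> E" if "u \<in> {b1, b2}" "v \<in> A" "{u, v} \<in> T" for u v
    proof (cases "u = b1")
      case True
      then have v: "v \<in> NA b1" using that by (simp add: in_nbrs)
      then show ?thesis using True gA(3)[of v] f(4)[OF v] odd_edge[of 1 "f v"] by (auto simp: gS_def)
    next
      case False
      then have "u = b2" using that by simp
      then have v: "v \<in> NA b2" using that by (simp add: in_nbrs)
      have "{\<phi> i, \<phi> (f v)} \<in> E" using f(1) f(5)[OF v] by (intro odd_edge) auto
      then show ?thesis using False gA(3)[of v] v by (auto simp: gS_def)
    qed
    have "\<phi> 1 \<noteq> \<phi> i" using f(1) \<phi>_eq[of 1 i] by auto
    then have gS: "inj_on gS {b1, b2}" using b(3) by (simp add: gS_def)
    have "gS ` {b1, b2} \<subseteq> {\<phi> 1, \<phi> i}" by (auto simp: gS_def)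
    also have "\<dots> \<subseteq> P" using f(1) by (elim disjE) (simp_all add: P_def)
    finally have gSP: "gS ` {b1, b2} \<subseteq> P" .
    have c: "card X \<le> card H + card A + card {b1, b2}" using b(3) 3 cardX H(5) t3 by simp
    have "{b1, b2} \<subseteq> B" using bB by simp
    then show ?thesis
      by (rule embeds_split_joined[OF subset_refl _ gA(1,2) gS gSP PM sub H(1) J H(7) fV c ins])
  qed
qed

text \<open>If some vertex of \<open>B\<close> has at most one neighbour in \<open>A\<close>, one
  edge of the matching suffices. Otherwise the forest between \<open>A\<close> and \<open>B\<close>
  is as dense as possible, and then a vertex \<open>a\<close> with two neighbours in
  \<open>B\<close> can be moved into the clique in exchange for these two, which occupy both
  edges.\<close>

lemma embeds_matching_host:
  assumes fV: "finite V" and host: "matching_host V t E" shows "embeds X T V E"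
proof -
  obtain H F w1 z1 w2 z2 x1 x2 where H: "H \<subseteq> V" "F \<union> {w1, z1, w2, z2} \<subseteq> V"
    "H \<inter> (F \<union> {w1, z1, w2, z2}) = {}" "F \<inter> {w1, z1, w2, z2} = {}" "distinct [w1, z1, w2, z2]"
    "card H = 2 * t - 1" "t \<le> card F" "clique E H" "joined E H (F \<union> {w1, w2})"
    "x1 \<in> H" "x2 \<in> H" "joined E (H - {x1}) {z1}" "joined E (H - {x2}) {z2}"
    "{w1, z1} \<in> E" "{w2, z2} \<in> E"
    using host unfolding matching_host_def by (elim exE conjE) (rule that; assumption)
  define M where "M = F \<union> {w1, w2}"
  have fF: "finite F" "finite H" using H(1,2) fV by (auto intro: finite_subset)
  have fM: "finite M" using fF by (simp add: M_def)
  have cM: "t + 2 \<le> card M"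
  proof -
    have "card M = card F + card {w1, w2}" unfolding M_def using fF H(4) by (intro card_Un_disjoint) auto
    then show ?thesis using H(5,7) by simp
  qed
  have PM: "{z1, z2} \<inter> M = {}" using H(4,5) by (auto simp: M_def)
  have HPM: "{z1, z2} \<union> M \<subseteq> V - H" using H(2,3) by (auto simp: M_def)
  have J: "joined E H M" using H(9) by (simp add: M_def)
  have tB: "card A = t + 1 \<Longrightarrow> t \<le> card B" using card_B by simp
  consider "t + 2 \<le> card A" | "card A = t + 1" "\<exists>x\<in>B. card (NA x) < 2"
    | "card A = t + 1" "\<forall>x\<in>B. 2 \<le> card (NA x)"
    using card_A by force
  then show ?thesis
  proof cases
    case 1
    then show ?thesis
      using HPM H(6) cM t3 by (intro embeds_independent[OF fV H(1) _ J H(8), of "t + 2"]) simp_all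
  next
    case 2
    obtain x where x: "x \<in> B" "card (NA x) < 2" using 2(2) by blast
    have "card (NA x) \<le> card {w1}" "finite (NA x)" using x fin by simp_all
    then obtain f0 where f0: "inj_on f0 (NA x)" "f0 ` NA x \<subseteq> {w1}"
      by (metis card_le_inj finite.emptyI finite_insert)
    have "{w1} \<subseteq> M" by (simp add: M_def)
    then have "f0 ` NA x \<subseteq> M" using f0(2) by (rule order_trans[rotated])
    moreover have "card A \<le> card M" "NA x \<subseteq> A" using 2(1) cM by simp_all
    ultimately obtain gA where gA: "inj_on gA A" "gA ` A \<subseteq> M" "\<And>v. v \<in> NA x \<Longrightarrow> gA v = f0 v"
      using extend_inj[OF fin(1) fM _ _ f0(1)] by metis
    \<comment> \<open>A second vertex \<open>y\<close> of \<open>B\<close> is not adjacent to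
      \<open>x\<close> and is placed at \<open>x1\<close>, the vertex of the clique that
      \<open>z1\<close> may miss.\<close>
    have "length [x] < card B" using tB[OF 2(1)] t3 by simp
    then obtain y where y: "y \<in> B" "y \<notin> set [x]" using exists_outside_few[OF fin(2)] by metis
    define X0 where "X0 = X - (A \<union> {x})"
    have yX0: "y \<in> X0" using y X disj by (auto simp: X0_def)
    have "card X0 = card X - card (A \<union> {x})" unfolding X0_def using x X fin by (intro card_Diff_subset) auto
    moreover have "card (A \<union> {x}) = t + 2" using x disj fin 2(1) by (auto simp: card_insert_if)
    ultimately have cX0: "card X0 \<le> card H" using cardX H(6) by simp
    have "finite X0" using finX by (simp add: X0_def)
    moreover have "{y} \<subseteq> X0" "inj_on (\<lambda>_. x1) {y}" "(\<lambda>_. x1) ` {y} \<subseteq> H" using yX0 H(10) by simp_all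
    ultimately obtain g0 where g0: "inj_on g0 X0" "g0 ` X0 \<subseteq> H" "\<And>v. v \<in> {y} \<Longrightarrow> g0 v = x1"
      using extend_inj[OF _ fF(2) cX0] by metis
    have cross: "{g0 v, z1} \<in> E" if "v \<in> X0" "{v, x} \<in> T" for v
    proof -
      have "v \<noteq> y" using proper[OF that(2)] x y by auto
      then have "g0 v \<noteq> x1" using inj_onD[OF g0(1)] g0(3)[of y] that(1) yX0 by (metis singletonI)
      then have "g0 v \<in> H - {x1}" using g0(2) that(1) by auto
      then show ?thesis using H(12) by (simp add: joined_def)
    qed
    have ins: "{z1, gA v} \<in> E" if "v \<in> A" "{x, v} \<in> T" for v
    proof -
      have "v \<in> NA x" using that by (simp add: in_nbrs)
      then have "gA v = w1" using gA(3) f0(2) by auto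
      then show ?thesis using H(14) by (simp add: insert_commute)
    qed
    have S: "{x} \<subseteq> B" "inj_on (\<lambda>_. z1) {x}" "(\<lambda>_. z1) ` {x} \<subseteq> {z1, z2}" using x(1) by simp_all
    show ?thesis
      by (rule embeds_split[OF subset_refl S(1) gA(1,2) S(2,3) g0(1,2)[unfolded X0_def] PM HPM H(1) J H(8)])
        (use cross ins in \<open>simp_all add: X0_def\<close>)
  next
    case 3
    \<comment> \<open>At least \<open>2 * card B\<close> edges lie in a forest on
      \<open>card B + t + 1\<close> vertices and \<open>card B \<ge> t\<close>, so equality holds
      throughout: \<open>B\<close> has \<open>t\<close> vertices with exactly two neighbours in
      \<open>A\<close> each.\<close>
    have Bt: "card B = t" and exact: "\<And>b. b \<in> B \<Longrightarrow> card (NA b) = 2"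
    proof -
      have "B \<noteq> {}" using tB 3(1) t3 by auto
      then show c: "card B = t" using few_large[of B 2] 3 tB by auto
      have "(\<Sum>b\<in>B. card (NA b)) \<le> card {e \<in> T. e \<subseteq> B \<union> A}"
        using disj by (intro sum_card_nbrs_le[OF T fin(2,1)]) auto
      also have "\<dots> + 1 \<le> card (B \<union> A)" using \<open>B \<noteq> {}\<close> by (intro forest) auto
      also have "card (B \<union> A) = 2 * t + 1" using fin disj c 3(1) by (subst card_Un_disjoint) auto
      finally have le: "(\<Sum>b\<in>B. card (NA b)) \<le> 2 * t" by simp
      show "card (NA b) = 2" if b: "b \<in> B" for b
      proof -
        have "(\<Sum>b\<in>B - {b}. 2) \<le> (\<Sum>b\<in>B - {b}. card (NA b))" using 3(2) by (intro sum_mono) auto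
        moreover have "(\<Sum>b\<in>B. card (NA b)) = card (NA b) + (\<Sum>b\<in>B - {b}. card (NA b))"
          using fin b by (intro sum.remove) auto
        moreover have "card (B - {b}) = t - 1" using c b fin by simp
        moreover have "2 \<le> card (NA b)" using 3(2) b by blast
        ultimately show ?thesis using le t3 by simp
      qed
    qed
    \<comment> \<open>Disjoint neighbourhoods would need \<open>2 t\<close> vertices in
      \<open>A\<close>, which has \<open>t + 1\<close>.\<close>
    have "\<exists>b\<in>B. \<exists>b'\<in>B. b \<noteq> b' \<and> NA b \<inter> NA b' \<noteq> {}"
    proof (rule ccontr)
      assume "\<not> ?thesis"
      then have "\<forall>b\<in>B. \<forall>b'\<in>B. b \<noteq> b' \<longrightarrow> NA b \<inter> NA b' = {}" by blast
      then have "card (\<Union>b\<in>B. NA b) = (\<Sum>b\<in>B. card (NA b))"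
        by (intro card_UN_disjoint) (use fin in simp_all)
      also have "\<dots> = 2 * t" using exact Bt by simp
      finally have "2 * t = card (\<Union>b\<in>B. NA b)" by simp
      also have "\<dots> \<le> card A" by (rule card_mono[OF fin(1)]) blast
      finally show False using 3(1) t3 by simp
    qed
    then obtain b b' where bb: "b \<in> B" "b' \<in> B" "b \<noteq> b'" "NA b \<inter> NA b' \<noteq> {}" by blast
    then obtain a where "a \<in> NA b \<inter> NA b'" by blast
    then have b: "b \<in> B" "b' \<in> B" "b \<noteq> b'" "a \<in> NA b" "a \<in> NA b'" using bb by simp_all
    have "card (NA b - {a}) = 1" "card (NA b' - {a}) = 1"
      using exact[OF b(1)] exact[OF b(2)] b(4,5) fin by simp_all
    then obtain a1 a2 where a12: "NA b - {a} = {a1}" "NA b' - {a} = {a2}" by (metis card_1_singletonE)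
    have "a1 \<in> NA b - {a}" "a2 \<in> NA b' - {a}" unfolding a12 by simp_all
    then have a12': "{b, a1} \<in> T" "{b', a2} \<in> T" and aA: "a \<in> A" "a1 \<in> A" "a2 \<in> A" "a1 \<noteq> a" "a2 \<noteq> a"
      using b(4) by (simp_all add: in_nbrs)
    have "a1 \<noteq> a2"
    proof
      assume "a1 = a2"
      then show False using no_four_cycle[of b b' a a1] b a12' aA by (simp add: in_nbrs)
    qed
    \<comment> \<open>Without the common neighbour \<open>a\<close>, which goes into the clique,
      \<open>b\<close> and \<open>b'\<close> keep one neighbour each, and these differ because there
      is no 4-cycle. Then \<open>A0\<close>, \<open>b\<close> and \<open>b'\<close> are
      \<open>t + 2\<close> vertices.\<close>
    define A0 where "A0 = A - {a}"
    have "NA b \<inter> A0 = NA b - {a}" "NA b' \<inter> A0 = NA b' - {a}" by (auto simp: A0_def)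
    then have NA0: "NA b \<inter> A0 = {a1}" "NA b' \<inter> A0 = {a2}" using a12 by simp_all
    define f0 where "f0 v = (if v = a1 then w1 else w2)" for v
    have "inj_on f0 {a1, a2}" using \<open>a1 \<noteq> a2\<close> H(5) by (simp add: f0_def)
    moreover have "f0 ` {a1, a2} \<subseteq> M" by (auto simp: f0_def M_def)
    moreover have "finite A0" "card A0 \<le> card M" "{a1, a2} \<subseteq> A0" using fin 3(1) cM aA by (auto simp: A0_def)
    ultimately obtain gA where gA: "inj_on gA A0" "gA ` A0 \<subseteq> M" "\<And>v. v \<in> {a1, a2} \<Longrightarrow> gA v = f0 v"
      using extend_inj[OF _ fM] by metis
    define X0 where "X0 = X - (A0 \<union> {b, b'})"
    have "card (A0 \<union> {b, b'}) = card A0 + card {b, b'}"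
      using fin b disj by (intro card_Un_disjoint) (auto simp: A0_def)
    then have "card (A0 \<union> {b, b'}) = t + 2" using 3(1) aA(1) fin b(3) by (simp add: A0_def)
    moreover have "card X0 = card X - card (A0 \<union> {b, b'})" unfolding X0_def
      using b X fin by (intro card_Diff_subset) (auto simp: A0_def)
    ultimately have cX0: "card X0 \<le> card H" using cardX H(6) by simp
    have fX0: "finite X0" using finX by (simp add: X0_def)
    obtain y where y: "y \<in> B" "y \<notin> set [b, b']"
      using exists_outside_few[OF fin(2), of "[b, b']"] Bt t3 by (metis One_nat_def Suc_le_lessD length_Cons list.size(3) numeral_3_eq_3)
    have nb: "{b, v} \<notin> T" "{b', v} \<notin> T" if "v \<in> B" for v using proper[of b v] proper[of b' v] b that by auto
    have yX0: "y \<in> X0" using y X disj by (auto simp: X0_def A0_def)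
    \<comment> \<open>\<open>b\<close> and \<open>b'\<close> go to \<open>z1\<close> and \<open>z2\<close>; the vertices \<open>x1\<close>, \<open>x2\<close> that these miss receive non-neighbours
      of \<open>b\<close> and \<open>b'\<close>.\<close>
    have "\<exists>y1\<in>X0. \<exists>y2\<in>X0. (y1 = y2 \<longleftrightarrow> x1 = x2) \<and> {b, y1} \<notin> T \<and> {b', y2} \<notin> T"
    proof (cases "x1 = x2")
      case True
      then show ?thesis using yX0 nb[OF y(1)] by blast
    next
      case False
      have "2 \<le> card C" using card_sum 3(1) Bt t3 by simp
      then obtain c c' where c: "c \<in> C" "c' \<in> C" "c \<noteq> c'"
        using card_le_Suc0_iff_eq[OF fin(3)] by (metis not_less_eq_eq numeral_2_eq_2)
      \<comment> \<open>When \<open>x1\<close> and \<open>x2\<close> differ, two non-neighbours are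
        required. Besides \<open>y\<close> some vertex of \<open>C\<close> qualifies: two vertices
        of \<open>C\<close> adjacent to both \<open>b\<close> and \<open>b'\<close> would close a
        4-cycle.\<close>
      have "\<exists>c\<in>C. {b, c} \<notin> T \<or> {b', c} \<notin> T"
      proof (rule ccontr)
        assume "\<not> ?thesis"
        then show False using no_four_cycle[of b b' c c'] b c by auto
      qed
      then obtain c where c: "c \<in> C" "{b, c} \<notin> T \<or> {b', c} \<notin> T" by blast
      have "c \<in> X0" "c \<noteq> y" using c(1) X disj b y by (auto simp: X0_def A0_def)
      then show ?thesis using c(2) False yX0 nb[OF y(1)] by metis
    qed
    then obtain y1 y2 where y12: "y1 \<in> X0" "y2 \<in> X0" "y1 = y2 \<longleftrightarrow> x1 = x2" "{b, y1} \<notin> T" "{b', y2} \<notin> T" by blast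
    define h0 where "h0 v = (if v = y1 then x1 else x2)" for v
    have "inj_on h0 {y1, y2}" using y12(3) by (auto simp: h0_def)
    moreover have "h0 ` {y1, y2} \<subseteq> H" using H(10,11) by (auto simp: h0_def)
    moreover have "{y1, y2} \<subseteq> X0" using y12 by simp
    ultimately obtain g0 where g0: "inj_on g0 X0" "g0 ` X0 \<subseteq> H" "\<And>v. v \<in> {y1, y2} \<Longrightarrow> g0 v = h0 v"
      using extend_inj[OF fX0 fF(2) cX0] by metis
    have g0y: "g0 y1 = x1" "g0 y2 = x2" using g0(3)[of y1] g0(3)[of y2] y12(3) by (auto simp: h0_def)
    define gS where "gS u = (if u = b then z1 else z2)" for u
    have cross: "{g0 v, gS u} \<in> E" if v: "v \<in> X0" "u \<in> {b, b'}" "{v, u} \<in> T" for u v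
    proof (cases "u = b")
      case True
      then have "v \<noteq> y1" using v(3) y12(4) by (auto simp: insert_commute)
      then have "g0 v \<noteq> x1" using inj_onD[OF g0(1)] g0y(1) v(1) y12(1) by metis
      then have "g0 v \<in> H - {x1}" using g0(2) v(1) by auto
      then show ?thesis using H(12) True by (simp add: joined_def gS_def)
    next
      case False
      then have "v \<noteq> y2" using v(2,3) y12(5) by (auto simp: insert_commute)
      then have "g0 v \<noteq> x2" using inj_onD[OF g0(1)] g0y(2) v(1) y12(2) by metis
      then have "g0 v \<in> H - {x2}" using g0(2) v(1) by auto
      then show ?thesis using H(13) False by (simp add: joined_def gS_def)
    qed
    have ins: "{gS u, gA v} \<in> E" if v: "u \<in> {b, b'}" "v \<in> A0" "{u, v} \<in> T" for u v
    proof (cases "u = b")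
      case True
      then have "v \<in> NA b \<inter> A0" using v by (auto simp: in_nbrs A0_def)
      then have "v = a1" using NA0 by auto
      then have "gA v = w1" using gA(3)[of a1] by (simp add: f0_def)
      then show ?thesis using H(14) True by (simp add: gS_def insert_commute)
    next
      case False
      then have "v \<in> NA b' \<inter> A0" using v by (auto simp: in_nbrs A0_def)
      then have "v = a2" using NA0 by auto
      then have "gA v = w2" using gA(3)[of a2] \<open>a1 \<noteq> a2\<close> by (simp add: f0_def)
      then show ?thesis using H(15) False by (simp add: gS_def insert_commute)
    qed
    have gS: "inj_on gS {b, b'}" "gS ` {b, b'} \<subseteq> {z1, z2}" using H(5) b(3) by (auto simp: gS_def)
    have "A0 \<subseteq> A" "{b, b'} \<subseteq> B" using b by (auto simp: A0_def)
    then show ?thesis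
      by (rule embeds_split[OF _ _ gA(1,2) gS g0(1,2)[unfolded X0_def] PM HPM H(1) J H(8)])
        (use cross ins in \<open>simp_all add: X0_def\<close>)
  qed
qed

lemma embeds_cocktail_host:
  assumes fV: "finite V" and host: "cocktail_host V t E" shows "embeds X T V E"
proof -
  obtain H \<phi> where H: "H \<subseteq> V" "card H = t - 1" "inj_on \<phi> {..<2 * t + 2}"
    "\<phi> ` {..<2 * t + 2} \<subseteq> V - H" "clique E H" "joined E H (\<phi> ` {..<2 * t + 2})"
    "\<forall>i<2 * t + 2. \<forall>j<2 * t + 2. i div 2 \<noteq> j div 2 \<longrightarrow> {\<phi> i, \<phi> j} \<in> E"
    using host unfolding cocktail_host_def by (elim exE conjE) (rule that; assumption)
  have fH: "finite H" using H fV by (auto intro: finite_subset)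
  \<comment> \<open>Keep an even number of vertices of each colour, so that the matched pairs of the host can be
    filled with vertices of the same colour; rounding down loses at most three vertices.\<close>
  have half: "t + 1 \<le> card A div 2 + card B div 2 + card C div 2"
    using card_sum t3 by presburger
  define i where "i = min (card A div 2) (t + 1)"
  define j where "j = min (card B div 2) (t + 1 - i)"
  define k where "k = t + 1 - i - j"
  have ijk: "i + j + k = t + 1" "2 * i \<le> card A" "2 * j \<le> card B" "2 * k \<le> card C"
  proof -
    have "i \<le> card A div 2" "j \<le> card B div 2" "k \<le> card C div 2" "i + j + k = t + 1"
      using half unfolding i_def j_def k_def by linarith+
    then show "i + j + k = t + 1" "2 * i \<le> card A" "2 * j \<le> card B" "2 * k \<le> card C" by auto
  qed
  obtain A' where A': "A' \<subseteq> A" "card A' = 2 * i" "finite A'" using exists_subset_card[OF fin(1) ijk(2)] by metis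
  obtain B' where B': "B' \<subseteq> B" "card B' = 2 * j" "finite B'" using exists_subset_card[OF fin(2) ijk(3)] by metis
  obtain C' where C': "C' \<subseteq> C" "card C' = 2 * k" "finite C'" using exists_subset_card[OF fin(3) ijk(4)] by metis
  \<comment> \<open>The three classes occupy consecutive blocks that begin and end at even
    positions, so a non-adjacent pair \<open>2 k\<close>, \<open>2 k + 1\<close> of the host never
    meets two classes.\<close>
  obtain eA where eA: "inj_on eA A'" "eA ` A' \<subseteq> {0..<2 * i}"
    using card_le_inj[of A' "{0..<2 * i}"] A' by auto
  obtain eB where eB: "inj_on eB B'" "eB ` B' \<subseteq> {2 * i..<2 * i + 2 * j}"
    using card_le_inj[of B' "{2 * i..<2 * i + 2 * j}"] B' by auto
  obtain eC where eC: "inj_on eC C'" "eC ` C' \<subseteq> {2 * i + 2 * j..<2 * t + 2}"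
  proof -
    have "card {2 * i + 2 * j..<2 * t + 2} = 2 * k" using ijk(1) by simp
    then show thesis using card_le_inj[of C' "{2 * i + 2 * j..<2 * t + 2}"] C' that by auto
  qed
  define \<psi> where "\<psi> x = (if x \<in> A' then eA x else if x \<in> B' then eB x else eC x)" for x
  have dis: "A' \<inter> B' = {}" "A' \<inter> C' = {}" "B' \<inter> C' = {}" using A' B' C' disj by auto
  have \<psi>A: "\<psi> x < 2 * i" if "x \<in> A'" for x using that eA by (auto simp: \<psi>_def)
  have \<psi>B: "2 * i \<le> \<psi> x \<and> \<psi> x < 2 * i + 2 * j" if "x \<in> B'" for x
    using that eB dis by (auto simp: \<psi>_def)
  have \<psi>C: "2 * i + 2 * j \<le> \<psi> x \<and> \<psi> x < 2 * t + 2" if "x \<in> C'" for x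
    using that eC dis by (auto simp: \<psi>_def)
  have "eB x \<noteq> eC y" if "x \<in> B'" "y \<in> C'" for x y
  proof -
    have "x \<notin> A'" "y \<notin> A'" "y \<notin> B'" using that dis by auto
    then show ?thesis using \<psi>B[OF that(1)] \<psi>C[OF that(2)] that by (simp add: \<psi>_def)
  qed
  then have dBC: "eB ` B' \<inter> eC ` C' = {}" by blast
  define \<chi> where "\<chi> x = (if x \<in> B' then eB x else eC x)" for x
  have \<chi>: "inj_on \<chi> (B' \<union> C')" unfolding \<chi>_def using eB eC dBC by (intro inj_on_disjoint_Un)
  have "eA x \<noteq> \<chi> y" if x: "x \<in> A'" and y: "y \<in> B' \<union> C'" for x y
  proof -
    have "y \<notin> A'" using y dis by auto
    then have "\<chi> y = \<psi> y" by (simp add: \<chi>_def \<psi>_def)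
    moreover have "2 * i \<le> \<psi> y" using y \<psi>B[of y] \<psi>C[of y] by auto
    moreover have "eA x = \<psi> x" using x by (simp add: \<psi>_def)
    ultimately show ?thesis using \<psi>A[OF x] by simp
  qed
  then have "eA ` A' \<inter> \<chi> ` (B' \<union> C') = {}" by blast
  then have "inj_on (\<lambda>x. if x \<in> A' then eA x else \<chi> x) (A' \<union> (B' \<union> C'))"
    using eA \<chi> by (intro inj_on_disjoint_Un)
  moreover have "(\<lambda>x. if x \<in> A' then eA x else \<chi> x) = \<psi>" by (auto simp: \<psi>_def \<chi>_def)
  ultimately have inj\<psi>: "inj_on \<psi> (A' \<union> (B' \<union> C'))" by simp
  define S where "S = A' \<union> (B' \<union> C')"
  have \<psi>lt: "\<psi> x < 2 * t + 2" if "x \<in> S" for x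
    using that \<psi>A[of x] \<psi>B[of x] \<psi>C[of x] ijk(1) by (auto simp: S_def)
  have cS: "card S = 2 * t + 2"
  proof -
    have "card S = card A' + card (B' \<union> C')" unfolding S_def using A' B' C' dis by (intro card_Un_disjoint) auto
    also have "card (B' \<union> C') = card B' + card C'" using B' C' dis by (intro card_Un_disjoint) auto
    finally show ?thesis using A' B' C' ijk(1) by simp
  qed
  have diff: "\<psi> x div 2 \<noteq> \<psi> y div 2" if xy: "x \<in> S" "y \<in> S" "{x, y} \<in> T" for x y
  proof -
    have p: "\<not> {x, y} \<subseteq> A'" "\<not> {x, y} \<subseteq> B'" "\<not> {x, y} \<subseteq> C'" using proper[OF xy(3)] A' B' C' by auto
    have dA: "\<psi> z div 2 < i" if "z \<in> A'" for z using \<psi>A[OF that] by simp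
    have dB: "i \<le> \<psi> z div 2 \<and> \<psi> z div 2 < i + j" if "z \<in> B'" for z using \<psi>B[OF that] by auto
    have dC: "i + j \<le> \<psi> z div 2" if "z \<in> C'" for z using \<psi>C[OF that] by auto
    show ?thesis using xy(1,2) p dA[of x] dA[of y] dB[of x] dB[of y] dC[of x] dC[of y]
      unfolding S_def by auto
  qed
  show ?thesis
  proof (rule embeds_join[OF T _ _ fH])
    show "S \<subseteq> X" using A' B' C' X by (auto simp: S_def)
    show "card X \<le> card H + card S" using cardX H(2) cS t3 by simp
    have "inj_on \<phi> (\<psi> ` S)" using \<psi>lt H(3) by (auto intro: inj_on_subset)
    then show "inj_on (\<phi> \<circ> \<psi>) S" using inj\<psi> unfolding S_def by (rule comp_inj_on[rotated])
    show "(\<phi> \<circ> \<psi>) ` S \<subseteq> \<phi> ` {..<2 * t + 2}" using \<psi>lt by auto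
    show "{(\<phi> \<circ> \<psi>) x, (\<phi> \<circ> \<psi>) y} \<in> E" if "x \<in> S" "y \<in> S" "{x, y} \<in> T" for x y
      using H(7) \<psi>lt[OF that(1)] \<psi>lt[OF that(2)] diff[OF that] by simp
  qed (use H in auto)
qed

end

section \<open>2-trees\<close>

definition uedges :: "('a, 'b) pre_digraph \<Rightarrow> 'a set set" where
  "uedges G = {{u, v} |u v. (u, v) \<in> arcs_ends G}"

lemma in_uedges: "graph G \<Longrightarrow> {u, v} \<in> uedges G \<longleftrightarrow> (u, v) \<in> arcs_ends G"
proof -
  assume "graph G"
  then interpret graph G .
  have "(v, u) \<in> arcs_ends G \<longleftrightarrow> (u, v) \<in> arcs_ends G" using graph_symmetric by blast
  then show ?thesis by (auto simp: uedges_def doubleton_eq_iff)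
qed

lemma sgraph_uedges: assumes "graph G" shows "sgraph (verts G) (uedges G)"
proof -
  interpret graph G by (rule assms)
  have "u \<in> verts G \<and> v \<in> verts G \<and> u \<noteq> v" if "(u, v) \<in> arcs_ends G" for u v
    using that adj_in_verts adj_not_same by auto
  then show ?thesis using finite_verts by (force simp: sgraph_def uedges_def)
qed

lemma arcs_ends_del_vert:
  "arcs_ends (pre_digraph.del_vert G v) = {(a, b) \<in> arcs_ends G. a \<noteq> v \<and> b \<noteq> v}"
  by (auto simp: arcs_ends_def arc_to_ends_def pre_digraph.del_vert_def)

lemma out_degree_eq_card_nbrs:
  assumes "graph G" shows "out_degree G v = card (nbrs (uedges G) v)"
proof -
  interpret graph G by (rule assms)
  have "head G ` out_arcs G v = nbrs (uedges G) v"
    by (auto simp: in_nbrs in_uedges[OF assms] out_arcs_def arcs_ends_def arc_to_ends_def)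
  moreover have "inj_on (head G) (out_arcs G v)"
    by (rule inj_onI) (auto simp: out_arcs_def arc_to_ends_def intro: no_multi_arcs)
  ultimately show ?thesis unfolding out_degree_def by (metis card_image)
qed

text \<open>The forest condition is carried through the induction along with the colouring: every
  nonempty vertex set on which some colour is missing spans fewer edges than it has vertices. A new
  vertex gets the colour that its two adjacent neighbours leave over.\<close>

lemma two_tree_colouring:
  assumes "two_tree G"
  shows "graph G \<and> (\<exists>c :: 'a \<Rightarrow> nat. c ` verts G \<subseteq> {0, 1, 2} \<and>
    (\<forall>u v. {u, v} \<in> uedges G \<longrightarrow> c u \<noteq> c v) \<and>
    (\<forall>Y\<subseteq>verts G. Y \<noteq> {} \<longrightarrow> \<not> {0, 1, 2} \<subseteq> c ` Y \<longrightarrow> card {e \<in> uedges G. e \<subseteq> Y} + 1 \<le> card Y))"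
  using assms
proof (induction rule: two_tree.induct)
  case (triangle G)
  then have G: "graph G" and c3: "card (verts G) = 3" by (auto simp: complete_digraph_def)
  interpret graph G by (rule G)
  have "card (verts G) = card {0, 1, 2::nat}" using c3 by simp
  then obtain c where c: "bij_betw c (verts G) {0, 1, 2::nat}"
    using finite_same_card_bij[OF finite_verts, of "{0, 1, 2::nat}"] by auto
  have inj: "inj_on c (verts G)" and im: "c ` verts G = {0, 1, 2}" using c by (auto simp: bij_betw_def)
  have S: "sgraph (verts G) (uedges G)" by (rule sgraph_uedges[OF G])
  have col: "c u \<noteq> c v" if "{u, v} \<in> uedges G" for u v
    using sgraph_ends[OF S that] sgraph_no_loop[OF S that] inj_onD[OF inj] by blast
  have few: "card {e \<in> uedges G. e \<subseteq> Y} + 1 \<le> card Y"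
    if Y: "Y \<subseteq> verts G" "Y \<noteq> {}" "\<not> {0, 1, 2} \<subseteq> c ` Y" for Y
  proof -
    have fY: "finite Y" using Y finite_verts finite_subset by blast
    have "c ` Y \<subseteq> {0, 1, 2}" using image_mono[OF Y(1), of c] unfolding im .
    moreover have "c ` Y \<noteq> {0, 1, 2}" using Y(3) by force
    ultimately have "c ` Y \<subset> {0, 1, 2}" by (rule psubsetI)
    then have "card (c ` Y) < card {0, 1, 2::nat}" by (intro psubset_card_mono) simp_all
    moreover have "card (c ` Y) = card Y" by (rule card_image[OF inj_on_subset[OF inj Y(1)]])
    ultimately have Y3: "card Y < 3" by simp
    have "finite {e. e \<subseteq> Y \<and> card e = 2}" using fY by simp
    moreover have "{e \<in> uedges G. e \<subseteq> Y} \<subseteq> {e. e \<subseteq> Y \<and> card e = 2}" using S by (auto simp: sgraph_def)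
    ultimately have "card {e \<in> uedges G. e \<subseteq> Y} \<le> card {e. e \<subseteq> Y \<and> card e = 2}" by (rule card_mono)
    then have le: "card {e \<in> uedges G. e \<subseteq> Y} \<le> card Y choose 2" using n_subsets[OF fY, of 2] by simp
    have "card Y \<noteq> 0" using fY Y(2) by simp
    then have "card Y = 1 \<or> card Y = 2" using Y3 by linarith
    then have "(card Y choose 2) + 1 \<le> card Y" by (elim disjE) (simp_all add: choose_two)
    then show ?thesis using le by linarith
  qed
  show ?case
    by (intro conjI exI[of _ c] allI impI G) (simp add: im, erule col, rule few)
next
  case (extend G v x y)
  have G: "graph G" by (rule extend.hyps(1))
  interpret graph G by (rule G)
  let ?G' = "pre_digraph.del_vert G v"
  obtain c :: "'a \<Rightarrow> nat" where G': "graph ?G'" and c: "c ` verts ?G' \<subseteq> {0, 1, 2}"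
    "\<And>u w. {u, w} \<in> uedges ?G' \<Longrightarrow> c u \<noteq> c w"
    "\<And>Y. Y \<subseteq> verts ?G' \<Longrightarrow> Y \<noteq> {} \<Longrightarrow> \<not> {0, 1, 2} \<subseteq> c ` Y \<Longrightarrow> card {e \<in> uedges ?G'. e \<subseteq> Y} + 1 \<le> card Y"
    using extend.IH by auto
  have V': "verts ?G' = verts G - {v}" by (simp add: pre_digraph.del_vert_def)
  have S: "sgraph (verts G) (uedges G)" by (rule sgraph_uedges[OF G])
  have edge': "{a, b} \<in> uedges ?G' \<longleftrightarrow> {a, b} \<in> uedges G \<and> a \<noteq> v \<and> b \<noteq> v" for a b
    unfolding in_uedges[OF G] in_uedges[OF G'] arcs_ends_del_vert by auto
  have e: "{v, x} \<in> uedges G" "{v, y} \<in> uedges G" "{x, y} \<in> uedges G"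
    using extend.hyps in_uedges[OF G] by auto
  have ne: "x \<noteq> v" "y \<noteq> v" using e sgraph_no_loop[OF S] by auto
  have Nv: "nbrs (uedges G) v = {x, y}"
  proof -
    have "{x, y} \<subseteq> nbrs (uedges G) v" using e by (simp add: in_nbrs)
    moreover have "card (nbrs (uedges G) v) = card {x, y}"
      using out_degree_eq_card_nbrs[OF G, of v] extend.hyps(3,4) by simp
    ultimately show ?thesis using sgraph_finite_nbrs[OF S] by (metis card_subset_eq)
  qed
  have xy': "x \<in> verts ?G'" "y \<in> verts ?G'" using e ne sgraph_ends[OF S] V' by auto
  have cxy: "c x \<noteq> c y" using e(3) ne edge'[of x y] by (intro c(2)) simp
  have cin: "c x \<in> {0, 1, 2}" "c y \<in> {0, 1, 2}"
    using subsetD[OF c(1) imageI] xy' by metis+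
  have "\<not> {0, 1, 2} \<subseteq> {c x, c y}"
  proof
    assume "{0, 1, 2} \<subseteq> {c x, c y}"
    then have "card {0, 1, 2::nat} \<le> card {c x, c y}" by (intro card_mono) simp_all
    then show False using cxy by simp
  qed
  then obtain k where k': "k \<in> {0, 1, 2}" "k \<notin> {c x, c y}" by blast
  then have k: "k \<in> {0, 1, 2}" "k \<noteq> c x" "k \<noteq> c y" by simp_all
  have all: "{c x, c y, k} = {0, 1, 2}"
  proof (rule card_subset_eq)
    show "{c x, c y, k} \<subseteq> {0, 1, 2}" using cin k(1) by (intro insert_subsetI empty_subsetI)
  qed (use cxy k in simp_all)
  define c' where "c' = c(v := k)"
  have c'v: "c' v = k" and c'o: "\<And>u. u \<noteq> v \<Longrightarrow> c' u = c u" by (auto simp: c'_def)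
  have range: "c' ` verts G \<subseteq> {0, 1, 2}"
  proof
    fix i assume "i \<in> c' ` verts G"
    then obtain u where u: "u \<in> verts G" "i = c' u" by blast
    moreover have "c u \<in> {0, 1, 2}" if "u \<noteq> v"
      using that u(1) V' by (intro subsetD[OF c(1)] imageI) simp
    ultimately show "i \<in> {0, 1, 2}" using k(1) c'v c'o[of u] by (cases "u = v") simp_all
  qed
  have col: "c' u \<noteq> c' w" if uw: "{u, w} \<in> uedges G" for u w
  proof -
    have "u \<noteq> w" using uw sgraph_no_loop[OF S] by blast
    have new: "c' z \<noteq> k" if "{v, z} \<in> uedges G" for z
    proof -
      have "z \<in> nbrs (uedges G) v" using that by (simp add: in_nbrs)
      then have "z = x \<or> z = y" unfolding Nv by simp
      then show ?thesis using c'o[OF ne(1)] c'o[OF ne(2)] k(2,3) by (elim disjE) simp_all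
    qed
    consider "u = v" | "w = v" | "u \<noteq> v" "w \<noteq> v" by blast
    then show ?thesis
    proof cases
      case 1
      then show ?thesis using new[of w] uw c'v by simp
    next
      case 2
      then show ?thesis using new[of u] uw c'v by (simp add: insert_commute)
    next
      case 3
      then show ?thesis using c(2)[of u w] edge'[of u w] uw c'o[of u] c'o[of w] by simp
    qed
  qed
  have few: "card {e \<in> uedges G. e \<subseteq> Y} + 1 \<le> card Y"
    if Y: "Y \<subseteq> verts G" "Y \<noteq> {}" "\<not> {0, 1, 2} \<subseteq> c' ` Y" for Y
  proof -
    have fY: "finite Y" using Y finite_verts finite_subset by blast
    have fE: "finite (uedges G)" using S by (rule sgraph_finite_edges)
    have sub': "{e \<in> uedges G. e \<subseteq> Z} = {e \<in> uedges ?G'. e \<subseteq> Z}" if "v \<notin> Z" for Z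
    proof -
      have "e \<in> uedges G \<longleftrightarrow> e \<in> uedges ?G'" if "e \<subseteq> Z" for e
      proof
        assume e: "e \<in> uedges G"
        then obtain a b where "e = {a, b}" using sgraph_edge[OF S] by metis
        moreover have "a \<noteq> v" "b \<noteq> v" using calculation \<open>e \<subseteq> Z\<close> \<open>v \<notin> Z\<close> by auto
        ultimately show "e \<in> uedges ?G'" using e edge'[of a b] by simp
      next
        assume e: "e \<in> uedges ?G'"
        then obtain a b where "e = {a, b}" using sgraph_edge[OF sgraph_uedges[OF G']] by metis
        then show "e \<in> uedges G" using e edge'[of a b] by simp
      qed
      then show ?thesis by blast
    qed
    have old: "card {e \<in> uedges G. e \<subseteq> Z} + 1 \<le> card Z" if Z: "Z \<subseteq> Y" "v \<notin> Z" "Z \<noteq> {}" for Z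
    proof -
      have "c' u = c u" if "u \<in> Z" for u using c'o[of u] Z(2) that by blast
      then have "c' ` Z = c ` Z" by (rule image_cong[OF refl])
      moreover have "c' ` Z \<subseteq> c' ` Y" using Z(1) by (rule image_mono)
      ultimately have "\<not> {0, 1, 2} \<subseteq> c ` Z" using Y(3) by (metis order_trans)
      moreover have "Z \<subseteq> verts ?G'" using Z(1,2) Y(1) V' by blast
      ultimately have "card {e \<in> uedges ?G'. e \<subseteq> Z} + 1 \<le> card Z" using Z(3) by (intro c(3))
      then show ?thesis unfolding sub'[OF Z(2)] .
    qed
    show ?thesis
    proof (cases "v \<in> Y")
      case False
      then show ?thesis using old[of Y] Y by simp
    next
      case True
      let ?Z = "Y - {v}"
      \<comment> \<open>\<open>v\<close>, \<open>x\<close> and \<open>y\<close> carry all three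
        colours, so a set that misses a colour and contains \<open>v\<close> omits \<open>x\<close>
        or \<open>y\<close>. Adding \<open>v\<close> therefore adds at most one edge.\<close>
      have "\<not> (x \<in> Y \<and> y \<in> Y)"
      proof
        assume xyY: "x \<in> Y \<and> y \<in> Y"
        have "c x \<in> c' ` Y" "c y \<in> c' ` Y" "k \<in> c' ` Y"
          using xyY True c'v c'o[OF ne(1)] c'o[OF ne(2)] by (metis imageI)+
        then have "{c x, c y, k} \<subseteq> c' ` Y" by simp
        then show False using Y(3) unfolding all by blast
      qed
      moreover define u where "u = (if x \<in> Y then x else y)"
      ultimately have u: "w = u" if "w \<in> Y" "w = x \<or> w = y" for w using that by auto
      have key: "e = {v, u} \<and> u \<in> ?Z \<or> e \<subseteq> ?Z" if e: "e \<in> uedges G" "e \<subseteq> Y" for e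
      proof (cases "v \<in> e")
        case True
        obtain a b where ab: "e = {a, b}" using e(1) sgraph_edge[OF S] by metis
        then have "e = {v, b} \<or> e = {v, a}" using True by auto
        then obtain w where w: "e = {v, w}" by blast
        then have "w \<in> nbrs (uedges G) v" using e by (simp add: in_nbrs)
        then have "w = x \<or> w = y" unfolding Nv by simp
        moreover have "w \<in> Y" using w e(2) by simp
        moreover have "w \<noteq> v" using calculation(1) ne by blast
        ultimately show ?thesis using u[of w] w by simp
      next
        case False
        then show ?thesis using e by blast
      qed
      show ?thesis
      proof (cases "?Z = {}")
        case True
        have "{e \<in> uedges G. e \<subseteq> Y} = {}"
        proof (rule ccontr)
          assume "\<not> ?thesis"
          then obtain e where e: "e \<in> uedges G" "e \<subseteq> Y" by blast
          then have "e = {}" using key[OF e] True by simp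
          moreover have "card e = 2" using e S by (simp add: sgraph_def)
          ultimately show False by simp
        qed
        then have "card {e \<in> uedges G. e \<subseteq> Y} = 0" by (simp only: card.empty)
        moreover have "card Y > 0" using fY Y by (simp add: card_gt_0_iff)
        ultimately show ?thesis by linarith
      next
        case False
        have "{e \<in> uedges G. e \<subseteq> Y} \<subseteq> insert {v, u} {e \<in> uedges G. e \<subseteq> ?Z}" using key by blast
        then have "card {e \<in> uedges G. e \<subseteq> Y} \<le> card (insert {v, u} {e \<in> uedges G. e \<subseteq> ?Z})"
          using fE by (intro card_mono) simp_all
        also have "\<dots> \<le> Suc (card {e \<in> uedges G. e \<subseteq> ?Z})" using fE by (simp add: card_insert_if)
        finally have "card {e \<in> uedges G. e \<subseteq> Y} \<le> card ?Z" using old[of ?Z] False by simp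
        moreover have "Suc (card ?Z) = card Y" by (rule card_Suc_Diff1[OF fY \<open>v \<in> Y\<close>])
        ultimately show ?thesis by simp
      qed
    qed
  qed
  show ?case
    by (intro conjI exI[of _ c'] allI impI G range) (erule col, rule few)
qed

text \<open>A set inside two colour classes misses the third colour, so the colouring invariant
  applies to it; what remains is to name the classes in order of size.\<close>

lemma two_tree_tri_forest:
  assumes "two_tree G" "card (verts G) = 3 * t + 1" "3 \<le> t"
  shows "\<exists>A B C. tri_forest (verts G) (uedges G) A B C t"
proof -
  obtain c :: "'a \<Rightarrow> nat" where G: "graph G" and c: "c ` verts G \<subseteq> {0, 1, 2}"
    "\<forall>u v. {u, v} \<in> uedges G \<longrightarrow> c u \<noteq> c v"
    "\<forall>Y\<subseteq>verts G. Y \<noteq> {} \<longrightarrow> \<not> {0, 1, 2} \<subseteq> c ` Y \<longrightarrow> card {e \<in> uedges G. e \<subseteq> Y} + 1 \<le> card Y"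
    using two_tree_colouring[OF assms(1)] by (elim conjE exE) (rule that)
  define K where "K i = {u \<in> verts G. c u = i}" for i
  have main: ?thesis if ijk: "{i, j, k} = {0, 1, 2::nat}" "i \<noteq> j" "j \<noteq> k" "i \<noteq> k"
    "card (K k) \<le> card (K j)" "card (K j) \<le> card (K i)" for i j k
  proof -
    have "tri_forest (verts G) (uedges G) (K i) (K j) (K k) t"
    proof
      show "sgraph (verts G) (uedges G)" by (rule sgraph_uedges[OF G])
      have "u \<in> K i \<union> K j \<union> K k" if "u \<in> verts G" for u
      proof -
        have "c u \<in> {i, j, k}" unfolding ijk(1) using that by (intro subsetD[OF c(1)] imageI)
        then show ?thesis using that by (auto simp: K_def)
      qed
      then show "verts G = K i \<union> K j \<union> K k" by (auto simp: K_def)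
      show "K i \<inter> K j = {}" "K i \<inter> K k = {}" "K j \<inter> K k = {}" using ijk(2-4) by (auto simp: K_def)
      show "\<not> {x, y} \<subseteq> K i \<and> \<not> {x, y} \<subseteq> K j \<and> \<not> {x, y} \<subseteq> K k" if "{x, y} \<in> uedges G" for x y
        using c(2)[rule_format, OF that] by (auto simp: K_def)
      show "card {e \<in> uedges G. e \<subseteq> Y} + 1 \<le> card Y"
        if Y: "Y \<subseteq> K i \<union> K j \<or> Y \<subseteq> K i \<union> K k \<or> Y \<subseteq> K j \<union> K k" "Y \<noteq> {}" for Y
      proof (rule c(3)[rule_format])
        show "Y \<subseteq> verts G" using Y(1) by (auto simp: K_def)
        have "k \<notin> c ` Y \<or> j \<notin> c ` Y \<or> i \<notin> c ` Y" using Y(1) ijk(2-4) by (auto simp: K_def)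
        then show "\<not> {0, 1, 2} \<subseteq> c ` Y" unfolding ijk(1)[symmetric] by blast
      qed (rule Y(2))
    qed (use ijk(5,6) assms(2,3) in simp_all)
    then show ?thesis by blast
  qed
  consider "card (K 2) \<le> card (K 1)" "card (K 1) \<le> card (K 0)"
    | "card (K 1) \<le> card (K 2)" "card (K 2) \<le> card (K 0)"
    | "card (K 2) \<le> card (K 0)" "card (K 0) \<le> card (K 1)"
    | "card (K 0) \<le> card (K 2)" "card (K 2) \<le> card (K 1)"
    | "card (K 0) \<le> card (K 1)" "card (K 1) \<le> card (K 2)"
    | "card (K 1) \<le> card (K 0)" "card (K 0) \<le> card (K 2)" by linarith
  then show ?thesis
  proof cases
    case 1 show ?thesis by (rule main[of 0 1 2]) (use 1 in \<open>simp_all add: insert_commute\<close>)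
  next
    case 2 show ?thesis by (rule main[of 0 2 1]) (use 2 in \<open>simp_all add: insert_commute\<close>)
  next
    case 3 show ?thesis by (rule main[of 1 0 2]) (use 3 in \<open>simp_all add: insert_commute\<close>)
  next
    case 4 show ?thesis by (rule main[of 1 2 0]) (use 4 in \<open>simp_all add: insert_commute\<close>)
  next
    case 5 show ?thesis by (rule main[of 2 1 0]) (use 5 in \<open>simp_all add: insert_commute\<close>)
  next
    case 6 show ?thesis by (rule main[of 2 0 1]) (use 6 in \<open>simp_all add: insert_commute\<close>)
  qed
qed

lemma (in tri_forest) embeds_host:
  assumes "finite V" "sparse_host V t E \<or> cherry_host V t E \<or> matching_host V t E"
  shows "embeds X T V E"
proof -
  consider "clique_host V t E" | "cocktail_host V t E" | "path_host V t E"
    | s where "2 \<le> s" "s < t" "bipartite_host V t s E" | "cherry_host V t E" | "matching_host V t E"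
    using assms(2) unfolding sparse_host_def by (elim disjE exE conjE)
  then show ?thesis
  proof cases
    case 1 show ?thesis by (rule embeds_clique_host[OF assms(1) 1])
  next
    case 2 show ?thesis by (rule embeds_cocktail_host[OF assms(1) 2])
  next
    case 3 show ?thesis by (rule embeds_path_host[OF assms(1) 3])
  next
    case 4 show ?thesis by (rule embeds_bipartite_host[OF assms(1) 4])
  next
    case 5 show ?thesis by (rule embeds_cherry_host[OF assms(1) 5])
  next
    case 6 show ?thesis by (rule embeds_matching_host[OF assms(1) 6])
  qed
qed

section \<open>Return from edge sets to digraphs and degree sequences\<close>

definition pair_of_edges :: "'a set \<Rightarrow> 'a set set \<Rightarrow> 'a pair_pre_digraph" where
  "pair_of_edges V E = \<lparr> pverts = V, parcs = {(u, v). {u, v} \<in> E} \<rparr>"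

lemma pair_graph_pair_of_edges:
  assumes "sgraph V E" shows "pair_graph (pair_of_edges V E)"
proof -
  let ?G = "pair_of_edges V E"
  have G: "pverts ?G = V" "parcs ?G = {(u, v). {u, v} \<in> E}" by (simp_all add: pair_of_edges_def)
  have ends: "fst e \<in> V \<and> snd e \<in> V \<and> fst e \<noteq> snd e" if "e \<in> parcs ?G" for e
  proof -
    have "{fst e, snd e} \<in> E" using that unfolding G by (simp add: case_prod_beta)
    then show ?thesis using sgraph_ends[OF assms] sgraph_no_loop[OF assms] by metis
  qed
  have sub: "parcs ?G \<subseteq> V \<times> V" using ends by (simp add: subset_iff mem_Times_iff)
  have fV: "finite V" using assms by (rule sgraph_finite)
  show ?thesis
  proof
    show "finite (pverts ?G)" "finite (parcs ?G)" using fV finite_subset[OF sub] by (simp_all add: G(1))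
    show "symmetric (with_proj ?G)" by (simp add: symmetric_def G sym_def insert_commute)
  qed (simp_all add: ends G(1))
qed

lemma uedges_pair_of_edges:
  assumes "sgraph V E" shows "uedges (with_proj (pair_of_edges V E)) = E"
proof (intro equalityI subsetI)
  fix e assume "e \<in> uedges (with_proj (pair_of_edges V E))"
  then show "e \<in> E" by (auto simp: uedges_def pair_of_edges_def)
next
  fix e assume e: "e \<in> E"
  then obtain u v where uv: "e = {u, v}" using sgraph_edge[OF assms] by metis
  then have "(u, v) \<in> arcs_ends (with_proj (pair_of_edges V E))" using e by (simp add: pair_of_edges_def)
  then show "e \<in> uedges (with_proj (pair_of_edges V E))" unfolding uedges_def using uv by blast
qed

lemma degree_sequence_pair_of_edges:
  assumes "realizes V d E"
  shows "degree_sequence (with_proj (pair_of_edges V E)) =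
    rev (sorted_list_of_multiset (image_mset d (mset_set V)))"
proof -
  have S: "sgraph V E" using assms by (rule realizes_sgraph)
  interpret pair_graph "pair_of_edges V E" by (rule pair_graph_pair_of_edges[OF S])
  have "out_degree (with_proj (pair_of_edges V E)) x = d x" if "x \<in> V" for x
    using out_degree_eq_card_nbrs[OF pair_graphD_graph] uedges_pair_of_edges[OF S]
      realizes_card_nbrs[OF assms that] by simp
  then have "image_mset (out_degree (with_proj (pair_of_edges V E))) (mset_set V) = image_mset d (mset_set V)"
    using sgraph_finite[OF S] by (intro image_mset_cong) auto
  then show ?thesis by (simp add: degree_sequence_def pair_of_edges_def)
qed

lemma contains_copy_pair_of_edges:
  assumes S: "sgraph V E" and T: "pair_graph T" and emb: "embeds (pverts T) (uedges (with_proj T)) V E"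
  shows "contains_copy (pair_of_edges V E) T"
proof -
  interpret T: pair_graph T by (rule T)
  obtain f where f: "inj_on f (pverts T)" "f ` pverts T \<subseteq> V"
    "\<forall>x y. {x, y} \<in> uedges (with_proj T) \<longrightarrow> {f x, f y} \<in> E"
    using emb unfolding embeds_def by blast
  have "(f u, f v) \<in> parcs (pair_of_edges V E)" if "(u, v) \<in> parcs T" for u v
  proof -
    have "{u, v} \<in> uedges (with_proj T)" using that in_uedges[OF T.pair_graphD_graph] by simp
    then show ?thesis using f(3) by (simp add: pair_of_edges_def)
  qed
  then show ?thesis
    unfolding contains_copy_iff[OF pair_graph_pair_of_edges[OF S] T]
    using f(1,2) by (intro exI[of _ f]) (auto simp: pair_of_edges_def)
qed

theorem theorem4p2:
  fixes t n :: nat and \<pi> :: "nat list"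
  assumes "t \<ge> 3"
    and "n \<ge> 20 * t^2 + 23 * t + 5"
    and "length \<pi> = n"
    and "graphic \<pi>"
    and "int (sum_list \<pi>) > 4 * int t * int n - 2 * int n - 4 * (int t)^2 + 2 * int t + 2"
  shows "\<exists>G :: nat pair_pre_digraph. realization G \<pi> \<and>
    (\<forall>T :: nat pair_pre_digraph.
      two_tree (with_proj T) \<and> card (pverts T) = 3 * t + 1 \<longrightarrow> contains_copy G T)"
proof -
  obtain G0 :: "nat pair_pre_digraph" where G0: "pair_graph G0" "degree_sequence (with_proj G0) = \<pi>"
    using assms(4) unfolding graphic_def realization_def by blast
  interpret G0: pair_graph G0 by (rule G0(1))
  define V where "V = pverts G0"
  define d where "d = out_degree (with_proj G0)"
  define E0 where "E0 = uedges (with_proj G0)"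
  have fV: "finite V" by (simp add: V_def)
  have g: "graph (with_proj G0)" by (rule G0.pair_graphD_graph)
  have R: "realizes V d E0"
    using sgraph_uedges[OF g] out_degree_eq_card_nbrs[OF g]
    by (simp add: realizes_def V_def d_def E0_def)
  have \<pi>: "\<pi> = rev (sorted_list_of_multiset (image_mset d (mset_set V)))"
    using G0(2) by (simp add: degree_sequence_def V_def d_def)
  have cV: "card V = n" using length_degree_sequence[of "with_proj G0"] G0(2) assms(3) by (simp add: V_def)
  have "sum_list \<pi> = sum_mset (mset \<pi>)" by (simp add: sum_mset_sum_list)
  also have "mset \<pi> = image_mset d (mset_set V)" unfolding \<pi> by simp
  also have "sum_mset \<dots> = (\<Sum>x\<in>V. d x)" by (simp add: sum_unfold_sum_mset)
  also have "\<dots> = 2 * card E0" using realizes_card_edges[OF R] by simp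
  finally have sum: "sum_list \<pi> = 2 * card E0" .
  have e: "(2 * t - 1) * (card V - t) + 2 \<le> card E0"
  proof -
    have "t \<le> n" using assms(2) by simp
    then have "int ((2 * t - 1) * (n - t)) = (2 * int t - 1) * (int n - int t)"
      using assms(1) by (simp add: of_nat_diff)
    \<comment> \<open>The threshold for the sum of degrees is \<open>2 (r (n - t) + 1)\<close>. The
      sum is twice the number of edges, so exceeding it means at least \<open>r (n - t) + 2\<close>
      edges.\<close>
    moreover have "2 * ((2 * int t - 1) * (int n - int t) + 1) < 2 * int (card E0)"
      using assms(5) unfolding sum by (simp add: algebra_simps power2_eq_square)
    ultimately have "2 * (int ((2 * t - 1) * (n - t)) + 1) < 2 * int (card E0)" by metis
    then have "int ((2 * t - 1) * (n - t)) + 1 < int (card E0)" by (simp only: mult_less_cancel_left_pos zero_less_numeral)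
    then show ?thesis unfolding cV by linarith
  qed
  have n: "20 * t^2 + 23 * t + 5 \<le> card V" using assms(2) cV by simp
  obtain E where E: "realizes V d E" "sparse_host V t E \<or> cherry_host V t E \<or> matching_host V t E"
    using exists_host[OF R assms(1) n e] by blast
  have S: "sgraph V E" using E(1) by (rule realizes_sgraph)
  let ?G = "pair_of_edges V E"
  have "realization ?G \<pi>"
    unfolding realization_def using pair_graph_pair_of_edges[OF S] degree_sequence_pair_of_edges[OF E(1)] \<pi> by simp
  moreover have "contains_copy ?G T"
    if T: "two_tree (with_proj T)" "card (pverts T) = 3 * t + 1" for T :: "nat pair_pre_digraph"
  proof -
    have "graph (with_proj T)" using two_tree_colouring[OF T(1)] by blast
    then have PT: "pair_graph T" by (rule pair_graphI_graph)
    have "card (verts (with_proj T)) = 3 * t + 1" using T(2) by simp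
    from two_tree_tri_forest[OF T(1) this assms(1)] obtain A B C
      where "tri_forest (verts (with_proj T)) (uedges (with_proj T)) A B C t" by blast
    then have "embeds (verts (with_proj T)) (uedges (with_proj T)) V E"
      by (rule tri_forest.embeds_host[OF _ fV E(2)])
    then show ?thesis using contains_copy_pair_of_edges[OF S PT] by simp
  qed
  ultimately show ?thesis by blast
qed

end
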